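(* Let $X$ be an Asplund space, let $m\ge2$, and let $\bar{x}$ be a rated extremal point of rank $\alpha\in[0,1)$ for a system of sets $\Omega_1,\ldots,\Omega_m\subset X$ locally closed around $\bar{x}$. Assume that all but one of the sets $\Omega_i$, $i=1,\ldots,m$, are sequentially normally compact (SNC) at $\bar{x}$. Then the exact extremal principle holds for $\{\Omega_1,\ldots,\Omega_m\}$ at $\bar{x}$; that is, there are $x_i^*\in N(\bar{x};\Omega_i)$, $i=1,\ldots,m$, such that $$x_1^*+\ldots+x_m^*=0\quad\text{and}\quad\|x_1^*\|^2+\ldots+\|x_m^*\|^2=1.$$
   Context: A Banach space is Asplund if each of its separable subspaces has a separable dual. $B(\bar{x},\rho)$ is the closed ball centered at $\bar{x}$ with radius $\rho$. Rated extremality: for nonempty sets $\Omega_1,\ldots,\Omega_m\subset X$ with common point $\bar{x}$, $\bar{x}$ is a rated extremal point of rank $\alpha$, $0\le\alpha<1$, of $\{\Omega_1,\ldots,\Omega_m\}$ if there are $\gamma>0$ and sequences $\{a_{ik}\}_{k\in\mathbb{N}}\subset X$, $i=1,\ldots,m$, such that $r_k:=\max_i\|a_{ik}\|\to0$ as $k\to\infty$ and $\bigcap_{i=1}^m(\Omega_i-a_{ik})\cap B(\bar{x},\gamma r_k^\alpha)=\emptyset$ for all large $k\in\mathbb{N}$. Normals: for $\Omega\subset X$ and $\varepsilon\ge0$ put $\widehat{N}_\varepsilon(x;\Omega):=\{x^*\in X^*\mid\limsup_{u\to x,\,u\in\Omega}\frac{\langle x^*,u-x\rangle}{\|u-x\|}\le\varepsilon\}$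 if $x\in\Omega$ and $\widehat{N}_\varepsilon(x;\Omega):=\emptyset$ if $x\notin\Omega$; the Fréchet normal cone is $\widehat{N}(x;\Omega):=\widehat{N}_0(x;\Omega)$. The limiting (basic) normal cone $N(\bar{x};\Omega)$ is the set of all $x^*\in X^*$ for which there are sequences $\varepsilon_k\downarrow0$, $x_k\to\bar{x}$ and $x_k^*\to x^*$ in the weak$^*$ topology with $x_k^*\in\widehat{N}_{\varepsilon_k}(x_k;\Omega)$ for all $k\in\mathbb{N}$ (in Asplund spaces and for $\Omega$ locally closed around $\bar{x}$ one can equivalently take $\varepsilon_k=0$). SNC: a set $\Omega\subset X$ is sequentially normally compact at $\bar{x}\in\Omega$ if for every sequence $\{(x_k,x_k^* )\}_{k\in\mathbb{N}}\subset\Omega\times X^*$ with $x_k\to\bar{x}$, $x_k^*\to0$ weak$^*$, and $x_k^*\in\widehat{N}(x_k;\Omega)$ for all $k$, one has $\|x_k^*\|\to0$. *)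

theory Defs
  imports "HOL-Analysis.Analysis"
begin

section \<open>Asplund spaces\<close>

text \<open>
  The topological dual of a linear subspace \<open>Y\<close> consists of the bounded linear functionals on
  \<open>Y\<close> itself (\<open>extensional\<close>: they are \<open>undefined\<close> off \<open>Y\<close>), with the operator norm over \<open>Y\<close>.
\<close>

definition dual_of :: "'a::real_normed_vector set \<Rightarrow> ('a \<Rightarrow> real) set" where
  "dual_of Y = {f \<in> extensional Y.
     (\<forall>x\<in>Y. \<forall>y\<in>Y. f (x + y) = f x + f y) \<and>
     (\<forall>c. \<forall>x\<in>Y. f (c *\<^sub>R x) = c * f x) \<and>
     (\<exists>K. \<forall>x\<in>Y. \<bar>f x\<bar> \<le> K * norm x)}"

definition dual_norm :: "'a::real_normed_vector set \<Rightarrow> ('a \<Rightarrow> real) \<Rightarrow> real" where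
  "dual_norm Y f = (SUP y \<in> Y \<inter> cball 0 1. \<bar>f y\<bar>)"

definition separable_dual :: "'a::real_normed_vector set \<Rightarrow> bool" where
  "separable_dual Y \<longleftrightarrow>
     (\<exists>D. countable D \<and> D \<subseteq> dual_of Y \<and>
       (\<forall>f\<in>dual_of Y. \<forall>e>0. \<exists>g\<in>D. dual_norm Y (\<lambda>y. f y - g y) < e))"

text \<open>
  Whether \<open>Y\<close> ranges over all linear subspaces or only the closed ones is immaterial: a subspace
  and its closure are separable simultaneously and have the same dual.
\<close>

definition asplund :: "'a::banach itself \<Rightarrow> bool" where
  "asplund TYPE('a) \<longleftrightarrow>
     (\<forall>Y::'a set. subspace Y \<and> separable_space (top_of_set Y) \<longrightarrow> separable_dual Y)"


section \<open>Generalized normals\<close>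

text \<open>
  The dual space of \<open>'a\<close> is the type \<open>'a \<Rightarrow>\<^sub>L real\<close>. The strong operator topology on it is the topology
  of pointwise convergence, which for real-valued functionals is the weak-star topology.
\<close>

abbreviation weak_star_topology :: "('a::real_normed_vector \<Rightarrow>\<^sub>L real) topology" where
  "weak_star_topology \<equiv> strong_operator_topology"

text \<open>
  The limsup is taken in the extended reals over \<open>u \<noteq> x\<close>. At an isolated point \<open>x\<close> of \<open>\<Omega>\<close> it is
  \<open>-\<infinity>\<close>, so that every functional is a normal there.
\<close>

definition eps_normals ::
    "real \<Rightarrow> 'a::real_normed_vector \<Rightarrow> 'a set \<Rightarrow> ('a \<Rightarrow>\<^sub>L real) set" where
  "eps_normals \<epsilon> x \<Omega> =
     (if x \<in> \<Omega>
      then {x'. Limsup (at x within \<Omega>)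
                  (\<lambda>u. ereal (blinfun_apply x' (u - x) / norm (u - x))) \<le> ereal \<epsilon>}
      else {})"

definition frechet_normal_cone ::
    "'a::real_normed_vector \<Rightarrow> 'a set \<Rightarrow> ('a \<Rightarrow>\<^sub>L real) set" where
  "frechet_normal_cone x \<Omega> = eps_normals 0 x \<Omega>"

definition limiting_normal_cone ::
    "'a::real_normed_vector \<Rightarrow> 'a set \<Rightarrow> ('a \<Rightarrow>\<^sub>L real) set" where
  "limiting_normal_cone xbar \<Omega> =
     {x'. \<exists>(\<epsilon> :: nat \<Rightarrow> real) (x :: nat \<Rightarrow> 'a) (xs :: nat \<Rightarrow> 'a \<Rightarrow>\<^sub>L real).
        (\<forall>k. 0 \<le> \<epsilon> k) \<and> decseq \<epsilon> \<and> \<epsilon> \<longlonglongrightarrow> 0 \<and>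
        x \<longlonglongrightarrow> xbar \<and>
        limitin weak_star_topology xs x' sequentially \<and>
        (\<forall>k. xs k \<in> eps_normals (\<epsilon> k) (x k) \<Omega>)}"

definition SNC_at :: "'a::real_normed_vector set \<Rightarrow> 'a \<Rightarrow> bool" where
  "SNC_at \<Omega> xbar \<longleftrightarrow>
     (\<forall>(x :: nat \<Rightarrow> 'a) (xs :: nat \<Rightarrow> 'a \<Rightarrow>\<^sub>L real).
        (\<forall>k. x k \<in> \<Omega>) \<and> x \<longlonglongrightarrow> xbar \<and>
        limitin weak_star_topology xs 0 sequentially \<and>
        (\<forall>k. xs k \<in> frechet_normal_cone (x k) \<Omega>)
        \<longrightarrow> (\<lambda>k. norm (xs k)) \<longlonglongrightarrow> 0)"


section \<open>Systems of sets\<close>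

definition locally_closed_at :: "'a::real_normed_vector set \<Rightarrow> 'a \<Rightarrow> bool" where
  "locally_closed_at \<Omega> xbar \<longleftrightarrow> (\<exists>\<rho>>0. closed (\<Omega> \<inter> cball xbar \<rho>))"

text \<open>
  The system is \<open>\<Omega> 1, \<dots>, \<Omega> m\<close>; values of \<open>\<Omega>\<close> at other indices play no role. The convention
  \<open>0 powr 0 = 0\<close> is harmless: if \<open>r k = 0\<close>, then all \<open>a i k\<close> vanish and the intersection contains
  \<open>xbar\<close> whatever the radius \<open>\<ge> 0\<close>, so for large \<open>k\<close> only \<open>r k > 0\<close> can occur.
\<close>

definition rated_extremal_point ::
    "real \<Rightarrow> nat \<Rightarrow> (nat \<Rightarrow> 'a::real_normed_vector set) \<Rightarrow> 'a \<Rightarrow> bool" where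
  "rated_extremal_point \<alpha> m \<Omega> xbar \<longleftrightarrow>
     0 \<le> \<alpha> \<and> \<alpha> < 1 \<and>
     (\<forall>i\<in>{1..m}. xbar \<in> \<Omega> i) \<and>
     (\<exists>\<gamma>>0. \<exists>a :: nat \<Rightarrow> nat \<Rightarrow> 'a.
        let r = (\<lambda>k. Max ((\<lambda>i. norm (a i k)) ` {1..m})) in
          r \<longlonglongrightarrow> 0 \<and>
          (\<forall>\<^sub>F k in sequentially.
             (\<Inter>i\<in>{1..m}. (\<lambda>w. w - a i k) ` \<Omega> i) \<inter> cball xbar (\<gamma> * r k powr \<alpha>) = {}))"

end

(* A rated extremal point almost minimises the function g z = sum over i < m of
   norm ((z i - a i) - (z m - a m)) on the product of the sets, and g is positive there.  Minimising
   g plus small perturbations, once with norms (Ekeland) and once with smooth approximations of the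
   norm, gives approximate Frechet normals with small sum.  Smooth approximations exist only along
   a separable subspace Y: a dense sequence in the dual of Y yields a locally uniformly convex
   weak-star lower semicontinuous penalty, whose conjugate is smooth along Y.  A separable
   reduction based on the Hahn-Banach theorem chooses Y so that Frechet normals along Y lift to
   the whole space.  In an Asplund space bounded sequences of functionals have weak-star
   convergent subsequences, because upper limits of functionals are almost Frechet differentiable
   somewhere; SNC then keeps the limits of the normals from all vanishing. *)

theory Submission
  imports Defs "HOL-Library.Diagonal_Subsequence"
begin

section \<open>The Hahn--Banach theorem and subgradients\<close>

text \<open>Why \<open>g\<close> is minimised twice: a norm is not differentiable, and smoothing it
  changes \<open>g\<close> by an error that must be small compared with the value of
  \<open>g\<close> at the minimiser. That value is positive by extremality but has no lower bound
  known in advance. The first minimisation fixes a point \<open>u1\<close> with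
  \<open>g u1 > 0\<close>; only then is the smoothing error chosen. Smoothness is needed because a
  subgradient at a constrained minimiser is minus a Frechet normal only if the function is
  differentiable there. The normals do not degenerate: a tuple \<open>b\<close> whose coordinate
  norms add up to \<open>2 * \<beta>\<close> cancels all differences in \<open>g\<close> and lowers
  the minimised function by at least \<open>\<beta>\<close>. Their sum is small because
  \<open>g\<close> is constant in diagonal directions. The rank \<alpha> < 1 enters through a single
  fact: r is of smaller order than r powr \<alpha>. At the common point \<open>g\<close> has order
  r, while the radius on which the shifted sets do not meet has order r powr \<alpha>; the quotient,
  which governs the slope of the perturbations, can be made arbitrarily small.\<close>

definition sublinear :: "('z::real_vector \<Rightarrow> real) \<Rightarrow> bool" where
  "sublinear p \<longleftrightarrow> (\<forall>x y. p (x + y) \<le> p x + p y) \<and> (\<forall>t\<ge>0. \<forall>x. p (t *\<^sub>R x) = t * p x)"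

lemma sublinear_add: "sublinear p \<Longrightarrow> p (x + y) \<le> p x + p y"
  and sublinear_scaleR: "sublinear p \<Longrightarrow> t \<ge> 0 \<Longrightarrow> p (t *\<^sub>R x) = t * p x"
  by (auto simp: sublinear_def)

lemma sublinear_zero: "sublinear p \<Longrightarrow> p 0 = 0"
  using sublinear_scaleR[of p 0 0] by simp

lemma sublinear_minus: "sublinear p \<Longrightarrow> - p (- x) \<le> p x"
  using sublinear_add[of p x "- x"] sublinear_zero[of p] by simp

lemma sublinearI:
  assumes add: "\<And>x y. p (x + y) \<le> p x + p y"
    and scale: "\<And>t x. t > 0 \<Longrightarrow> p (t *\<^sub>R x) \<le> t * p x"
    and zero: "p 0 = 0"
  shows "sublinear p"
  unfolding sublinear_def
proof (intro conjI allI impI add)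
  fix t :: real and x assume "t \<ge> 0"
  show "p (t *\<^sub>R x) = t * p x"
  proof (cases "t = 0")
    case True
    then show ?thesis using zero by simp
  next
    case False
    with \<open>t \<ge> 0\<close> have t: "t > 0" by simp
    have "p x = p ((1/t) *\<^sub>R (t *\<^sub>R x))" using t by simp
    also have "\<dots> \<le> (1/t) * p (t *\<^sub>R x)" using t by (intro scale) simp
    finally have "t * p x \<le> p (t *\<^sub>R x)" using t by (simp add: field_simps)
    with scale[OF t, of x] show ?thesis by simp
  qed
qed

lemma linear_of_sublinear_odd:
  assumes p: "sublinear p" and odd: "\<And>x. p (- x) \<le> - p x"
  shows "linear p"
proof -
  have odd': "p (- x) = - p x" for x
    using odd[of x] sublinear_minus[OF p, of x] by linarith
  show ?thesis
  proof (rule linearI)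
    fix x y
    have "p x \<le> p (x + y) + p (- y)" using sublinear_add[OF p, of "x + y" "- y"] by simp
    then show "p (x + y) = p x + p y"
      using sublinear_add[OF p, of x y] odd'[of y] by simp
  next
    fix t :: real and x
    show "p (t *\<^sub>R x) = t *\<^sub>R p x"
    proof (cases "t \<ge> 0")
      case True
      then show ?thesis using sublinear_scaleR[OF p] by simp
    next
      case False
      then have "p (t *\<^sub>R x) = p (- ((- t) *\<^sub>R x))" by simp
      also have "\<dots> = - ((- t) * p x)"
        using False odd' sublinear_scaleR[OF p, of "- t" x] by (metis neg_0_le_iff_le linear)
      finally show ?thesis by simp
    qed
  qed
qed

text \<open>The largest sublinear function below \<open>p\<close> whose value at \<open>- x\<close>
  is at most \<open>- p x\<close>: every such \<open>q\<close> satisfies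
  \<open>q y \<le> q (y + t *\<^sub>R x) + t * q (- x)\<close> for \<open>t \<ge> 0\<close>.\<close>

definition ray_inf :: "('z::real_vector \<Rightarrow> real) \<Rightarrow> 'z \<Rightarrow> 'z \<Rightarrow> real" where
  "ray_inf p x y = (INF t\<in>{0..}. p (y + t *\<^sub>R x) - t * p x)"

lemma ray_inf_le:
  assumes "sublinear p" "t \<ge> 0"
  shows "ray_inf p x y \<le> p (y + t *\<^sub>R x) - t * p x"
proof -
  have "- p (- y) \<le> p (y + t *\<^sub>R x) - t * p x" if "t \<ge> 0" for t
    using sublinear_add[OF assms(1), of "y + t *\<^sub>R x" "- y"] sublinear_scaleR[OF assms(1) that, of x]
    by simp
  then have "bdd_below ((\<lambda>t. p (y + t *\<^sub>R x) - t * p x) ` {0..})"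
    by (intro bdd_belowI[of _ "- p (- y)"]) auto
  then show ?thesis
    unfolding ray_inf_def using assms(2) by (intro cINF_lower) auto
qed

lemma ray_inf_greatest:
  assumes "\<And>t. t \<ge> 0 \<Longrightarrow> c \<le> p (y + t *\<^sub>R x) - t * p x"
  shows "c \<le> ray_inf p x y"
  unfolding ray_inf_def using assms by (intro cINF_greatest) auto

lemma ray_inf_le_self: "sublinear p \<Longrightarrow> ray_inf p x y \<le> p y"
  using ray_inf_le[of p 0 x y] by simp

lemma ray_inf_minus: "sublinear p \<Longrightarrow> ray_inf p x (- x) \<le> - p x"
  using ray_inf_le[of p 1 x "- x"] sublinear_zero[of p] by simp

lemma sublinear_ray_inf:
  assumes p: "sublinear p"
  shows "sublinear (ray_inf p x)"
proof (rule sublinearI)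
  fix y z
  have "ray_inf p x (y + z) - (p (z + s *\<^sub>R x) - s * p x) \<le> p (y + t *\<^sub>R x) - t * p x"
    if "t \<ge> 0" "s \<ge> 0" for s t
  proof -
    have "ray_inf p x (y + z) \<le> p ((y + t *\<^sub>R x) + (z + s *\<^sub>R x)) - (t + s) * p x"
      using ray_inf_le[OF p, of "t + s" x "y + z"] that by (simp add: algebra_simps)
    also have "\<dots> \<le> p (y + t *\<^sub>R x) + p (z + s *\<^sub>R x) - (t + s) * p x"
      using sublinear_add[OF p] by simp
    finally show ?thesis by (simp add: algebra_simps)
  qed
  then have "ray_inf p x (y + z) - (p (z + s *\<^sub>R x) - s * p x) \<le> ray_inf p x y" if "s \<ge> 0" for s
    using that by (intro ray_inf_greatest) auto
  then have "ray_inf p x (y + z) - ray_inf p x y \<le> ray_inf p x z"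
    by (intro ray_inf_greatest) (simp add: algebra_simps)
  then show "ray_inf p x (y + z) \<le> ray_inf p x y + ray_inf p x z" by simp
next
  fix t :: real and y assume t: "t > 0"
  have "ray_inf p x (t *\<^sub>R y) / t \<le> p (y + s *\<^sub>R x) - s * p x" if "s \<ge> 0" for s
  proof -
    have "ray_inf p x (t *\<^sub>R y) \<le> p (t *\<^sub>R y + (t * s) *\<^sub>R x) - (t * s) * p x"
      using ray_inf_le[OF p, of "t * s" x] that t by simp
    also have "p (t *\<^sub>R y + (t * s) *\<^sub>R x) = t * p (y + s *\<^sub>R x)"
      using sublinear_scaleR[OF p, of t "y + s *\<^sub>R x"] t by (simp add: algebra_simps)
    finally show ?thesis using t by (simp add: field_simps)
  qed
  then have "ray_inf p x (t *\<^sub>R y) / t \<le> ray_inf p x y" by (rule ray_inf_greatest)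
  then show "ray_inf p x (t *\<^sub>R y) \<le> t * ray_inf p x y" using t by (simp add: field_simps)
next
  have "0 \<le> ray_inf p x 0"
    using sublinear_scaleR[OF p] by (intro ray_inf_greatest) simp
  then show "ray_inf p x 0 = 0"
    using ray_inf_le_self[OF p, of x 0] sublinear_zero[OF p] by simp
qed

text \<open>Zorn's lemma for the reversed order \<open>P\<close>. The pointwise infimum of a chain
  is finite because sublinear functions below \<open>p\<close> stay above \<open>- p (- x)\<close>,
  and it is subadditive because of any two members one lies below the other.\<close>

lemma minimal_sublinear:
  fixes p :: "'z::real_vector \<Rightarrow> real"
  assumes p: "sublinear p"
  shows "\<exists>q. sublinear q \<and> q \<le> p \<and> (\<forall>q'. sublinear q' \<longrightarrow> q' \<le> q \<longrightarrow> q' = q)"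
proof -
  define A where "A = {q. sublinear q \<and> q \<le> p}"
  define P where "P = (\<lambda>a b :: 'z \<Rightarrow> real. b \<le> a)"
  have po: "partial_order_on A (relation_of P A)"
    by (rule partial_order_on_relation_ofI) (auto simp: P_def)
  have "\<exists>u\<in>A. \<forall>a\<in>C. P a u" if C: "C \<in> Chains (relation_of P A)" for C
  proof (cases "C = {}")
    case True
    then show ?thesis using p by (auto simp: A_def)
  next
    case False
    have CA: "sublinear q" "q \<le> p" if "q \<in> C" for q
      using C that by (auto simp: Chains_def relation_of_def A_def)
    have tot: "q \<le> r \<or> r \<le> q" if "q \<in> C" "r \<in> C" for q r
      using C that by (auto simp: Chains_def relation_of_def P_def)
    define u where "u x = (INF q\<in>C. q x)" for x
    have lower: "- p (- x) \<le> q x" if "q \<in> C" for q x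
      using sublinear_minus[OF CA(1)[OF that], of x] CA(2)[OF that, THEN le_funD, of "- x"] by simp
    have u_le: "u x \<le> q x" if "q \<in> C" for q x
      unfolding u_def using that lower by (intro cINF_lower bdd_belowI) auto
    have u_ge: "c \<le> u x" if "\<And>q. q \<in> C \<Longrightarrow> c \<le> q x" for c x
      unfolding u_def using that False by (intro cINF_greatest) auto
    have "sublinear u"
    proof (rule sublinearI)
      fix x y
      have "u (x + y) - q x \<le> r y" if "q \<in> C" "r \<in> C" for q r
      proof -
        have "\<exists>s\<in>C. s \<le> q \<and> s \<le> r" using tot[OF that] that by auto
        then obtain s where s: "s \<in> C" "s \<le> q" "s \<le> r" by blast
        have "u (x + y) \<le> s x + s y"
          using u_le[OF s(1), of "x + y"] sublinear_add[OF CA(1)[OF s(1)], of x y] by linarith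
        then show ?thesis using s(2,3)[THEN le_funD, of x] s(2,3)[THEN le_funD, of y] by linarith
      qed
      then have "u (x + y) - q x \<le> u y" if "q \<in> C" for q
        using that by (intro u_ge) auto
      then have "u (x + y) - u y \<le> u x" by (intro u_ge) (simp add: algebra_simps)
      then show "u (x + y) \<le> u x + u y" by simp
    next
      fix t :: real and x assume t: "t > 0"
      have "u (t *\<^sub>R x) / t \<le> q x" if "q \<in> C" for q
        using u_le[OF that, of "t *\<^sub>R x"] sublinear_scaleR[OF CA(1)[OF that], of t x] t
        by (simp add: field_simps)
      then have "u (t *\<^sub>R x) / t \<le> u x" by (rule u_ge)
      then show "u (t *\<^sub>R x) \<le> t * u x" using t by (simp add: field_simps)
    next
      have "q 0 = 0" if "q \<in> C" for q using CA(1)[OF that] by (rule sublinear_zero)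
      then have "(\<lambda>q. q 0) ` C = {0}" using False by (auto simp: image_iff)
      then show "u 0 = 0" by (simp add: u_def)
    qed
    moreover have "u \<le> p"
    proof -
      obtain q where "q \<in> C" using False by auto
      then show ?thesis using u_le[of q] CA(2)[of q] by (meson le_funI le_funD order_trans)
    qed
    ultimately have "u \<in> A" by (simp add: A_def)
    then show ?thesis using u_le by (auto simp: P_def le_fun_def intro!: bexI[of _ u])
  qed
  from predicate_Zorn[OF po this] obtain q where q: "q \<in> A" "\<And>a. a \<in> A \<Longrightarrow> P q a \<Longrightarrow> a = q"
    by blast
  have "q' = q" if "sublinear q'" "q' \<le> q" for q'
    using q that by (auto simp: A_def P_def intro: order_trans)
  then show ?thesis using q(1) by (auto simp: A_def)
qed

text \<open>A minimal sublinear \<open>q\<close> equals \<open>ray_inf q x\<close> for every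
  \<open>x\<close>, hence is odd, hence linear. Minimising below \<open>ray_inf p x0\<close> instead
  of \<open>p\<close> forces \<open>q (- x0) \<le> - p x0\<close>, which gives equality at
  \<open>x0\<close>.\<close>

theorem hahn_banach_sublinear:
  fixes p :: "'z::real_vector \<Rightarrow> real"
  assumes p: "sublinear p"
  obtains f where "linear f" "\<And>x. f x \<le> p x" "f x0 = p x0"
proof -
  obtain q where q: "sublinear q" "q \<le> ray_inf p x0"
    and min: "\<And>q'. sublinear q' \<Longrightarrow> q' \<le> q \<Longrightarrow> q' = q"
    using minimal_sublinear[OF sublinear_ray_inf[OF p, of x0]] by blast
  have odd: "q (- x) \<le> - q x" for x
  proof -
    have "ray_inf q x = q"
      using sublinear_ray_inf[OF q(1)] ray_inf_le_self[OF q(1)] by (intro min) (auto simp: le_fun_def)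
    then show ?thesis using ray_inf_minus[OF q(1), of x] by simp
  qed
  have lin: "linear q" by (rule linear_of_sublinear_odd[OF q(1) odd])
  have le: "q x \<le> p x" for x
    using q(2)[THEN le_funD, of x] ray_inf_le_self[OF p, of x0 x] by linarith
  have "q (- x0) \<le> - p x0"
    using q(2)[THEN le_funD, of "- x0"] ray_inf_minus[OF p, of x0] by linarith
  then have "q x0 = p x0" using le[of x0] linear_neg[OF lin, of x0] by simp
  with lin le show ?thesis using that by blast
qed

section \<open>Bounded functionals and norming functionals\<close>

lemma blinfun_of_linear_le_norm:
  fixes f :: "'z::real_normed_vector \<Rightarrow> real"
  assumes lin: "linear f" and le: "\<And>x. f x \<le> K * norm x" and K: "K \<ge> 0"
  obtains g :: "'z \<Rightarrow>\<^sub>L real" where "\<And>x. blinfun_apply g x = f x" "norm g \<le> K"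
proof -
  have b: "\<bar>f x\<bar> \<le> norm x * K" for x
    using le[of x] le[of "- x"] linear_neg[OF lin, of x] by (simp add: abs_le_iff mult.commute)
  then have "bounded_linear f"
    using lin by (intro bounded_linear_intro[of f K]) (auto simp: linear_add linear_scale)
  then have "blinfun_apply (Blinfun f) = f" by (rule bounded_linear_Blinfun_apply)
  moreover from this have "norm (Blinfun f) \<le> K"
    using b K by (intro norm_blinfun_bound) (auto simp: mult.commute)
  ultimately show ?thesis by (intro that[of "Blinfun f"]) auto
qed

lemma abs_blinfun_le_norm:
  fixes f :: "'z::real_normed_vector \<Rightarrow>\<^sub>L real"
  shows "norm f \<le> 1 \<Longrightarrow> \<bar>blinfun_apply f x\<bar> \<le> norm x"
  using norm_blinfun[of f x] mult_right_mono[of "norm f" 1 "norm x"] by simp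

lemma sublinear_norm: "sublinear (norm :: 'z::real_normed_vector \<Rightarrow> real)"
  by (auto simp: sublinear_def norm_triangle_ineq)

lemma norming_functional:
  fixes x :: "'z::real_normed_vector"
  obtains g :: "'z \<Rightarrow>\<^sub>L real" where "norm g \<le> 1" "blinfun_apply g x = norm x"
proof -
  obtain f :: "'z \<Rightarrow> real" where f: "linear f" "\<And>y. f y \<le> norm y" "f x = norm x"
    by (rule hahn_banach_sublinear[OF sublinear_norm, where ?x0.0 = x], rule that)
  obtain g :: "'z \<Rightarrow>\<^sub>L real" where "\<And>y. blinfun_apply g y = f y" "norm g \<le> 1"
    by (rule blinfun_of_linear_le_norm[OF f(1), of 1]) (use f(2) in auto)
  then show ?thesis using that f(3) by auto
qed

text \<open>\<open>p\<close> is the one-sided directional derivative of \<open>f\<close> at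
  \<open>u\<close>, written as an infimum because the difference quotients of a convex function are
  nondecreasing in \<open>t\<close>. It is finite thanks to \<open>\<rho>\<close>: convexity between
  \<open>u + t *\<^sub>R h\<close> and \<open>u - h\<close> bounds the quotients below by
  \<open>- \<rho> (- h)\<close>.\<close>

lemma sublinear_dir_quotient:
  fixes f :: "'z::real_vector \<Rightarrow> real"
  assumes cvx: "convex_on UNIV f" and \<rho>: "sublinear \<rho>" and le: "\<And>h. f (u + h) - f u \<le> \<rho> h"
  defines "p \<equiv> \<lambda>h. INF t\<in>{0<..}. (f (u + t *\<^sub>R h) - f u) / t"
  shows "sublinear p" "p h \<le> f (u + h) - f u" "p h \<le> \<rho> h"
proof -
  have cv: "f ((1 - s) *\<^sub>R x + s *\<^sub>R y) \<le> (1 - s) * f x + s * f y" if "0 \<le> s" "s \<le> 1" for s x y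
    using convex_onD[OF cvx that] by simp
  have low: "- \<rho> (- h) \<le> (f (u + t *\<^sub>R h) - f u) / t" if t: "t > 0" for t h
  proof -
    have "u = (1 - t / (1 + t)) *\<^sub>R (u + t *\<^sub>R h) + (t / (1 + t)) *\<^sub>R (u + (- h))"
    proof -
      define c where "c = t / (1 + t)"
      have c: "(1 - c) * t = c" using t by (simp add: c_def field_simps)
      have "(1 - c) *\<^sub>R (u + t *\<^sub>R h) = (1 - c) *\<^sub>R u + c *\<^sub>R h"
        by (simp only: scaleR_add_right scaleR_scaleR c)
      then have "(1 - c) *\<^sub>R (u + t *\<^sub>R h) + c *\<^sub>R (u + (- h))
          = ((1 - c) *\<^sub>R u + c *\<^sub>R h) + (c *\<^sub>R u + - (c *\<^sub>R h))"
        by (simp only: scaleR_add_right scaleR_minus_right)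
      also have "\<dots> = (1 - c) *\<^sub>R u + c *\<^sub>R u" by simp
      also have "\<dots> = u" by (simp add: scaleR_add_left[symmetric])
      finally show ?thesis unfolding c_def[symmetric] by simp
    qed
    then have "f u \<le> (1 - t / (1 + t)) * f (u + t *\<^sub>R h) + (t / (1 + t)) * f (u + (- h))"
      using cv[of "t / (1 + t)" "u + t *\<^sub>R h" "u + (- h)"] t by simp
    also have "1 - t / (1 + t) = 1 / (1 + t)" using t by (simp add: field_simps)
    also have "1 / (1 + t) * f (u + t *\<^sub>R h) + t / (1 + t) * f (u + (- h))
        = (f (u + t *\<^sub>R h) + t * f (u + (- h))) / (1 + t)"
      by (simp add: add_divide_distrib)
    finally have "f u * (1 + t) \<le> f (u + t *\<^sub>R h) + t * f (u + (- h))"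
      using t by (simp add: pos_le_divide_eq)
    moreover have "t * f (u + - h) \<le> t * (f u + \<rho> (- h))"
      using le[of "- h"] t by (intro mult_left_mono) auto
    ultimately show ?thesis using t by (simp add: field_simps)
  qed
  have p_le: "p h \<le> (f (u + t *\<^sub>R h) - f u) / t" if "t > 0" for t h
    unfolding p_def using that low by (intro cINF_lower bdd_belowI[of _ "- \<rho> (- h)"]) auto
  have p_ge: "c \<le> p h" if "\<And>t. t > 0 \<Longrightarrow> c \<le> (f (u + t *\<^sub>R h) - f u) / t" for c h
    unfolding p_def using that by (intro cINF_greatest) (auto intro: exI[of _ 1])
  show 1: "p h \<le> f (u + h) - f u" for h using p_le[of 1 h] by simp
  show "p h \<le> \<rho> h" for h using 1[of h] le[of h] by linarith
  show "sublinear p"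
  proof (rule sublinearI)
    fix x y
    have key: "p (x + y) \<le> (f (u + s *\<^sub>R x) - f u) / s + (f (u + t *\<^sub>R y) - f u) / t"
      if s: "s > 0" and t: "t > 0" for s t
    proof -
      \<comment> \<open>This step length puts \<open>u + r *\<^sub>R (x + y)\<close> on the segment
        between \<open>u + s *\<^sub>R x\<close> and \<open>u + t *\<^sub>R y\<close>.\<close>
      define r where "r = s * t / (s + t)"
      have r: "r > 0" using s t by (simp add: r_def)
      have "1 - t / (s + t) = s / (s + t)" using s t by (simp add: field_simps)
      then have rs: "t / (s + t) = r / s" "1 - t / (s + t) = r / t" using s t by (simp_all add: r_def)
      have "u + r *\<^sub>R (x + y) = (1 - t / (s + t)) *\<^sub>R (u + t *\<^sub>R y) + (t / (s + t)) *\<^sub>R (u + s *\<^sub>R x)"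
      proof -
        define c where "c = t / (s + t)"
        have c: "(1 - c) * t = r" "c * s = r" using s t rs by (simp_all add: c_def)
        have "(1 - c) *\<^sub>R (u + t *\<^sub>R y) + c *\<^sub>R (u + s *\<^sub>R x)
            = ((1 - c) *\<^sub>R u + r *\<^sub>R y) + (c *\<^sub>R u + r *\<^sub>R x)"
          by (simp only: scaleR_add_right scaleR_scaleR c)
        also have "\<dots> = ((1 - c) *\<^sub>R u + c *\<^sub>R u) + r *\<^sub>R (x + y)"
          by (simp add: scaleR_add_right)
        also have "(1 - c) *\<^sub>R u + c *\<^sub>R u = u" by (simp add: scaleR_add_left[symmetric])
        finally show ?thesis unfolding c_def[symmetric] by simp
      qed
      then have feq: "f (u + r *\<^sub>R (x + y)) = f ((1 - t / (s + t)) *\<^sub>R (u + t *\<^sub>R y) + (t / (s + t)) *\<^sub>R (u + s *\<^sub>R x))"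
        by simp
      have "f (u + r *\<^sub>R (x + y)) \<le> (r / t) * f (u + t *\<^sub>R y) + (r / s) * f (u + s *\<^sub>R x)"
      proof -
        have "0 \<le> t / (s + t)" "t / (s + t) \<le> 1" using s t by auto
        from cv[OF this, of "u + t *\<^sub>R y" "u + s *\<^sub>R x"]
        show ?thesis unfolding feq by (simp only: rs rs(2)[unfolded rs(1)])
      qed
      moreover have "f u = (r / t) * f u + (r / s) * f u"
      proof -
        have "r / t + r / s = 1" using rs by simp
        then show ?thesis by (metis distrib_right mult_1)
      qed
      ultimately have "f (u + r *\<^sub>R (x + y)) - f u
          \<le> r * ((f (u + t *\<^sub>R y) - f u) / t + (f (u + s *\<^sub>R x) - f u) / s)"
        using r s t by (simp add: algebra_simps diff_divide_distrib)
      then have "(f (u + r *\<^sub>R (x + y)) - f u) / r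
          \<le> (f (u + t *\<^sub>R y) - f u) / t + (f (u + s *\<^sub>R x) - f u) / s"
        using r by (subst pos_divide_le_eq) (auto simp: mult.commute)
      with p_le[OF r, of "x + y"] show ?thesis by linarith
    qed
    have "p (x + y) - (f (u + s *\<^sub>R x) - f u) / s \<le> p y" if "s > 0" for s
      using key[OF that] by (intro p_ge) (simp add: algebra_simps)
    then have "p (x + y) - p y \<le> p x" by (intro p_ge) (simp add: algebra_simps)
    then show "p (x + y) \<le> p x + p y" by simp
  next
    fix t :: real and x assume t: "t > 0"
    have "p (t *\<^sub>R x) / t \<le> (f (u + s *\<^sub>R x) - f u) / s" if "s > 0" for s
      using p_le[of "s / t" "t *\<^sub>R x"] that t by (simp add: field_simps)
    then have "p (t *\<^sub>R x) / t \<le> p x" by (rule p_ge)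
    then show "p (t *\<^sub>R x) \<le> t * p x" using t by (simp add: field_simps)
  next
    show "p 0 = 0" by (simp add: p_def)
  qed
qed

lemma convex_subgradient:
  fixes f :: "'z::real_vector \<Rightarrow> real"
  assumes "convex_on UNIV f" "sublinear \<rho>" "\<And>h. f (u + h) - f u \<le> \<rho> h"
  obtains l where "linear l" "\<And>h. l h \<le> f (u + h) - f u" "\<And>h. l h \<le> \<rho> h"
proof -
  note * = sublinear_dir_quotient[OF assms]
  from *(1) obtain l where l: "linear l"
      "\<And>h. l h \<le> (INF t\<in>{0<..}. (f (u + t *\<^sub>R h) - f u) / t)"
    by (rule hahn_banach_sublinear[where ?x0.0 = u]) blast
  show ?thesis using that[OF l(1)] l(2) *(2,3) by (meson order_trans)
qed

section \<open>Separable subspaces of Asplund spaces\<close>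

text \<open>Closing off under countably many operations, as in the downward Loewenheim-Skolem
  theorem. \<open>F\<close> supplies the witnesses that a separable subspace has to contain.\<close>

lemma countable_closure_exists:
  fixes F :: "'s list \<Rightarrow> 's set"
  assumes F: "\<And>xs. countable (F xs)" and S0: "countable S0"
  obtains S where "countable S" "S0 \<subseteq> S" "\<And>xs. set xs \<subseteq> S \<Longrightarrow> F xs \<subseteq> S"
proof -
  define T where "T = rec_nat S0 (\<lambda>_ A. A \<union> (\<Union>xs\<in>lists A. F xs))"
  have T0: "T 0 = S0" and TS: "T (Suc n) = T n \<union> (\<Union>xs\<in>lists (T n). F xs)" for n
    by (simp_all add: T_def)
  have "countable (T n)" for n
    by (induction n) (auto simp: T0 TS S0 F)
  then have "countable (\<Union>n. T n)" by simp
  moreover have "S0 \<subseteq> (\<Union>n. T n)" using T0 by blast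
  moreover have "F xs \<subseteq> (\<Union>n. T n)" if "set xs \<subseteq> (\<Union>n. T n)" for xs
  proof -
    have mono: "T n \<subseteq> T k" if "n \<le> k" for n k
      using that by (rule lift_Suc_mono_le[of T, rotated]) (auto simp: TS)
    have "\<exists>n. set xs \<subseteq> T n" using that
    proof (induction xs)
      case (Cons x xs)
      then obtain n k where "set xs \<subseteq> T n" "x \<in> T k" by auto
      then have "set (x # xs) \<subseteq> T (max n k)" using mono[of n "max n k"] mono[of k "max n k"] by auto
      then show ?case by blast
    qed simp
    then obtain n where "set xs \<subseteq> T n" by blast
    then have "F xs \<subseteq> T (Suc n)" by (auto simp: TS in_lists_conv_set)
    then show ?thesis by blast
  qed
  ultimately show ?thesis by (rule that)
qed

text \<open>Real scalars are limits of rational ones, so a countable set can be dense in a closed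
  subspace.\<close>

lemma subspace_closure_rational:
  fixes S :: "'z::real_normed_vector set"
  assumes "0 \<in> S" and comb: "\<And>x y r. x \<in> S \<Longrightarrow> y \<in> S \<Longrightarrow> r \<in> \<rat> \<Longrightarrow> x + r *\<^sub>R y \<in> S"
  shows "subspace (closure S)"
  unfolding subspace_def
proof (intro conjI ballI allI)
  show "0 \<in> closure S" using assms(1) closure_subset by blast
  have add: "x + c *\<^sub>R y \<in> closure S" if x: "x \<in> closure S" and y: "y \<in> closure S" for x y c
  proof -
    obtain xs where xs: "\<And>n. xs n \<in> S" "xs \<longlonglongrightarrow> x"
      using x unfolding closure_sequential by blast
    obtain ys where ys: "\<And>n. ys n \<in> S" "ys \<longlonglongrightarrow> y"
      using y unfolding closure_sequential by blast
    have "\<exists>r\<in>\<rat>. c < r \<and> r < c + 1 / Suc n" for n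
      by (intro Rats_dense_in_real) simp
    then obtain r where r: "\<And>n. r n \<in> \<rat>" "\<And>n. c < r n" "\<And>n. r n < c + 1 / Suc n" by metis
    have "(\<lambda>n. c + 1 / Suc n) \<longlonglongrightarrow> c + 0"
      by (intro tendsto_add tendsto_const) (rule LIMSEQ_Suc[OF lim_1_over_n])
    then have "r \<longlonglongrightarrow> c"
      by (intro tendsto_sandwich[of "\<lambda>_. c" r _ "\<lambda>n. c + 1 / Suc n" c] always_eventually allI)
        (use r in \<open>auto intro: less_imp_le\<close>)
    then have "(\<lambda>n. xs n + r n *\<^sub>R ys n) \<longlonglongrightarrow> x + c *\<^sub>R y"
      by (intro tendsto_intros xs ys)
    moreover have "xs n + r n *\<^sub>R ys n \<in> S" for n by (rule comb[OF xs(1) ys(1) r(1)])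
    ultimately show ?thesis
      unfolding closure_sequential by (intro exI[of _ "\<lambda>n. xs n + r n *\<^sub>R ys n"]) blast
  qed
  show "x + y \<in> closure S" if "x \<in> closure S" "y \<in> closure S" for x y
    using add[OF that, of 1] by simp
  show "c *\<^sub>R x \<in> closure S" if "x \<in> closure S" for c x
    using add[OF \<open>0 \<in> closure S\<close> that, of c] by simp
qed

lemma separable_space_if_subset_closure:
  fixes C :: "'z::metric_space set"
  assumes "countable C" "C \<subseteq> Y" "Y \<subseteq> closure C"
  shows "separable_space (top_of_set Y)"
  unfolding separable_space_def
  using assms by (intro exI[of _ C]) (auto simp: closure_of_subtopology Int_absorb1)

lemma separable_subspace_closure_exists:
  fixes F :: "'z::real_normed_vector list \<Rightarrow> 'z set"
  assumes F: "\<And>xs. countable (F xs)" and S0: "countable S0"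
  obtains S where "countable S" "S0 \<subseteq> S" "\<And>xs. set xs \<subseteq> S \<Longrightarrow> F xs \<subseteq> S"
    "subspace (closure S)" "separable_space (top_of_set (closure S))"
proof -
  define G where "G xs = F xs \<union> (\<Union>x\<in>set xs. \<Union>y\<in>set xs. (\<lambda>r. x + r *\<^sub>R y) ` \<rat>)" for xs
  have "countable (G xs)" for xs
    unfolding G_def by (intro countable_Un F countable_UN countable_image countable_rat countable_finite finite_set)
  then obtain S where S: "countable S" "insert 0 S0 \<subseteq> S" "\<And>xs. set xs \<subseteq> S \<Longrightarrow> G xs \<subseteq> S"
    by (rule countable_closure_exists[of G "insert 0 S0"]) (use S0 in auto)
  have "x + r *\<^sub>R y \<in> S" if "x \<in> S" "y \<in> S" "r \<in> \<rat>" for x y r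
    using S(3)[of "[x, y]"] that by (auto simp: G_def)
  then have "subspace (closure S)" using S(2) by (intro subspace_closure_rational) auto
  moreover have "separable_space (top_of_set (closure S))"
    using S(1) closure_subset by (rule separable_space_if_subset_closure) simp
  moreover have "F xs \<subseteq> S" if "set xs \<subseteq> S" for xs
    using S(3)[OF that] by (auto simp: G_def)
  ultimately show ?thesis using S(1,2) by (intro that) auto
qed

text \<open>Separability of the dual of \<open>Y\<close> provides functions on \<open>Y\<close> of
  any norm, while the later arguments need functionals on the whole space of norm at most 1. For
  each \<open>g\<close> in the dense set and each precision, \<open>pick\<close> selects a
  functional of the unit ball that is this close to \<open>g\<close> on \<open>Y\<close>, if there
  is one. Two functionals this close to \<open>g\<close> differ by at most twice the precision,
  hence the bound \<open>2 / Suc n\<close>.\<close>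

lemma asplund_dense_functionals:
  fixes Y :: "'a::banach set"
  assumes "asplund TYPE('a)" and Y: "subspace Y" "separable_space (top_of_set Y)"
  obtains fs :: "nat \<Rightarrow> 'a \<Rightarrow>\<^sub>L real"
  where "\<And>n. norm (fs n) \<le> 1"
    "\<And>f e. norm f \<le> 1 \<Longrightarrow> e > 0 \<Longrightarrow> \<exists>n. \<forall>y\<in>Y. \<bar>blinfun_apply f y - fs n y\<bar> \<le> e * norm y"
proof -
  obtain D where D: "countable D" "D \<subseteq> dual_of Y"
    "\<And>f e. f \<in> dual_of Y \<Longrightarrow> e > 0 \<Longrightarrow> \<exists>g\<in>D. dual_norm Y (\<lambda>y. f y - g y) < e"
    using assms unfolding asplund_def separable_dual_def by meson
  have res: "restrict (blinfun_apply f) Y \<in> dual_of Y" for f :: "'a \<Rightarrow>\<^sub>L real"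
    unfolding dual_of_def
  proof (intro CollectI conjI)
    show "\<exists>K. \<forall>x\<in>Y. \<bar>restrict (blinfun_apply f) Y x\<bar> \<le> K * norm x"
      using norm_blinfun[of f] by (intro exI[of _ "norm f"]) auto
  qed (use Y in \<open>auto simp: subspace_add subspace_scale blinfun.add_right blinfun.scaleR_right\<close>)
  define near where "near f g n \<longleftrightarrow> norm f \<le> 1 \<and> (\<forall>y\<in>Y. \<bar>blinfun_apply f y - g y\<bar> \<le> norm y / Suc n)"
    for f :: "'a \<Rightarrow>\<^sub>L real" and g :: "'a \<Rightarrow> real" and n :: nat
  define pick where "pick g n = (if \<exists>f. near f g n then (SOME f. near f g n) else 0)" for g n
  have pick: "near (pick g n) g n" if "near f g n" for f g n
    using that unfolding pick_def by (auto intro: someI)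
  have pick_norm: "norm (pick g n) \<le> 1" for g n
    using pick[of _ g n] by (cases "\<exists>f. near f g n") (auto simp: near_def pick_def)
  define H where "H = insert 0 ((\<lambda>(g, n). pick g n) ` (D \<times> UNIV))"
  have H: "countable H" "H \<noteq> {}" using D(1) by (auto simp: H_def)
  show ?thesis
  proof (rule that[of "from_nat_into H"])
    show "norm (from_nat_into H n) \<le> 1" for n
      using from_nat_into[OF H(2), of n] pick_norm by (auto simp: H_def)
  next
    fix f :: "'a \<Rightarrow>\<^sub>L real" and e :: real assume f: "norm f \<le> 1" and e: "e > 0"
    obtain n where n: "2 / Suc n < e"
    proof -
      obtain n where "inverse (real (Suc n)) < e / 2" using reals_Archimedean[of "e / 2"] e by auto
      then show thesis using that[of n] by (simp add: field_simps)
    qed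
    obtain g where g: "g \<in> D" "dual_norm Y (\<lambda>y. restrict (blinfun_apply f) Y y - g y) < 1 / Suc n"
      using D(3)[OF res, of "1 / Suc n" f] by auto
    have "\<exists>K. \<forall>y\<in>Y. \<bar>g y\<bar> \<le> K * norm y" using g(1) D(2) by (auto simp: dual_of_def)
    then obtain K where K: "\<And>y. y \<in> Y \<Longrightarrow> \<bar>g y\<bar> \<le> K * norm y" by blast
    have gs: "g (c *\<^sub>R y) = c * g y" if "y \<in> Y" for c y
      using g(1) D(2) that by (auto simp: dual_of_def)
    have "\<bar>blinfun_apply f y - g y\<bar> \<le> norm y / Suc n" if y: "y \<in> Y" for y
    proof (cases "y = 0")
      case True
      then show ?thesis using K[OF y] by simp
    next
      case False
      define z where "z = (1 / norm y) *\<^sub>R y"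
      have z: "z \<in> Y" "norm z = 1" using y Y False by (auto simp: z_def subspace_scale)
      have "bdd_above ((\<lambda>y. \<bar>restrict (blinfun_apply f) Y y - g y\<bar>) ` (Y \<inter> cball 0 1))"
      proof (rule bdd_aboveI2)
        fix x assume x: "x \<in> Y \<inter> cball 0 1"
        have "\<bar>blinfun_apply f x\<bar> \<le> norm f * norm x" using norm_blinfun[of f x] by simp
        also have "\<dots> \<le> norm f * 1" using x by (intro mult_left_mono) auto
        finally have "\<bar>blinfun_apply f x\<bar> \<le> norm f" by simp
        moreover have "\<bar>g x\<bar> \<le> \<bar>K\<bar> * 1"
          using K[of x] x mult_right_mono[OF abs_ge_self[of K], of "norm x"]
            mult_left_mono[of "norm x" 1 "\<bar>K\<bar>"] by auto
        ultimately show "\<bar>restrict (blinfun_apply f) Y x - g x\<bar> \<le> norm f + \<bar>K\<bar>" using x by auto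
      qed
      then have "\<bar>restrict (blinfun_apply f) Y z - g z\<bar>
          \<le> dual_norm Y (\<lambda>y. restrict (blinfun_apply f) Y y - g y)"
        unfolding dual_norm_def using z by (intro cSUP_upper) auto
      then have "\<bar>blinfun_apply f z - g z\<bar> \<le> 1 / Suc n" using g(2) z(1) by simp
      moreover have "blinfun_apply f z - g z = (blinfun_apply f y - g y) / norm y"
        using y by (simp add: z_def gs blinfun.scaleR_right diff_divide_distrib)
      ultimately show ?thesis using False by (simp add: field_simps)
    qed
    then have nf: "near f g n" using f by (simp add: near_def)
    have "pick g n \<in> H" using g(1) by (auto simp: H_def)
    then obtain k where k: "from_nat_into H k = pick g n" using H by (metis from_nat_into_to_nat_on)
    have "\<bar>blinfun_apply f y - blinfun_apply (pick g n) y\<bar> \<le> e * norm y" if "y \<in> Y" for y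
    proof -
      have "\<bar>blinfun_apply f y - blinfun_apply (pick g n) y\<bar> \<le> norm y / Suc n + norm y / Suc n"
      proof -
        have "\<bar>blinfun_apply f y - g y\<bar> \<le> norm y / Suc n" "\<bar>blinfun_apply (pick g n) y - g y\<bar> \<le> norm y / Suc n"
          using nf pick[OF nf] that unfolding near_def by blast+
        then show ?thesis by linarith
      qed
      also have "\<dots> = (2 / Suc n) * norm y" by simp
      also have "\<dots> \<le> e * norm y" using n by (intro mult_right_mono) auto
      finally show ?thesis .
    qed
    with k show "\<exists>n. \<forall>y\<in>Y. \<bar>blinfun_apply f y - blinfun_apply (from_nat_into H n) y\<bar> \<le> e * norm y"
      by (intro exI[of _ k]) simp
  qed
qed

section \<open>Weak-star sequential compactness\<close>

text \<open>Baire category on a separable closed subspace. If every point were bad, \<open>Y\<close>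
  could be the closure of a countable set containing arbitrarily short bad directions for each of
  its points. The closed sets \<open>T n\<close>, where \<open>fs n\<close> is a subgradient along
  \<open>Y\<close> up to slope \<open>e/4\<close>, cover \<open>Y\<close>, so one of them has
  interior. There the same \<open>fs n\<close> serves at \<open>v + h\<close> and at
  \<open>v - h\<close>; in the sum of the two inequalities its values cancel, and the second
  difference is too small for a bad direction \<open>h\<close>.\<close>

lemma asplund_almost_differentiable:
  fixes \<psi> :: "'a::banach \<Rightarrow> real"
  assumes A: "asplund TYPE('a)" and cvx: "convex_on UNIV \<psi>"
    and lip: "\<And>x h. \<psi> (x + h) - \<psi> x \<le> norm h" and e: "e > 0"
  obtains v d where "d > 0"
    "\<And>h. norm h \<le> d \<Longrightarrow> \<psi> (v + h) + \<psi> (v - h) - 2 * \<psi> v \<le> e * norm h"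
proof (rule ccontr)
  assume "\<not> thesis"
  with that have bad: "\<exists>h. norm h \<le> d \<and> \<psi> (v + h) + \<psi> (v - h) - 2 * \<psi> v > e * norm h"
    if "d > 0" for v d
    using \<open>d > 0\<close> by (meson not_le)
  define W where "W v n = (SOME h. norm h \<le> 1 / Suc n \<and> \<psi> (v + h) + \<psi> (v - h) - 2 * \<psi> v > e * norm h)"
    for v and n :: nat
  have W: "norm (W v n) \<le> 1 / Suc n"
      "\<psi> (v + W v n) + \<psi> (v - W v n) - 2 * \<psi> v > e * norm (W v n)" for v n
    using someI_ex[OF bad[of "1 / Suc n" v]] unfolding W_def by auto
  define F where "F xs = (\<Union>x\<in>set xs. range (W x))" for xs
  have "countable (F xs)" for xs
    unfolding F_def by (rule countable_UN) (simp_all add: countable_finite)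
  then obtain S where S: "countable S" "{0} \<subseteq> S" "\<And>xs. set xs \<subseteq> S \<Longrightarrow> F xs \<subseteq> S"
      "subspace (closure S)" "separable_space (top_of_set (closure S))"
    by (rule separable_subspace_closure_exists[of F "{0}"]) auto
  define Y where "Y = closure S"
  have WS: "W v n \<in> S" if "v \<in> S" for v n
    using S(3)[of "[v]"] that by (auto simp: F_def)
  note Y = S(4,5)[folded Y_def]
  obtain fs :: "nat \<Rightarrow> 'a \<Rightarrow>\<^sub>L real" where fs: "\<And>n. norm (fs n) \<le> 1"
    "\<And>f e. norm f \<le> 1 \<Longrightarrow> e > 0 \<Longrightarrow> \<exists>n. \<forall>y\<in>Y. \<bar>blinfun_apply f y - fs n y\<bar> \<le> e * norm y"
    by (rule asplund_dense_functionals[OF A Y], rule that)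
  define T where "T n = {v \<in> Y. \<forall>w\<in>Y. \<psi> w - \<psi> v \<ge> fs n (w - v) - (e/4) * norm (w - v)}" for n
  have "\<bar>\<psi> x - \<psi> y\<bar> \<le> norm (x - y)" for x y
    using lip[of x "y - x"] lip[of y "x - y"] by (simp add: norm_minus_commute)
  then have "1-lipschitz_on UNIV \<psi>" by (auto simp: lipschitz_on_def dist_norm)
  then have cont: "continuous_on A \<psi>" for A
    using lipschitz_on_continuous_on continuous_on_subset by blast
  have clT: "closed (T n)" for n
  proof -
    have "T n = Y \<inter> (\<Inter>w\<in>Y. {v. fs n (w - v) - (e/4) * norm (w - v) \<le> \<psi> w - \<psi> v})"
      by (auto simp: T_def)
    also have "closed \<dots>"
      by (intro closed_Int closed_INT ballI closed_Collect_le continuous_intros cont) (simp add: Y_def)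
    finally show ?thesis .
  qed
  have cover: "Y \<subseteq> (\<Union>n. T n)"
  proof
    fix v assume v: "v \<in> Y"
    obtain l where l: "linear l" "\<And>h. l h \<le> \<psi> (v + h) - \<psi> v" "\<And>h. l h \<le> norm h"
      by (rule convex_subgradient[OF cvx sublinear_norm, of v]) (rule lip, rule that)
    have "\<exists>g :: 'a \<Rightarrow>\<^sub>L real. (\<forall>y. blinfun_apply g y = l y) \<and> norm g \<le> 1"
      by (rule blinfun_of_linear_le_norm[OF l(1), of 1]) (use l(3) in auto)
    then obtain g :: "'a \<Rightarrow>\<^sub>L real" where g: "\<And>y. blinfun_apply g y = l y" "norm g \<le> 1" by blast
    obtain n where n: "\<And>y. y \<in> Y \<Longrightarrow> \<bar>blinfun_apply g y - fs n y\<bar> \<le> (e/4) * norm y"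
      using fs(2)[OF g(2), of "e/4"] e by auto
    have "\<psi> w - \<psi> v \<ge> fs n (w - v) - (e/4) * norm (w - v)" if "w \<in> Y" for w
    proof -
      have "l (w - v) \<le> \<psi> w - \<psi> v" using l(2)[of "w - v"] by simp
      with n[OF subspace_diff[OF Y(1) that v]] g(1)[of "w - v"] show ?thesis by linarith
    qed
    then show "v \<in> (\<Union>n. T n)" using v by (auto simp: T_def)
  qed
  have "\<exists>n. top_of_set Y interior_of T n \<noteq> {}"
  proof (rule ccontr)
    assume no: "\<not> ?thesis"
    have "top_of_set Y interior_of \<Union>(range T) = {}"
    proof (rule Baire_category_alt)
      have "completely_metrizable_space (top_of_set Y)"
        by (intro completely_metrizable_space_closedin[OF completely_metrizable_space_euclidean])
          (simp add: Y_def)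
      then show "completely_metrizable_space (top_of_set Y) \<or>
        locally_compact_space (top_of_set Y) \<and> regular_space (top_of_set Y)" by blast
      fix A assume "A \<in> range T"
      then obtain n where n: "A = T n" by auto
      have "closedin (top_of_set Y) (T n)"
        by (rule closed_subset[OF _ clT]) (auto simp: T_def)
      then show "closedin (top_of_set Y) A \<and> top_of_set Y interior_of A = {}"
        using no n by simp
    qed simp
    moreover have "\<Union>(range T) = Y" using cover by (auto simp: T_def)
    moreover have "top_of_set Y interior_of Y = Y"
      by (metis interior_of_topspace topspace_euclidean_subtopology)
    ultimately show False using S(2) closure_subset[of S] by (auto simp: Y_def)
  qed
  then obtain n v0 where v0: "v0 \<in> top_of_set Y interior_of T n" by blast
  have "openin (top_of_set Y) (top_of_set Y interior_of T n)" by simp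
  then obtain d0 where d0: "d0 > 0" "ball v0 d0 \<inter> Y \<subseteq> top_of_set Y interior_of T n"
    using v0 unfolding openin_contains_ball by blast
  then have ball: "x \<in> T n" if "x \<in> Y" "dist v0 x < d0" for x
    using that interior_of_subset by (force simp: dist_commute)
  have "v0 \<in> Y" using v0 interior_of_subset by (force simp: T_def)
  \<comment> \<open>The point is moved from \<open>Y\<close> into \<open>S\<close>, because only for
    points of \<open>S\<close> are the bad directions \<open>W\<close> known to lie in
    \<open>Y\<close>.\<close>
  then obtain v where v: "v \<in> S" "dist v v0 < d0 / 2"
    using d0(1) unfolding Y_def closure_approachable by (meson half_gt_zero)
  obtain k where k: "1 / Suc k < d0 / 2"
    using reals_Archimedean[of "d0 / 2"] d0(1) by (auto simp: field_simps)
  define h where "h = W v k"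
  have h: "norm h < d0 / 2" "h \<in> S" using W(1)[of v k] k WS[OF v(1)] by (auto simp: h_def)
  have SY: "x \<in> Y" if "x \<in> S" for x using that closure_subset by (auto simp: Y_def)
  have vY: "v \<in> Y" "v + h \<in> Y" "v - h \<in> Y"
    using SY v(1) h(2) Y(1) by (auto simp: subspace_add subspace_diff)
  have "dist v0 (v + h) < d0" "dist v0 (v - h) < d0"
    using dist_triangle[of v0 "v + h" v] dist_triangle[of v0 "v - h" v] v(2) h(1)
    by (auto simp: dist_commute dist_norm)
  then have "v + h \<in> T n" "v - h \<in> T n" using ball vY by auto
  then have "\<psi> v - \<psi> (v + h) \<ge> fs n (- h) - (e/4) * norm h" "\<psi> v - \<psi> (v - h) \<ge> fs n h - (e/4) * norm h"
    using vY(1) unfolding T_def by force+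
  then have "\<psi> (v + h) + \<psi> (v - h) - 2 * \<psi> v \<le> (e/2) * norm h"
    by (simp add: blinfun.minus_right)
  also have "\<dots> \<le> e * norm h" using e by (intro mult_right_mono) auto
  finally show False using W(2)[of v k] by (simp add: h_def)
qed

section \<open>Upper limits of sequences of functionals\<close>

definition upper_limit :: "(nat \<Rightarrow> real) \<Rightarrow> real" where
  "upper_limit a = Inf {c. \<forall>\<^sub>F n in sequentially. a n \<le> c}"

lemma upper_limit_bdd:
  fixes a :: "nat \<Rightarrow> real"
  assumes "\<And>n. \<bar>a n\<bar> \<le> K"
  shows "K \<in> {c. \<forall>\<^sub>F n in sequentially. a n \<le> c}"
    and "bdd_below {c. \<forall>\<^sub>F n in sequentially. a n \<le> c}"
proof -
  show "K \<in> {c. \<forall>\<^sub>F n in sequentially. a n \<le> c}"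
    using abs_le_D1[OF assms] by (simp add: always_eventually)
  have "- K \<le> c" if "\<forall>\<^sub>F n in sequentially. a n \<le> c" for c
  proof -
    have "\<exists>n. a n \<le> c" using eventually_happens[OF that] by auto
    then obtain n where "a n \<le> c" by blast
    then show ?thesis using assms[of n] by auto
  qed
  then show "bdd_below {c. \<forall>\<^sub>F n in sequentially. a n \<le> c}" by (intro bdd_belowI[of _ "- K"]) auto
qed

lemma upper_limit_le:
  assumes "\<And>n. \<bar>a n\<bar> \<le> K" "\<forall>\<^sub>F n in sequentially. a n \<le> c"
  shows "upper_limit a \<le> c"
  unfolding upper_limit_def using assms(2) upper_limit_bdd(2)[OF assms(1)] by (intro cInf_lower) auto

lemma eventually_le_upper_limit:
  assumes "\<And>n. \<bar>a n\<bar> \<le> K" "upper_limit a < c"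
  shows "\<forall>\<^sub>F n in sequentially. a n \<le> c"
proof -
  have "{c. \<forall>\<^sub>F n in sequentially. a n \<le> c} \<noteq> {}" using upper_limit_bdd(1)[of a K, OF assms(1)] by blast
  then obtain b where "\<forall>\<^sub>F n in sequentially. a n \<le> b" "b < c"
    using cInf_lessD[of "{c. \<forall>\<^sub>F n in sequentially. a n \<le> c}" c] assms(2)
    by (auto simp: upper_limit_def)
  then show ?thesis by (auto elim: eventually_mono)
qed

lemma sublinear_upper_limit:
  fixes f :: "nat \<Rightarrow> 'a::real_normed_vector \<Rightarrow>\<^sub>L real"
  assumes f: "\<And>n. norm (f n) \<le> 1"
  defines "\<psi> \<equiv> \<lambda>x. upper_limit (\<lambda>n. f n x)"
  shows "sublinear \<psi>" "\<psi> x \<le> norm x"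
proof -
  have b: "\<bar>f n x\<bar> \<le> norm x" for n x by (rule abs_blinfun_le_norm[OF f])
  show "\<psi> x \<le> norm x" for x
    unfolding \<psi>_def using abs_le_D1[OF b] by (intro upper_limit_le[OF b] always_eventually) auto
  show "sublinear \<psi>"
  proof (rule sublinearI)
    fix x y
    show "\<psi> (x + y) \<le> \<psi> x + \<psi> y"
    proof (rule field_le_epsilon)
      fix e :: real assume e: "e > 0"
      have "\<forall>\<^sub>F n in sequentially. f n x \<le> \<psi> x + e / 2" "\<forall>\<^sub>F n in sequentially. f n y \<le> \<psi> y + e / 2"
        using e by (auto intro!: eventually_le_upper_limit[OF b] simp: \<psi>_def)
      then have "\<forall>\<^sub>F n in sequentially. f n (x + y) \<le> \<psi> x + \<psi> y + e"
        by eventually_elim (simp add: blinfun.add_right)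
      then show "\<psi> (x + y) \<le> \<psi> x + \<psi> y + e"
        unfolding \<psi>_def by (intro upper_limit_le[OF b])
    qed
  next
    fix t :: real and x assume t: "t > 0"
    show "\<psi> (t *\<^sub>R x) \<le> t * \<psi> x"
    proof (rule field_le_epsilon)
      fix e :: real assume e: "e > 0"
      have "\<forall>\<^sub>F n in sequentially. f n x \<le> \<psi> x + e / t"
        using e t by (auto intro!: eventually_le_upper_limit[OF b] simp: \<psi>_def)
      then have "\<forall>\<^sub>F n in sequentially. f n (t *\<^sub>R x) \<le> t * \<psi> x + e"
        by eventually_elim (use t in \<open>simp add: blinfun.scaleR_right field_simps\<close>)
      then show "\<psi> (t *\<^sub>R x) \<le> t * \<psi> x + e"
        unfolding \<psi>_def by (intro upper_limit_le[OF b])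
    qed
  next
    have "{c :: real. 0 \<le> c} = {0..}" by auto
    then show "\<psi> 0 = 0" by (simp add: \<psi>_def upper_limit_def blinfun.zero_right)
  qed
qed

lemma convex_on_sublinear: "sublinear p \<Longrightarrow> convex_on UNIV p"
  by (intro convex_onI) (auto simp: sublinear_scaleR[symmetric] intro: sublinear_add)

text \<open>Along a subsequence realising the upper limit at a point of almost differentiability, the
  functionals oscillate little on the whole unit ball.\<close>

lemma asplund_subseq_small_oscillation:
  fixes f :: "nat \<Rightarrow> 'a::banach \<Rightarrow>\<^sub>L real"
  assumes A: "asplund TYPE('a)" and f: "\<And>n. norm (f n) \<le> 1" and e: "e > 0"
  obtains r :: "nat \<Rightarrow> nat" where "strict_mono r"
    "\<And>x. \<exists>N. \<forall>m\<ge>N. \<forall>n\<ge>N. \<bar>f (r m) x - f (r n) x\<bar> \<le> e * norm x"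
proof -
  have b: "\<bar>f n x\<bar> \<le> norm x" for n x by (rule abs_blinfun_le_norm[OF f])
  define \<psi> where "\<psi> x = upper_limit (\<lambda>n. f n x)" for x
  note \<psi> = sublinear_upper_limit[of f, OF f, folded \<psi>_def]
  have lip: "\<psi> (x + h) - \<psi> x \<le> norm h" for x h
    using sublinear_add[OF \<psi>(1), of x h] \<psi>(2)[of h] by simp
  obtain v d where d: "d > 0" and vd: "\<And>h. norm h \<le> d \<Longrightarrow> \<psi> (v + h) + \<psi> (v - h) - 2 * \<psi> v \<le> (e/4) * norm h"
    by (rule asplund_almost_differentiable[OF A convex_on_sublinear[OF \<psi>(1)] lip, of "e/4"]) (use e in simp, rule that)
  have freq: "\<exists>n>N. f n v > \<psi> v - 1 / real (Suc k)" for N k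
  proof (rule ccontr)
    assume "\<not> ?thesis"
    then have "f n v \<le> \<psi> v - 1 / real (Suc k)" if "n > N" for n
      using that by (meson not_less)
    then have "\<forall>\<^sub>F n in sequentially. f n v \<le> \<psi> v - 1 / real (Suc k)"
      unfolding eventually_sequentially by (intro exI[of _ "Suc N"]) auto
    then have "\<psi> v \<le> \<psi> v - 1 / real (Suc k)"
      unfolding \<psi>_def[of v] by (intro upper_limit_le[OF b])
    then show False by (simp add: field_simps)
  qed
  have "\<exists>r. \<forall>k. f (r k) v > \<psi> v - 1 / real (Suc k) \<and> r k < r (Suc k)"
  proof (rule dependent_nat_choice)
    show "\<exists>n. f n v > \<psi> v - 1 / real (Suc 0)" using freq[of 0 0] by blast
    show "\<exists>n. f n v > \<psi> v - 1 / real (Suc (Suc k)) \<and> x < n" for x k using freq[of x "Suc k"] by blast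
  qed
  then obtain r where r: "\<And>k. f (r k) v > \<psi> v - 1 / real (Suc k)" "strict_mono r"
    by (auto simp: strict_mono_Suc_iff)
  have "\<exists>N. \<forall>m\<ge>N. \<forall>n\<ge>N. \<bar>f (r m) x - f (r n) x\<bar> \<le> e * norm x" for x
  proof (cases "x = 0")
    case True
    then show ?thesis by (simp add: blinfun.zero_right)
  next
    case False
    define t where "t = d / norm x"
    define h where "h = t *\<^sub>R x"
    have t: "t > 0" and h: "norm h = d" using d False by (auto simp: t_def h_def)
    have ed: "e * d / 8 > 0" using e d by simp
    have 1: "\<forall>\<^sub>F k in sequentially. f (r k) (v + h) \<le> \<psi> (v + h) + e * d / 8"
      by (rule eventually_subseq[OF r(2), OF eventually_le_upper_limit[OF b]]) (use ed in \<open>simp add: \<psi>_def\<close>)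
    have 2: "\<forall>\<^sub>F k in sequentially. f (r k) (v - h) \<le> \<psi> (v - h) + e * d / 8"
      by (rule eventually_subseq[OF r(2), OF eventually_le_upper_limit[OF b]]) (use ed in \<open>simp add: \<psi>_def\<close>)
    have 3: "\<forall>\<^sub>F k in sequentially. 1 / real (Suc k) < e * d / 8"
      using order_tendstoD(2)[OF LIMSEQ_Suc[OF lim_1_over_n] ed] .
    \<comment> \<open>At \<open>v\<close> the functionals nearly attain \<open>\<psi> v\<close>, and
      at \<open>v + h\<close> and \<open>v - h\<close> they eventually exceed the upper limit by
      little. Subtracting encloses \<open>f (r k) h\<close> between two bounds whose distance is the
      second difference of \<open>\<psi>\<close> at \<open>v\<close> plus
      \<open>e * d / 2\<close>.\<close>
    have "\<forall>\<^sub>F k in sequentially. f (r k) h \<le> \<psi> (v + h) - \<psi> v + e * d / 4 \<and> f (r k) h \<ge> \<psi> v - \<psi> (v - h) - e * d / 4"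
      using 1 2 3
    proof eventually_elim
      case (elim k)
      then show ?case using r(1)[of k] by (simp add: blinfun.add_right blinfun.diff_right)
    qed
    then obtain N where N: "\<And>k. k \<ge> N \<Longrightarrow> f (r k) h \<le> \<psi> (v + h) - \<psi> v + e * d / 4"
        "\<And>k. k \<ge> N \<Longrightarrow> f (r k) h \<ge> \<psi> v - \<psi> (v - h) - e * d / 4"
      unfolding eventually_sequentially by blast
    have "\<bar>f (r m) x - f (r n) x\<bar> \<le> e * norm x" if "m \<ge> N" "n \<ge> N" for m n
    proof -
      have "\<bar>f (r m) h - f (r n) h\<bar> \<le> e * d"
        using N[OF that(1)] N[OF that(2)] vd[of h] h ed by (simp add: abs_le_iff)
      also have "f (r m) h - f (r n) h = t * (f (r m) x - f (r n) x)"
        by (simp add: h_def blinfun.scaleR_right right_diff_distrib)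
      finally have "t * \<bar>f (r m) x - f (r n) x\<bar> \<le> e * d" using t by (simp add: abs_mult)
      also have "e * d = t * (e * norm x)" using False by (simp add: t_def)
      finally show ?thesis using t by simp
    qed
    then show ?thesis by blast
  qed
  from r(2) this show ?thesis by (rule that)
qed

text \<open>The diagonal runs over precisions and not over points: stage \<open>k\<close> makes the
  oscillation at every \<open>x\<close> eventually at most \<open>norm x / Suc k\<close>. This works
  in nonseparable spaces, where a diagonal over a countable set of points would not reach every
  \<open>x\<close>.\<close>

lemma asplund_weak_star_seq_compact_unit:
  fixes f :: "nat \<Rightarrow> 'a::banach \<Rightarrow>\<^sub>L real"
  assumes A: "asplund TYPE('a)" and f: "\<And>n. norm (f n) \<le> 1"
  obtains r :: "nat \<Rightarrow> nat" and g where "strict_mono r" "\<And>x. (\<lambda>n. f (r n) x) \<longlonglongrightarrow> blinfun_apply g x" "norm g \<le> 1"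
proof -
  define P where "P k s \<longleftrightarrow> (\<forall>x. \<exists>N. \<forall>m\<ge>N. \<forall>n\<ge>N. \<bar>f (s m) x - f (s n) x\<bar> \<le> 1 / real (Suc k) * norm x)"
    for k :: nat and s :: "nat \<Rightarrow> nat"
  interpret subseqs P
  proof
    fix k and s :: "nat \<Rightarrow> nat" assume "strict_mono s"
    obtain r :: "nat \<Rightarrow> nat" where r: "strict_mono r"
      "\<And>x. \<exists>N. \<forall>m\<ge>N. \<forall>n\<ge>N. \<bar>f (s (r m)) x - f (s (r n)) x\<bar> \<le> (1 / real (Suc k)) * norm x"
      by (rule asplund_subseq_small_oscillation[OF A, of "\<lambda>n. f (s n)" "1 / real (Suc k)"])
        (rule f, simp, rule that)
    have "P k (s \<circ> r)" unfolding P_def o_def by (rule allI) (rule r(2))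
    then show "\<exists>r'. strict_mono r' \<and> P k (s \<circ> r')" using r(1) by blast
  qed
  have stable: "P k (s \<circ> r)" if r: "strict_mono r" and s: "P k s" for r s k
    unfolding P_def
  proof
    fix x
    obtain N where "\<forall>m\<ge>N. \<forall>n\<ge>N. \<bar>f (s m) x - f (s n) x\<bar> \<le> 1 / real (Suc k) * norm x"
      using s unfolding P_def by blast
    moreover have "N \<le> r n" if "N \<le> n" for n using seq_suble[OF r, of n] that by simp
    ultimately show "\<exists>N. \<forall>m\<ge>N. \<forall>n\<ge>N. \<bar>f ((s \<circ> r) m) x - f ((s \<circ> r) n) x\<bar> \<le> 1 / real (Suc k) * norm x"
      unfolding o_def by blast
  qed
  have diag: "\<exists>N. \<forall>m\<ge>N. \<forall>n\<ge>N. \<bar>f (diagseq m) x - f (diagseq n) x\<bar> \<le> 1 / real (Suc k) * norm x" for k x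
  proof -
    have "P k (diagseq \<circ> (+) (Suc k))" by (rule diagseq_holds) (rule stable)
    then have "\<exists>N. \<forall>m\<ge>N. \<forall>n\<ge>N.
        \<bar>f (diagseq (Suc k + m)) x - f (diagseq (Suc k + n)) x\<bar> \<le> 1 / real (Suc k) * norm x"
      unfolding P_def[of k "diagseq \<circ> (+) (Suc k)"] unfolding o_def by (rule spec)
    then obtain N where N: "\<And>m n. m \<ge> N \<Longrightarrow> n \<ge> N \<Longrightarrow>
        \<bar>f (diagseq (Suc k + m)) x - f (diagseq (Suc k + n)) x\<bar> \<le> 1 / real (Suc k) * norm x"
      by blast
    have "\<bar>f (diagseq m) x - f (diagseq n) x\<bar> \<le> 1 / real (Suc k) * norm x"
      if "m \<ge> N + Suc k" "n \<ge> N + Suc k" for m n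
      using N[of "m - Suc k" "n - Suc k"] that by simp
    then show ?thesis by blast
  qed
  have "Cauchy (\<lambda>n. f (diagseq n) x)" for x
  proof (rule CauchyI)
    fix e :: real assume "e > 0"
    obtain k where k: "norm x / Suc k < e"
    proof -
      obtain k where "norm x / e < real k" using reals_Archimedean2 by blast
      then have "norm x / e < Suc k" by simp
      then show thesis using \<open>e > 0\<close> that[of k] by (simp add: field_simps)
    qed
    show "\<exists>M. \<forall>m\<ge>M. \<forall>n\<ge>M. norm (f (diagseq m) x - f (diagseq n) x) < e"
    proof -
      obtain N where "\<And>m n. m \<ge> N \<Longrightarrow> n \<ge> N \<Longrightarrow> \<bar>f (diagseq m) x - f (diagseq n) x\<bar> \<le> 1 / real (Suc k) * norm x"
        using diag[where k = k and x = x] by blast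
      moreover have "1 / real (Suc k) * norm x < e" using k by simp
      ultimately show ?thesis by (intro exI[of _ N]) (auto intro: le_less_trans)
    qed
  qed
  then obtain l where l: "\<And>x. (\<lambda>n. f (diagseq n) x) \<longlonglongrightarrow> l x"
    unfolding Cauchy_convergent_iff convergent_def by metis
  have lin: "linear l"
  proof (rule linearI)
    show "l (x + y) = l x + l y" for x y
      using LIMSEQ_unique[OF l[of "x + y"]] tendsto_add[OF l[of x] l[of y]]
      by (simp add: blinfun.add_right)
    show "l (c *\<^sub>R x) = c *\<^sub>R l x" for c x
      using LIMSEQ_unique[OF l[of "c *\<^sub>R x"]] tendsto_mult_left[OF l[of x], of c]
      by (simp add: blinfun.scaleR_right)
  qed
  have "f n x \<le> norm x" for n x using abs_blinfun_le_norm[OF f, of n x] by simp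
  then have "l x \<le> norm x" for x
    using LIMSEQ_le_const2[OF l[of x]] by blast
  then obtain g :: "'a \<Rightarrow>\<^sub>L real" where "\<And>x. blinfun_apply g x = l x" "norm g \<le> 1"
    using blinfun_of_linear_le_norm[OF lin, of 1] by auto
  then show ?thesis using that[OF subseq_diagseq, of g] l by simp
qed

lemma asplund_weak_star_seq_compact:
  fixes f :: "nat \<Rightarrow> 'a::banach \<Rightarrow>\<^sub>L real"
  assumes A: "asplund TYPE('a)" and f: "\<And>n. norm (f n) \<le> K"
  obtains r :: "nat \<Rightarrow> nat" and g where "strict_mono r" "\<And>x. (\<lambda>n. f (r n) x) \<longlonglongrightarrow> blinfun_apply g x"
proof -
  define c where "c = max 1 K"
  have c: "c > 0" "K \<le> c" by (auto simp: c_def)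
  have "norm ((1 / c) *\<^sub>R f n) \<le> 1" for n
    using c f[of n] by simp
  then obtain r g where r: "strict_mono r"
    and g: "\<And>x. (\<lambda>n. ((1 / c) *\<^sub>R f (r n)) x) \<longlonglongrightarrow> blinfun_apply g x"
    by (rule asplund_weak_star_seq_compact_unit[OF A, of "\<lambda>n. (1 / c) *\<^sub>R f n"]) blast
  have "(\<lambda>n. f (r n) x) \<longlonglongrightarrow> blinfun_apply (c *\<^sub>R g) x" for x
    using tendsto_mult_left[OF g[of x], of c] c by (simp add: blinfun.scaleR_left)
  with r show ?thesis by (rule that)
qed

section \<open>Smooth approximations of the norm\<close>

text \<open>For a continuous convex \<open>p\<close> this is Frechet differentiability at
  \<open>u\<close> in the directions of \<open>Y\<close>. Second differences avoid naming a
  derivative and can be added term by term.\<close>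

definition smooth_along :: "'z::real_normed_vector set \<Rightarrow> ('z \<Rightarrow> real) \<Rightarrow> 'z \<Rightarrow> bool" where
  "smooth_along Y p u \<longleftrightarrow>
     (\<forall>e>0. \<exists>d>0. \<forall>h\<in>Y. norm h \<le> d \<longrightarrow> p (u + h) + p (u - h) - 2 * p u \<le> e * norm h)"

lemma smooth_alongD:
  assumes "smooth_along Y p u" "e > 0"
  obtains d where "d > 0" "\<And>h. h \<in> Y \<Longrightarrow> norm h \<le> d \<Longrightarrow> p (u + h) + p (u - h) - 2 * p u \<le> e * norm h"
  using assms unfolding smooth_along_def by meson

lemma smooth_along_add:
  assumes "smooth_along Y p u" "smooth_along Y q u"
  shows "smooth_along Y (\<lambda>z. p z + q z) u"
  unfolding smooth_along_def
proof (intro allI impI)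
  fix e :: real assume "e > 0"
  then have e: "e / 2 > 0" by simp
  obtain d where d: "d > 0" "\<And>h. h \<in> Y \<Longrightarrow> norm h \<le> d \<Longrightarrow> p (u + h) + p (u - h) - 2 * p u \<le> e / 2 * norm h"
    by (rule smooth_alongD[OF assms(1) e], rule that)
  obtain d' where d': "d' > 0" "\<And>h. h \<in> Y \<Longrightarrow> norm h \<le> d' \<Longrightarrow> q (u + h) + q (u - h) - 2 * q u \<le> e / 2 * norm h"
    by (rule smooth_alongD[OF assms(2) e], rule that)
  have "(p (u + h) + q (u + h)) + (p (u - h) + q (u - h)) - 2 * (p u + q u) \<le> e * norm h"
    if "h \<in> Y" "norm h \<le> min d d'" for h
  proof -
    have h: "norm h \<le> d" "norm h \<le> d'" using that(2) by auto
    show ?thesis using d(2)[OF that(1) h(1)] d'(2)[OF that(1) h(2)] by argo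
  qed
  then show "\<exists>d>0. \<forall>h\<in>Y. norm h \<le> d \<longrightarrow>
      (p (u + h) + q (u + h)) + (p (u - h) + q (u - h)) - 2 * (p u + q u) \<le> e * norm h"
    using d(1) d'(1) by (intro exI[of _ "min d d'"]) auto
qed

lemma smooth_along_const: "smooth_along Y (\<lambda>z. c) u"
  unfolding smooth_along_def by (auto intro!: exI[of _ 1])

lemma smooth_along_sum:
  assumes "\<And>i. i \<in> I \<Longrightarrow> smooth_along Y (p i) u"
  shows "smooth_along Y (\<lambda>z. \<Sum>i\<in>I. p i z) u"
  using assms
  by (induction I rule: infinite_finite_induct) (auto intro!: smooth_along_const smooth_along_add)

lemma smooth_along_cmult:
  assumes "smooth_along Y p u" "c \<ge> 0"
  shows "smooth_along Y (\<lambda>z. c * p z) u"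
proof (cases "c = 0")
  case True
  then show ?thesis by (simp add: smooth_along_const)
next
  case False
  with assms(2) have c: "c > 0" by simp
  show ?thesis
    unfolding smooth_along_def
  proof (intro allI impI)
    fix e :: real assume "e > 0"
    then have e: "e / c > 0" using c by simp
    obtain d where d: "d > 0" "\<And>h. h \<in> Y \<Longrightarrow> norm h \<le> d \<Longrightarrow> p (u + h) + p (u - h) - 2 * p u \<le> e / c * norm h"
      by (rule smooth_alongD[OF assms(1) e], rule that)
    have "c * p (u + h) + c * p (u - h) - 2 * (c * p u) \<le> e * norm h" if "h \<in> Y" "norm h \<le> d" for h
      using mult_left_mono[OF d(2)[OF that] assms(2)] c by (simp add: algebra_simps)
    then show "\<exists>d>0. \<forall>h\<in>Y. norm h \<le> d \<longrightarrow> c * p (u + h) + c * p (u - h) - 2 * (c * p u) \<le> e * norm h"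
      using d(1) by blast
  qed
qed

lemma smooth_along_affine:
  fixes T :: "'z::real_normed_vector \<Rightarrow> 'a::real_normed_vector"
  assumes p: "smooth_along Y p (T u + a)" and lin: "linear T"
    and T: "\<And>h. norm (T h) \<le> B * norm h" and Y: "\<And>h. h \<in> Z \<Longrightarrow> T h \<in> Y"
  shows "smooth_along Z (\<lambda>z. p (T z + a)) u"
  unfolding smooth_along_def
proof (intro allI impI)
  fix e :: real assume e: "e > 0"
  define b where "b = max 1 B"
  have b: "b > 0" by (simp add: b_def)
  have Tb: "norm (T h) \<le> b * norm h" for h
  proof -
    have "B * norm h \<le> b * norm h" by (intro mult_right_mono) (auto simp: b_def)
    then show ?thesis using T[of h] by simp
  qed
  have eb: "e / b > 0" using e b by simp
  obtain d where d: "d > 0" "\<And>h. h \<in> Y \<Longrightarrow> norm h \<le> d \<Longrightarrow> p (T u + a + h) + p (T u + a - h) - 2 * p (T u + a) \<le> e / b * norm h"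
    by (rule smooth_alongD[OF p eb], rule that)
  have "p (T (u + h) + a) + p (T (u - h) + a) - 2 * p (T u + a) \<le> e * norm h"
    if h: "h \<in> Z" "norm h \<le> d / b" for h
  proof -
    have "norm (T h) \<le> d" using Tb[of h] h(2) b by (simp add: field_simps)
    from d(2)[OF Y[OF h(1)] this]
    have "p (T (u + h) + a) + p (T (u - h) + a) - 2 * p (T u + a) \<le> e / b * norm (T h)"
      using lin by (simp add: linear_add linear_diff algebra_simps)
    also have "\<dots> \<le> e / b * (b * norm h)" using Tb eb by (intro mult_left_mono) auto
    finally show ?thesis using b by simp
  qed
  then show "\<exists>d>0. \<forall>h\<in>Z. norm h \<le> d \<longrightarrow> p (T (u + h) + a) + p (T (u - h) + a) - 2 * p (T u + a) \<le> e * norm h"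
    using d(1) b by (intro exI[of _ "d / b"]) auto
qed

text \<open>By the common Lipschitz constant, the terms from \<open>K\<close> on contribute at most
  \<open>2 * M * norm h\<close> times their total weight, uniformly in \<open>h\<close>; the
  finitely many others are smooth.\<close>

lemma smooth_along_suminf:
  fixes q :: "nat \<Rightarrow> 'z::real_normed_vector \<Rightarrow> real"
  assumes \<mu>: "\<And>n. \<mu> n \<ge> 0" "summable \<mu>" and q: "\<And>n. smooth_along Y (q n) u"
    and lip: "\<And>n z h. q n (z + h) - q n z \<le> M * norm h" and M: "M \<ge> 0"
    and smb: "\<And>z. summable (\<lambda>n. \<mu> n * q n z)"
  shows "smooth_along Y (\<lambda>z. \<Sum>n. \<mu> n * q n z) u"
  unfolding smooth_along_def
proof (intro allI impI)
  fix e :: real assume e: "e > 0"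
  let ?w = "\<lambda>n h. \<mu> n * q n (u + h) + \<mu> n * q n (u - h) - 2 * (\<mu> n * q n u)"
  have smbw: "summable (\<lambda>n. ?w n h)" for h
    by (intro summable_diff summable_add summable_mult smb)
  have "\<exists>K. (\<Sum>n. \<mu> (n + K)) * (2 * M) < e / 2"
  proof -
    have "(\<lambda>K. (\<Sum>n. \<mu> (n + K))) \<longlonglongrightarrow> 0" by (rule suminf_exist_split2[OF \<mu>(2)])
    from tendsto_mult_left_zero[OF this, of "2 * M"] have "(\<lambda>K. (\<Sum>n. \<mu> (n + K)) * (2 * M)) \<longlonglongrightarrow> 0" .
    then have "\<forall>\<^sub>F K in sequentially. (\<Sum>n. \<mu> (n + K)) * (2 * M) < e / 2"
      using e by (intro order_tendstoD) auto
    then show ?thesis using eventually_happens'[OF sequentially_bot] by blast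
  qed
  then obtain K where K: "(\<Sum>n. \<mu> (n + K)) * (2 * M) < e / 2" by blast
  have "smooth_along Y (\<lambda>z. \<Sum>n<K. \<mu> n * q n z) u"
    by (intro smooth_along_sum smooth_along_cmult q \<mu>)
  moreover have "e / 2 > 0" using e by simp
  ultimately obtain d where d: "d > 0"
    "\<forall>h\<in>Y. norm h \<le> d \<longrightarrow> (\<Sum>n<K. \<mu> n * q n (u + h)) + (\<Sum>n<K. \<mu> n * q n (u - h)) - 2 * (\<Sum>n<K. \<mu> n * q n u) \<le> e / 2 * norm h"
    unfolding smooth_along_def by blast
  have "(\<Sum>n. \<mu> n * q n (u + h)) + (\<Sum>n. \<mu> n * q n (u - h)) - 2 * (\<Sum>n. \<mu> n * q n u) \<le> e * norm h"
    if h: "h \<in> Y" "norm h \<le> d" for h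
  proof -
    have "(\<Sum>n. \<mu> n * q n (u + h)) + (\<Sum>n. \<mu> n * q n (u - h)) - 2 * (\<Sum>n. \<mu> n * q n u) = (\<Sum>n. ?w n h)"
      by (simp add: suminf_diff[symmetric] suminf_add[symmetric] suminf_mult smb summable_add summable_mult)
    also have "\<dots> = (\<Sum>n. ?w (n + K) h) + (\<Sum>n<K. ?w n h)"
      by (rule suminf_split_initial_segment[OF smbw])
    also have "(\<Sum>n<K. ?w n h) \<le> e / 2 * norm h"
      using d(2) h by (simp add: sum.distrib sum_subtractf sum_distrib_left)
    also have "(\<Sum>n. ?w (n + K) h) \<le> (\<Sum>n. \<mu> (n + K) * (2 * M * norm h))"
    proof (rule suminf_le)
      fix n
      have "q (n + K) (u + h) + q (n + K) (u - h) - 2 * q (n + K) u \<le> 2 * M * norm h"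
        using lip[of "n + K" u h] lip[of "n + K" u "- h"] by simp
      from mult_left_mono[OF this \<mu>(1)[of "n + K"]]
      show "?w (n + K) h \<le> \<mu> (n + K) * (2 * M * norm h)" by (simp add: algebra_simps)
      show "summable (\<lambda>n. ?w (n + K) h)" using smbw by (simp add: summable_iff_shift[of "\<lambda>n. ?w n h" K])
      show "summable (\<lambda>n. \<mu> (n + K) * (2 * M * norm h))"
        using \<mu>(2) by (intro summable_mult2) (simp add: summable_iff_shift)
    qed
    also have "\<dots> = (\<Sum>n. \<mu> (n + K)) * (2 * M) * norm h"
      using suminf_mult2[of "\<lambda>n. \<mu> (n + K)" "2 * M * norm h"] \<mu>(2)
      by (simp add: summable_iff_shift mult.assoc)
    also have "\<dots> \<le> e / 2 * norm h" using K by (intro mult_right_mono) auto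
    finally show ?thesis by simp
  qed
  then show "\<exists>d>0. \<forall>h\<in>Y. norm h \<le> d \<longrightarrow>
      (\<Sum>n. \<mu> n * q n (u + h)) + (\<Sum>n. \<mu> n * q n (u - h)) - 2 * (\<Sum>n. \<mu> n * q n u) \<le> e * norm h"
    using d(1) by blast
qed

lemma convex_on_affine:
  fixes T :: "'z::real_vector \<Rightarrow> 'a::real_vector"
  assumes p: "convex_on UNIV p" and T: "linear T"
  shows "convex_on UNIV (\<lambda>z. p (T z + a))"
proof (intro convex_onI)
  fix t :: real and x y :: 'z assume t: "0 < t" "t < 1"
  have "T ((1 - t) *\<^sub>R x + t *\<^sub>R y) + a = (1 - t) *\<^sub>R (T x + a) + t *\<^sub>R (T y + a)"
    using T by (simp add: linear_add linear_diff linear_scale algebra_simps)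
  then show "p (T ((1 - t) *\<^sub>R x + t *\<^sub>R y) + a) \<le> (1 - t) * p (T x + a) + t * p (T y + a)"
    using convex_onD[OF p, of t "T x + a" "T y + a"] t by simp
qed simp

section \<open>The seminorm of the dual of a subspace\<close>

definition dual_seminorm :: "'a::real_normed_vector set \<Rightarrow> ('a \<Rightarrow>\<^sub>L real) \<Rightarrow> real" where
  "dual_seminorm Y f = dual_norm Y (blinfun_apply f)"

lemma blinfun_cball_bound:
  "x \<in> Y \<inter> cball 0 1 \<Longrightarrow> \<bar>blinfun_apply f x\<bar> \<le> norm (f :: 'a::real_normed_vector \<Rightarrow>\<^sub>L real)"
  using norm_blinfun[of f x] mult_left_mono[of "norm x" 1 "norm f"] by auto

lemma dual_seminorm_upper:
  assumes "x \<in> Y \<inter> cball 0 1"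
  shows "\<bar>blinfun_apply f x\<bar> \<le> dual_seminorm Y f"
  unfolding dual_seminorm_def dual_norm_def
  using assms blinfun_cball_bound by (intro cSUP_upper bdd_aboveI2) auto

lemma dual_seminorm_least:
  assumes "subspace Y" "\<And>x. x \<in> Y \<inter> cball 0 1 \<Longrightarrow> \<bar>blinfun_apply f x\<bar> \<le> e"
  shows "dual_seminorm Y f \<le> e"
proof -
  have "Y \<inter> cball 0 1 \<noteq> {}" using subspace_0[OF assms(1)] by force
  then show ?thesis
    unfolding dual_seminorm_def dual_norm_def using assms(2) by (intro cSUP_least) auto
qed

lemma dual_seminorm_le_norm: "subspace Y \<Longrightarrow> dual_seminorm Y f \<le> norm f"
  by (intro dual_seminorm_least blinfun_cball_bound)

lemma dual_seminorm_nonneg: "subspace Y \<Longrightarrow> 0 \<le> dual_seminorm Y f"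
  using dual_seminorm_upper[of 0 Y f] subspace_0 by (fastforce simp: blinfun.zero_right)

lemma abs_le_dual_seminorm:
  assumes "subspace Y" "y \<in> Y"
  shows "\<bar>blinfun_apply f y\<bar> \<le> dual_seminorm Y f * norm y"
proof (cases "y = 0")
  case False
  then have "\<bar>blinfun_apply f ((1 / norm y) *\<^sub>R y)\<bar> \<le> dual_seminorm Y f"
    using assms by (intro dual_seminorm_upper) (auto simp: subspace_scale)
  then show ?thesis using False by (simp add: blinfun.scaleR_right abs_mult field_simps)
qed (simp add: blinfun.zero_right)

lemma dual_seminorm_add:
  assumes "subspace Y"
  shows "dual_seminorm Y (f + g) \<le> dual_seminorm Y f + dual_seminorm Y g"
proof (rule dual_seminorm_least[OF assms])
  fix x assume x: "x \<in> Y \<inter> cball 0 1"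
  show "\<bar>blinfun_apply (f + g) x\<bar> \<le> dual_seminorm Y f + dual_seminorm Y g"
    using dual_seminorm_upper[OF x, of f] dual_seminorm_upper[OF x, of g] by (simp add: blinfun.add_left)
qed

lemma dual_seminorm_scaleR_le:
  assumes "subspace Y" "c \<ge> 0"
  shows "dual_seminorm Y (c *\<^sub>R f) \<le> c * dual_seminorm Y f"
proof (rule dual_seminorm_least[OF assms(1)])
  fix x assume x: "x \<in> Y \<inter> cball 0 1"
  show "\<bar>blinfun_apply (c *\<^sub>R f) x\<bar> \<le> c * dual_seminorm Y f"
    using mult_left_mono[OF dual_seminorm_upper[OF x, of f] assms(2)] assms(2)
    by (simp add: blinfun.scaleR_left abs_mult)
qed

lemma dual_seminorm_minus_commute: "dual_seminorm Y (f - g) = dual_seminorm Y (g - f)"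
  unfolding dual_seminorm_def dual_norm_def by (simp add: blinfun.diff_left abs_minus_commute)

text \<open>A supremum of weak-star continuous functions: it suffices to watch one point of
  \<open>Y\<close> in the unit ball at which \<open>g\<close> nearly attains its seminorm.\<close>

lemma dual_seminorm_lsc:
  fixes f :: "nat \<Rightarrow> 'a::real_normed_vector \<Rightarrow>\<^sub>L real"
  assumes Y: "subspace Y" and lim: "\<And>x. (\<lambda>n. f n x) \<longlonglongrightarrow> blinfun_apply g x" and e: "e > 0"
  shows "\<forall>\<^sub>F n in sequentially. dual_seminorm Y g \<le> dual_seminorm Y (f n) + e"
proof -
  have "\<exists>x \<in> Y \<inter> cball 0 1. \<bar>blinfun_apply g x\<bar> > dual_seminorm Y g - e"
  proof (rule ccontr)
    assume "\<not> ?thesis"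
    then have "dual_seminorm Y g \<le> dual_seminorm Y g - e"
      by (intro dual_seminorm_least[OF Y]) (auto simp: not_less)
    then show False using e by simp
  qed
  then obtain x where x: "x \<in> Y \<inter> cball 0 1" "\<bar>blinfun_apply g x\<bar> > dual_seminorm Y g - e" by blast
  have "(\<lambda>n. \<bar>f n x\<bar>) \<longlonglongrightarrow> \<bar>blinfun_apply g x\<bar>" by (intro tendsto_rabs lim)
  then have "\<forall>\<^sub>F n in sequentially. \<bar>f n x\<bar> > dual_seminorm Y g - e"
    using x(2) by (rule order_tendstoD)
  then show ?thesis
    by eventually_elim (use dual_seminorm_upper[OF x(1)] in \<open>smt (verit)\<close>)
qed

text \<open>The penalty \<open>\<theta>\<close> is convex, weak-star lower semicontinuous and locally uniformly convex for
  the seminorm of the dual of \<open>Y\<close>: the square of the distance to a nearby \<open>fs n\<close> already controls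
  the distance between two functionals whose midpoint has almost the average penalty.\<close>

locale dense_functionals =
  fixes Y :: "'a::banach set" and fs :: "nat \<Rightarrow> 'a \<Rightarrow>\<^sub>L real"
  assumes A: "asplund TYPE('a)" and Y: "subspace Y"
    and fs: "\<And>n. norm (fs n) \<le> 1"
    and dense: "\<And>f e. norm f \<le> 1 \<Longrightarrow> e > 0 \<Longrightarrow>
      \<exists>n. \<forall>y\<in>Y. \<bar>blinfun_apply f y - fs n y\<bar> \<le> e * norm y"
begin

definition "gap f n = dual_seminorm Y (f - fs n)"

definition "\<theta> f = (\<Sum>n. (1/2) ^ Suc n * (gap f n)\<^sup>2)"

definition "pen c y f = blinfun_apply f y - c * \<theta> f"

text \<open>The Fenchel conjugate of \<open>c * \<theta>\<close> on the unit ball of the dual. For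
  \<open>c = 0\<close> it is the norm; a positive \<open>c\<close> makes the maximising functional
  unique on \<open>Y\<close>, which is the source of smoothness.\<close>

definition "supp c y = (SUP f\<in>cball 0 1. pen c y f)"

section \<open>Bounds for the penalty and its conjugate\<close>

lemma gap_nonneg: "0 \<le> gap f n"
  by (simp add: gap_def dual_seminorm_nonneg[OF Y])

lemma gap_le: "norm f \<le> 1 \<Longrightarrow> gap f n \<le> 2"
  unfolding gap_def using dual_seminorm_le_norm[OF Y, of "f - fs n"] norm_triangle_ineq4[of f "fs n"] fs[of n]
  by linarith

lemma gap_square_le: "norm f \<le> 1 \<Longrightarrow> (gap f n)\<^sup>2 \<le> 4"
  using power_mono[OF gap_le gap_nonneg, of f n 2] by simp

lemma half_powers_sums: "(\<lambda>n. (1/2) ^ Suc n * c) sums (c :: real)"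
  using sums_mult2[OF power_half_series, of c] by simp

lemma \<theta>_summable: "norm f \<le> 1 \<Longrightarrow> summable (\<lambda>n. (1/2) ^ Suc n * (gap f n)\<^sup>2)"
  by (rule summable_comparison_test'[OF sums_summable[OF half_powers_sums[of 4]], of 0])
    (auto simp: gap_square_le)

lemma \<theta>_nonneg: "norm f \<le> 1 \<Longrightarrow> 0 \<le> \<theta> f"
  unfolding \<theta>_def by (intro suminf_nonneg \<theta>_summable) auto

lemma \<theta>_le: "norm f \<le> 1 \<Longrightarrow> \<theta> f \<le> 4"
  unfolding \<theta>_def
  using suminf_le[of "\<lambda>n. (1/2) ^ Suc n * (gap f n)\<^sup>2" "\<lambda>n. (1/2) ^ Suc n * 4"]
    \<theta>_summable[of f] half_powers_sums[of 4] gap_square_le[of f]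
  by (auto simp: sums_iff)

lemma pen_le:
  assumes "norm f \<le> 1" "c \<ge> 0"
  shows "pen c y f \<le> norm y"
  using abs_blinfun_le_norm[OF assms(1), of y] mult_nonneg_nonneg[OF assms(2) \<theta>_nonneg[OF assms(1)]]
  unfolding pen_def by (simp add: abs_le_iff)

lemma pen_le_supp: "norm f \<le> 1 \<Longrightarrow> c \<ge> 0 \<Longrightarrow> pen c y f \<le> supp c y"
  unfolding supp_def by (intro cSUP_upper bdd_aboveI2[of _ _ "norm y"] pen_le) auto

lemma supp_le: "(\<And>f. norm f \<le> 1 \<Longrightarrow> pen c y f \<le> b) \<Longrightarrow> supp c y \<le> b"
  unfolding supp_def by (intro cSUP_least) auto

text \<open>A norming functional for \<open>y\<close> loses at most \<open>4 * c\<close>: gaps are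
  at most 2 on the unit ball and the weights add up to 1, so \<open>\<theta>\<close> is at most
  4.\<close>

lemma supp_bounds:
  assumes c: "c \<ge> 0"
  shows "norm y - 4 * c \<le> supp c y" "supp c y \<le> norm y"
proof -
  obtain g :: "'a \<Rightarrow>\<^sub>L real" where g: "norm g \<le> 1" "blinfun_apply g y = norm y"
    by (rule norming_functional)
  have "c * \<theta> g \<le> c * 4" using c \<theta>_le[OF g(1)] by (rule mult_left_mono[rotated])
  then show "norm y - 4 * c \<le> supp c y"
    using pen_le_supp[OF g(1) c, of y] g(2) by (simp add: pen_def)
  show "supp c y \<le> norm y" using pen_le c by (intro supp_le)
qed

lemma supp_lipschitz:
  assumes c: "c \<ge> 0"
  shows "supp c (y + h) - supp c y \<le> norm h"
proof -
  have "supp c (y + h) \<le> supp c y + norm h"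
  proof (rule supp_le)
    fix f :: "'a \<Rightarrow>\<^sub>L real" assume f: "norm f \<le> 1"
    have "pen c (y + h) f = pen c y f + blinfun_apply f h"
      by (simp add: pen_def blinfun.add_right)
    then show "pen c (y + h) f \<le> supp c y + norm h"
      using pen_le_supp[OF f c, of y] abs_blinfun_le_norm[OF f, of h] by simp
  qed
  then show ?thesis by simp
qed

lemma convex_on_supp:
  assumes c: "c \<ge> 0"
  shows "convex_on UNIV (supp c)"
proof (intro convex_onI)
  fix t :: real and x y :: 'a assume t: "0 < t" "t < 1"
  show "supp c ((1 - t) *\<^sub>R x + t *\<^sub>R y) \<le> (1 - t) * supp c x + t * supp c y"
  proof (rule supp_le)
    fix f :: "'a \<Rightarrow>\<^sub>L real" assume f: "norm f \<le> 1"
    have "pen c ((1 - t) *\<^sub>R x + t *\<^sub>R y) f = (1 - t) * pen c x f + t * pen c y f"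
      unfolding pen_def blinfun.add_right blinfun.scaleR_right by (simp add: algebra_simps)
    also have "\<dots> \<le> (1 - t) * supp c x + t * supp c y"
      using t pen_le_supp[OF f c] by (intro add_mono mult_left_mono) auto
    finally show "pen c ((1 - t) *\<^sub>R x + t *\<^sub>R y) f \<le> (1 - t) * supp c x + t * supp c y" .
  qed
qed simp

text \<open>Finitely many terms exhaust \<open>\<theta> g\<close> up to \<open>e / 2\<close>, and
  each of them is lower semicontinuous. A loss of \<open>e / 8\<close> in a gap becomes at most
  \<open>e / 2\<close> in its square, since two gaps add up to at most 4.\<close>

lemma \<theta>_lsc:
  assumes f: "\<And>n. norm (f n) \<le> 1" and g: "norm g \<le> 1"
    and lim: "\<And>x. (\<lambda>n. blinfun_apply (f n) x) \<longlonglongrightarrow> blinfun_apply g x" and e: "e > 0"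
  shows "\<forall>\<^sub>F k in sequentially. \<theta> g \<le> \<theta> (f k) + e"
proof -
  have "(\<lambda>N. \<Sum>n<N. (1/2) ^ Suc n * (gap g n)\<^sup>2) \<longlonglongrightarrow> \<theta> g"
    unfolding \<theta>_def by (rule summable_LIMSEQ[OF \<theta>_summable[OF g]])
  then have "\<forall>\<^sub>F N in sequentially. (\<Sum>n<N. (1/2) ^ Suc n * (gap g n)\<^sup>2) > \<theta> g - e / 2"
    using e by (intro order_tendstoD) auto
  then obtain N where N: "(\<Sum>n<N. (1/2) ^ Suc n * (gap g n)\<^sup>2) > \<theta> g - e / 2"
    using eventually_happens'[OF sequentially_bot] by blast
  have "\<forall>\<^sub>F k in sequentially. \<forall>n\<in>{..<N}. gap g n \<le> gap (f k) n + e / 8"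
  proof (rule eventually_ball_finite, simp, rule ballI)
    fix n
    show "\<forall>\<^sub>F k in sequentially. gap g n \<le> gap (f k) n + e / 8"
      unfolding gap_def using e lim
      by (intro dual_seminorm_lsc[OF Y]) (auto simp: blinfun.diff_left intro: tendsto_diff)
  qed
  then show ?thesis
  proof eventually_elim
    case (elim k)
    have "(gap g n)\<^sup>2 \<le> (gap (f k) n)\<^sup>2 + e / 2" if "n < N" for n
    proof (cases "gap g n \<le> gap (f k) n")
      case True
      then show ?thesis using power_mono[OF True gap_nonneg, of 2] e by simp
    next
      case False
      have "(gap g n)\<^sup>2 - (gap (f k) n)\<^sup>2 = (gap g n - gap (f k) n) * (gap g n + gap (f k) n)"
        by (simp add: power2_eq_square algebra_simps)
      also have "\<dots> \<le> (e / 8) * 4"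
      proof (rule mult_mono)
        have "gap g n \<le> gap (f k) n + e / 8" using elim that by blast
        then show "gap g n - gap (f k) n \<le> e / 8" by simp
        show "gap g n + gap (f k) n \<le> 4"
          using gap_le[OF g, of n] gap_le[OF f, of k n] by simp
      qed (use e gap_nonneg[of g n] gap_nonneg[of "f k" n] in auto)
      finally show ?thesis by simp
    qed
    then have "(\<Sum>n<N. (1/2) ^ Suc n * (gap g n)\<^sup>2) \<le> (\<Sum>n<N. (1/2) ^ Suc n * ((gap (f k) n)\<^sup>2 + e / 2))"
      by (intro sum_mono mult_left_mono) auto
    also have "\<dots> = (\<Sum>n<N. (1/2) ^ Suc n * (gap (f k) n)\<^sup>2) + (\<Sum>n<N. (1/2) ^ Suc n * (e / 2))"
      by (simp add: distrib_left sum.distrib)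
    also have "(\<Sum>n<N. (1/2) ^ Suc n * (gap (f k) n)\<^sup>2) \<le> \<theta> (f k)"
      unfolding \<theta>_def by (intro sum_le_suminf \<theta>_summable f) auto
    also have "(\<Sum>n<N. (1/2) ^ Suc n * (e / 2)) \<le> (\<Sum>n. (1/2) ^ Suc n * (e / 2))"
      using e sums_summable[OF half_powers_sums[of "e / 2"]] by (intro sum_le_suminf) auto
    also have "\<dots> = e / 2" using half_powers_sums[of "e / 2"] by (simp add: sums_iff)
    finally show "\<theta> g \<le> \<theta> (f k) + e" using N by simp
  qed
qed

text \<open>A maximising sequence has a weak-star convergent subsequence, and by
  \<open>\<theta>_lsc\<close> the function \<open>pen c y\<close> is sequentially upper
  semicontinuous for this convergence.\<close>

lemma maximizer_exists:
  assumes c: "c > 0"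
  obtains f where "norm f \<le> 1" "pen c y f = supp c y"
proof -
  have "\<exists>f. norm f \<le> 1 \<and> pen c y f > supp c y - 1 / real (Suc k)" for k
  proof (rule ccontr)
    assume "\<not> ?thesis"
    then have "supp c y \<le> supp c y - 1 / real (Suc k)" by (intro supp_le) (meson not_less)
    then show False by (simp add: field_simps)
  qed
  then obtain f where f: "\<And>k. norm (f k) \<le> 1" "\<And>k. pen c y (f k) > supp c y - 1 / real (Suc k)"
    by metis
  obtain r :: "nat \<Rightarrow> nat" and g where r: "strict_mono r"
    and g: "\<And>x. (\<lambda>n. blinfun_apply (f (r n)) x) \<longlonglongrightarrow> blinfun_apply g x" and ng: "norm g \<le> 1"
    by (rule asplund_weak_star_seq_compact_unit[OF A f(1)], rule that)
  have "supp c y \<le> pen c y g + c * e" if e: "e > 0" for e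
  proof (rule tendsto_le[OF sequentially_bot])
    show "(\<lambda>k. blinfun_apply (f (r k)) y - c * \<theta> g + c * e) \<longlonglongrightarrow> pen c y g + c * e"
      unfolding pen_def by (intro tendsto_intros g)
    have "(\<lambda>k. 1 / real (Suc (r k))) \<longlonglongrightarrow> 0"
      using LIMSEQ_subseq_LIMSEQ[OF LIMSEQ_Suc[OF lim_1_over_n] r] by (simp add: o_def)
    then show "(\<lambda>k. supp c y - 1 / real (Suc (r k))) \<longlonglongrightarrow> supp c y"
      using tendsto_diff[OF tendsto_const[of "supp c y"]] by fastforce
    have "\<forall>\<^sub>F k in sequentially. \<theta> g \<le> \<theta> (f (r k)) + e"
      by (rule \<theta>_lsc[OF f(1) ng g e])
    then show "\<forall>\<^sub>F k in sequentially. supp c y - 1 / real (Suc (r k)) \<le> blinfun_apply (f (r k)) y - c * \<theta> g + c * e"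
    proof eventually_elim
      case (elim k)
      have "c * \<theta> g \<le> c * (\<theta> (f (r k)) + e)" using elim c by simp
      then show ?case using f(2)[of "r k"] by (simp add: pen_def algebra_simps)
    qed
  qed
  then have "supp c y \<le> pen c y g + e" if "e > 0" for e
    using c that by (metis divide_pos_pos nonzero_mult_div_cancel_left order_less_irrefl times_divide_eq_right)
  then have "supp c y \<le> pen c y g" by (rule field_le_epsilon)
  then show ?thesis using that[OF ng] pen_le_supp[OF ng, of c y] c by simp
qed

text \<open>The gap of the midpoint is at most the mean of the gaps, so each term of the defect is
  at least that of the square, \<open>a\<^sup>2 / 2 + b\<^sup>2 / 2 - ((a + b) / 2)\<^sup>2 = (a -
  b)\<^sup>2 / 4\<close>. As no term is negative, a single one may be kept.\<close>

lemma \<theta>_midpoint: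
  assumes f: "norm f \<le> 1" and g: "norm g \<le> 1"
  shows "(1/2) ^ Suc n * ((gap f n - gap g n)\<^sup>2 / 4) \<le> \<theta> f / 2 + \<theta> g / 2 - \<theta> ((1/2) *\<^sub>R (f + g))"
proof -
  let ?m = "(1/2) *\<^sub>R (f + g)"
  have m: "norm ?m \<le> 1" using norm_triangle_ineq[of f g] f g by simp
  have gm: "gap ?m k \<le> (gap f k + gap g k) / 2" for k
  proof -
    have "?m - fs k = (1/2) *\<^sub>R (f - fs k) + (1/2) *\<^sub>R (g - fs k)"
    proof -
      have "fs k = (1/2) *\<^sub>R fs k + (1/2) *\<^sub>R fs k" by (simp flip: scaleR_add_left)
      then have "?m - fs k = ?m - ((1/2) *\<^sub>R fs k + (1/2) *\<^sub>R fs k)" by simp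
      then show ?thesis by (simp add: scaleR_add_right scaleR_diff_right)
    qed
    then have "gap ?m k \<le> dual_seminorm Y ((1/2) *\<^sub>R (f - fs k)) + dual_seminorm Y ((1/2) *\<^sub>R (g - fs k))"
      unfolding gap_def using dual_seminorm_add[OF Y] by metis
    then show ?thesis
      using dual_seminorm_scaleR_le[OF Y, of "1/2" "f - fs k"] dual_seminorm_scaleR_le[OF Y, of "1/2" "g - fs k"]
      by (simp add: gap_def)
  qed
  have ineq: "(gap f k - gap g k)\<^sup>2 / 4 \<le> (gap f k)\<^sup>2 / 2 + (gap g k)\<^sup>2 / 2 - (gap ?m k)\<^sup>2" for k
  proof -
    have "(gap ?m k)\<^sup>2 \<le> ((gap f k + gap g k) / 2)\<^sup>2"
      by (rule power_mono[OF gm gap_nonneg])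
    then show ?thesis by (simp add: power2_eq_square field_simps)
  qed
  let ?D = "\<lambda>k. (1/2) ^ Suc k * ((gap f k)\<^sup>2 / 2 + (gap g k)\<^sup>2 / 2 - (gap ?m k)\<^sup>2)"
  have "(\<lambda>k. (1/2) ^ Suc k * (gap f k)\<^sup>2 / 2 + (1/2) ^ Suc k * (gap g k)\<^sup>2 / 2 - (1/2) ^ Suc k * (gap ?m k)\<^sup>2)
      sums (\<theta> f / 2 + \<theta> g / 2 - \<theta> ?m)"
    unfolding \<theta>_def using f g m by (intro sums_diff sums_add sums_divide summable_sums \<theta>_summable)
  then have D: "?D sums (\<theta> f / 2 + \<theta> g / 2 - \<theta> ?m)" by (simp add: algebra_simps)
  have nonneg: "0 \<le> (gap f k)\<^sup>2 / 2 + (gap g k)\<^sup>2 / 2 - (gap ?m k)\<^sup>2" for k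
    by (rule order_trans[OF _ ineq[of k]]) simp
  have "(1/2) ^ Suc n * ((gap f n - gap g n)\<^sup>2 / 4) \<le> ?D n"
    using ineq by (intro mult_left_mono) auto
  also have "?D n = sum ?D {n}" by simp
  also have "\<dots> \<le> suminf ?D"
    using nonneg sums_summable[OF D] by (intro sum_le_suminf) (auto intro!: mult_nonneg_nonneg)
  also have "\<dots> = \<theta> f / 2 + \<theta> g / 2 - \<theta> ?m" using D by (simp add: sums_iff)
  finally show ?thesis .
qed

text \<open>The midpoint of \<open>f\<close> and \<open>f0\<close> cannot beat
  \<open>supp c y\<close>, so the convexity defect of \<open>\<theta>\<close> is small and
  \<open>f\<close> and \<open>f0\<close> have nearly equal gaps to a chosen \<open>fs n\<close>.
  With \<open>fs n\<close> close to \<open>f0\<close>, both gaps are small, and the triangle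
  inequality through \<open>fs n\<close> applies.\<close>

lemma near_maximizers_close:
  assumes c: "c > 0" and f0: "norm f0 \<le> 1" "pen c y f0 = supp c y" and e: "e > 0"
  obtains \<eta> where "\<eta> > 0"
    "\<And>f. norm f \<le> 1 \<Longrightarrow> pen c y f \<ge> supp c y - \<eta> \<Longrightarrow> dual_seminorm Y (f - f0) \<le> e"
proof -
  obtain n where n: "\<And>y. y \<in> Y \<Longrightarrow> \<bar>f0 y - fs n y\<bar> \<le> (e/4) * norm y"
    using dense[OF f0(1), of "e/4"] e by auto
  have g0: "gap f0 n \<le> e / 4"
    unfolding gap_def
  proof (rule dual_seminorm_least[OF Y])
    fix x assume x: "x \<in> Y \<inter> cball 0 1"
    then have "\<bar>blinfun_apply (f0 - fs n) x\<bar> \<le> (e/4) * norm x" using n by (simp add: blinfun.diff_left)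
    also have "\<dots> \<le> (e/4) * 1" using x e by (intro mult_left_mono) auto
    finally show "\<bar>blinfun_apply (f0 - fs n) x\<bar> \<le> e / 4" by simp
  qed
  define w where "w = (1/2 :: real) ^ Suc n"
  have w: "w > 0" by (simp add: w_def)
  \<comment> \<open>The midpoint inherits half of the deficit of \<open>f\<close>; together with the
    factor \<open>1/4\<close> in \<open>\<theta>_midpoint\<close> this value forces the gaps to
    differ by at most \<open>e / 4\<close>.\<close>
  define \<eta> where "\<eta> = c * w * (e/4)\<^sup>2 / 2"
  have \<eta>: "\<eta> > 0" using c w e by (simp add: \<eta>_def)
  have "dual_seminorm Y (f - f0) \<le> e" if f: "norm f \<le> 1" and near: "pen c y f \<ge> supp c y - \<eta>" for f
  proof -
    let ?m = "(1/2) *\<^sub>R (f + f0)"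
    have m: "norm ?m \<le> 1" using norm_triangle_ineq[of f f0] f f0 by simp
    have "pen c y ?m \<le> supp c y" using pen_le_supp[OF m, of c y] c by simp
    moreover have "pen c y ?m = pen c y f / 2 + pen c y f0 / 2 + c * (\<theta> f / 2 + \<theta> f0 / 2 - \<theta> ?m)"
      unfolding pen_def blinfun.scaleR_left blinfun.add_left by (simp add: field_simps)
    ultimately have "c * (\<theta> f / 2 + \<theta> f0 / 2 - \<theta> ?m) \<le> \<eta> / 2"
      using near f0(2) by simp
    moreover have "c * (w * ((gap f n - gap f0 n)\<^sup>2 / 4)) \<le> c * (\<theta> f / 2 + \<theta> f0 / 2 - \<theta> ?m)"
      using \<theta>_midpoint[OF f f0(1), of n] c by (simp add: w_def)
    ultimately have "c * (w * ((gap f n - gap f0 n)\<^sup>2 / 4)) \<le> c * (w * ((e/4)\<^sup>2 / 4))"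
      by (simp add: \<eta>_def)
    then have "(gap f n - gap f0 n)\<^sup>2 \<le> (e/4)\<^sup>2" using c w by simp
    then have "\<bar>gap f n - gap f0 n\<bar> \<le> e / 4" using e by (simp add: abs_le_square_iff[symmetric])
    then have "gap f n - gap f0 n \<le> e / 4" by linarith
    then have "gap f n \<le> e / 2" using g0 by simp
    moreover have "dual_seminorm Y (f - f0) \<le> gap f n + gap f0 n"
      using dual_seminorm_add[OF Y, of "f - fs n" "fs n - f0"] dual_seminorm_minus_commute[of Y f0 "fs n"]
      by (simp add: gap_def)
    ultimately show ?thesis using g0 e by simp
  qed
  then show ?thesis using that \<eta> by blast
qed

text \<open>Smulian's argument: for small \<open>h\<close> only functionals that nearly maximise at
  \<open>y\<close> compete at \<open>y + h\<close>. On \<open>Y\<close> these are close to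
  \<open>f0\<close>, which therefore acts as the derivative along \<open>Y\<close>.\<close>

lemma supp_smooth:
  assumes c: "c > 0"
  shows "smooth_along Y (supp c) y"
  unfolding smooth_along_def
proof (intro allI impI)
  fix e :: real assume e: "e > 0"
  obtain f0 where f0: "norm f0 \<le> 1" "pen c y f0 = supp c y" by (rule maximizer_exists[OF c])
  obtain \<eta> where \<eta>: "\<eta> > 0"
    "\<And>f. norm f \<le> 1 \<Longrightarrow> pen c y f \<ge> supp c y - \<eta> \<Longrightarrow> dual_seminorm Y (f - f0) \<le> e / 2"
    by (rule near_maximizers_close[OF c f0, of "e/2"]) (use e in simp, rule that)
  have key: "supp c (y + h) \<le> supp c y + f0 h + (e / 2) * norm h"
    if h: "h \<in> Y" "norm h \<le> \<eta> / 3" for h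
  proof (rule supp_le)
    fix f :: "'a \<Rightarrow>\<^sub>L real" assume f: "norm f \<le> 1"
    have eq: "pen c (y + h) f = pen c y f + blinfun_apply f h" by (simp add: pen_def blinfun.add_right)
    show "pen c (y + h) f \<le> supp c y + f0 h + (e / 2) * norm h"
    proof (cases "pen c y f \<ge> supp c y - \<eta>")
      case True
      have "blinfun_apply f h - f0 h \<le> dual_seminorm Y (f - f0) * norm h"
        using abs_le_dual_seminorm[OF Y h(1), of "f - f0"] by (simp add: blinfun.diff_left)
      also have "\<dots> \<le> (e / 2) * norm h" using \<eta>(2)[OF f True] by (rule mult_right_mono) simp
      finally show ?thesis using eq pen_le_supp[OF f, of c y] c by simp
    next
      \<comment> \<open>A functional that misses the supremum at \<open>y\<close> by more than
        \<open>\<eta>\<close> cannot catch up, since \<open>f\<close> and \<open>f0\<close> are both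
        at most \<open>\<eta> / 3\<close> in absolute value at \<open>h\<close>.\<close>
      case False
      have "0 \<le> (e / 2) * norm h" using e by simp
      then show ?thesis using False eq abs_blinfun_le_norm[OF f, of h] abs_blinfun_le_norm[OF f0(1), of h] h(2) \<eta>(1) by (simp add: abs_le_iff)
    qed
  qed
  show "\<exists>d>0. \<forall>h\<in>Y. norm h \<le> d \<longrightarrow> supp c (y + h) + supp c (y - h) - 2 * supp c y \<le> e * norm h"
  proof (intro exI[of _ "\<eta> / 3"] conjI ballI impI)
    fix h assume h: "h \<in> Y" "norm h \<le> \<eta> / 3"
    have "supp c (y - h) \<le> supp c y - f0 h + (e / 2) * norm h"
      using key[of "- h"] h subspace_neg[OF Y] by (simp add: blinfun.minus_right)
    with key[OF h] show "supp c (y + h) + supp c (y - h) - 2 * supp c y \<le> e * norm h"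
      by (simp add: algebra_simps)
  qed (use \<eta> in simp)
qed

text \<open>Averaging over \<open>x\<close> and \<open>- x\<close> gives an even convex function,
  which has its minimum at \<open>0\<close>; subtracting the value there makes it nonnegative. The
  parameter \<open>c/4\<close> offsets the bound 4 on \<open>\<theta>\<close>, so that the function
  stays above \<open>norm x - c\<close>.\<close>

definition "smooth_norm c x = (supp (c/4) x + supp (c/4) (- x)) / 2 - supp (c/4) 0"

lemma smooth_norm_0: "smooth_norm c 0 = 0"
  by (simp add: smooth_norm_def)

lemma smooth_norm_lipschitz: "c \<ge> 0 \<Longrightarrow> smooth_norm c (x + h) - smooth_norm c x \<le> norm h"
  using supp_lipschitz[of "c/4" x h] supp_lipschitz[of "c/4" "- x" "- h"]
  unfolding smooth_norm_def add_divide_distrib by simp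

lemma smooth_norm_eq:
  "smooth_norm c = (\<lambda>x. (1/2 * supp (c/4) x + 1/2 * supp (c/4) (- x + 0)) + - supp (c/4) 0)"
  by (simp add: smooth_norm_def fun_eq_iff)

lemma linear_uminus: "linear (\<lambda>x :: 'z::real_vector. - x)"
  by (intro linear_compose_neg linear_ident)

lemma convex_on_smooth_norm:
  assumes "c \<ge> 0"
  shows "convex_on UNIV (smooth_norm c)"
proof -
  have cvx: "convex_on UNIV (supp (c/4))" using assms by (intro convex_on_supp) simp
  show ?thesis
    unfolding smooth_norm_eq
    by (intro convex_on_add convex_on_cmul cvx convex_on_affine[OF cvx linear_uminus])
      (simp_all add: convex_on_const)
qed

lemma smooth_norm_nonneg:
  assumes c: "c \<ge> 0"
  shows "smooth_norm c x \<ge> 0"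
proof -
  have "convex_on UNIV (supp (c/4))" using c by (intro convex_on_supp) simp
  then have "supp (c/4) ((1 - 1/2) *\<^sub>R x + (1/2) *\<^sub>R (- x)) \<le> (1 - 1/2) * supp (c/4) x + (1/2) * supp (c/4) (- x)"
    by (rule convex_onD) auto
  then show ?thesis by (simp add: smooth_norm_def)
qed

lemma smooth_norm_ge: "c \<ge> 0 \<Longrightarrow> smooth_norm c x \<ge> norm x - c"
  using supp_bounds(1)[of "c/4" x] supp_bounds(1)[of "c/4" "- x"] supp_bounds(2)[of "c/4" 0]
  unfolding smooth_norm_def add_divide_distrib by simp

lemma smooth_norm_smooth:
  assumes "c > 0"
  shows "smooth_along Y (smooth_norm c) x"
proof -
  have sm: "smooth_along Y (supp (c/4)) y" for y using assms by (intro supp_smooth) simp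
  show ?thesis
    unfolding smooth_norm_eq
    by (intro smooth_along_add smooth_along_cmult smooth_along_const sm
        smooth_along_affine[where B = 1, OF sm linear_uminus]) (auto simp: subspace_neg[OF Y])
qed

end

section \<open>Perturbed minimisation\<close>

lemma continuous_on_if_increments_le:
  fixes p :: "'z::real_normed_vector \<Rightarrow> real"
  assumes "\<And>x h. p (x + h) - p x \<le> L * norm h"
  shows "continuous_on A p"
proof -
  have b: "p x - p y \<le> L * norm (x - y)" for x y using assms[of y "x - y"] by simp
  have "\<bar>p x - p y\<bar> \<le> \<bar>L\<bar> * norm (x - y)" for x y
    using b[of x y] b[of y x] mult_right_mono[OF abs_ge_self[of L] norm_ge_zero[of "x - y"]]
    by (simp add: norm_minus_commute)
  then have "\<bar>L\<bar>-lipschitz_on A p" by (auto simp: lipschitz_on_def dist_norm)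
  then show ?thesis by (rule lipschitz_on_continuous_on)
qed

text \<open>The comparison with the given point \<open>x\<close> is what makes the values decrease
  along the iteration in \<open>perturbed_minimum_exists\<close>.\<close>

lemma bounded_below_approx_min:
  fixes g :: "'z \<Rightarrow> real"
  assumes "x \<in> D" "\<And>z. z \<in> D \<Longrightarrow> b \<le> g z" "s > 0"
  shows "\<exists>y\<in>D. g y \<le> g x \<and> (\<forall>z\<in>D. g y \<le> g z + s)"
proof -
  have bdd: "bdd_below (g ` D)" using assms(2) by (rule bdd_belowI2)
  have "Inf (g ` D) < Inf (g ` D) + s" using assms(3) by simp
  then have "\<exists>w\<in>g ` D. w < Inf (g ` D) + s" using assms(1) bdd by (subst (asm) cInf_less_iff) auto
  then obtain y where y: "y \<in> D" "g y < Inf (g ` D) + s" by blast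
  have "Inf (g ` D) \<le> g z" if "z \<in> D" for z using bdd that by (simp add: cINF_lower)
  then have near: "g y \<le> g z + s" if "z \<in> D" for z using y(2) that by (meson add_right_mono less_le order_trans)
  show ?thesis
  proof (cases "g y \<le> g x")
    case True
    then show ?thesis using y(1) near by blast
  next
    case False
    then show ?thesis using assms(1) near by (intro bexI[of _ x]) force+
  qed
qed

text \<open>Ekeland's argument with perturbations \<open>N c\<close> that only approximate the norm; taking them
  smooth gives a smooth variational principle.\<close>

lemma perturbed_minimum_exists:
  fixes f :: "'z::real_normed_vector \<Rightarrow> real" and N :: "real \<Rightarrow> 'z \<Rightarrow> real"
  assumes D: "complete D" "x0 \<in> D" and f: "\<And>x h. f (x + h) - f x \<le> L * norm h"
    and low: "\<And>z. z \<in> D \<Longrightarrow> f x0 \<le> f z + \<kappa> * R / 8"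
    and N0: "\<And>c. c > 0 \<Longrightarrow> N c 0 = 0" and Npos: "\<And>c z. c > 0 \<Longrightarrow> N c z \<ge> 0"
    and Nlip: "\<And>c z h. c > 0 \<Longrightarrow> N c (z + h) - N c z \<le> M * norm h" and M: "M \<ge> 0"
    and Nge: "\<And>c z z'. c > 0 \<Longrightarrow> z \<in> D \<Longrightarrow> z' \<in> D \<Longrightarrow> norm (z - z') - c \<le> N c (z - z')"
    and \<kappa>: "\<kappa> > 0" and R: "R > 0"
  obtains u \<mu> c x where "u \<in> D" "norm (u - x0) \<le> R" "\<And>n. \<mu> n \<ge> 0" "\<mu> sums \<kappa>"
    "\<And>n. c n > 0" "\<And>n. x n \<in> D" "\<And>z. summable (\<lambda>n :: nat. \<mu> n * N (c n) (z - x n))"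
    "\<And>z. z \<in> D \<Longrightarrow>
      f u + (\<Sum>n. \<mu> n * N (c n) (u - x n)) \<le> f z + (\<Sum>n. \<mu> n * N (c n) (z - x n))"
proof -
  \<comment> \<open>At stage \<open>n\<close> the error \<open>c n\<close> of the approximate norm
    and the tolerance \<open>\<sigma> n\<close> of near-minimality each contribute
    \<open>\<delta> n / 4\<close> to the distance bound \<open>close\<close>. The starting tolerance
    \<open>\<sigma> 0\<close> is the \<open>\<kappa> * R / 8\<close> of the assumption on
    \<open>x0\<close>.\<close>
  define \<mu> where "\<mu> n = (1/2) ^ Suc n * \<kappa>" for n :: nat
  define \<delta> where "\<delta> n = (1/2) ^ n * R" for n :: nat
  define c where "c n = \<delta> n / 4" for n
  define \<sigma> where "\<sigma> n = \<mu> n * \<delta> n / 4" for n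
  have \<mu>: "\<mu> n > 0" and \<delta>: "\<delta> n > 0" for n using \<kappa> R by (auto simp: \<mu>_def \<delta>_def)
  have c: "c n > 0" and \<sigma>: "\<sigma> n > 0" for n using \<mu>[of n] \<delta>[of n] by (auto simp: c_def \<sigma>_def)
  have \<mu>_sums: "\<mu> sums \<kappa>" unfolding \<mu>_def using sums_mult2[OF power_half_series, of \<kappa>] by simp
  \<comment> \<open>A state pairs the current function with a near-minimiser of it; the next
    function adds a perturbation centred at that point.\<close>
  define P where "P n s \<longleftrightarrow> snd s \<in> D \<and> (\<forall>z\<in>D. fst s (snd s) \<le> fst s z + \<sigma> n)"
    for n and s :: "('z \<Rightarrow> real) \<times> 'z"
  define Q where "Q n s s' \<longleftrightarrow> fst s' = (\<lambda>z. fst s z + \<mu> n * N (c n) (z - snd s)) \<and>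
      fst s' (snd s') \<le> fst s' (snd s)"
    for n and s s' :: "('z \<Rightarrow> real) \<times> 'z"
  have "\<exists>S. \<forall>n. (P n (S n) \<and> (n = 0 \<longrightarrow> S n = (f, x0))) \<and> Q n (S n) (S (Suc n))"
  proof (rule dependent_nat_choice)
    show "\<exists>s. P 0 s \<and> (0 = (0::nat) \<longrightarrow> s = (f, x0))"
      using D(2) low by (intro exI[of _ "(f, x0)"]) (auto simp: P_def \<sigma>_def \<mu>_def \<delta>_def)
  next
    fix s n assume s: "P n s \<and> (n = 0 \<longrightarrow> s = (f, x0))"
    define g' where "g' = (\<lambda>z. fst s z + \<mu> n * N (c n) (z - snd s))"
    have low: "fst s (snd s) - \<sigma> n \<le> g' z" if "z \<in> D" for z
    proof -
      have "fst s (snd s) \<le> fst s z + \<sigma> n" using s that by (auto simp: P_def)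
      moreover have "0 \<le> \<mu> n * N (c n) (z - snd s)" using \<mu>[of n] Npos[OF c] by simp
      ultimately show ?thesis by (simp add: g'_def)
    qed
    have "snd s \<in> D" using s by (simp add: P_def)
    then have "\<exists>y\<in>D. g' y \<le> g' (snd s) \<and> (\<forall>z\<in>D. g' y \<le> g' z + \<sigma> (Suc n))"
      by (rule bounded_below_approx_min[where b = "fst s (snd s) - \<sigma> n"]) (rule low, assumption, rule \<sigma>)
    then obtain y
      where "y \<in> D" "g' y \<le> g' (snd s)" "\<forall>z\<in>D. g' y \<le> g' z + \<sigma> (Suc n)"
      by blast
    then show "\<exists>s'. (P (Suc n) s' \<and> (Suc n = 0 \<longrightarrow> s' = (f, x0))) \<and> Q n s s'"
      by (intro exI[of _ "(g', y)"]) (simp add: P_def Q_def, simp add: g'_def)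
  qed
  then obtain S where S: "\<And>n. P n (S n)" "S 0 = (f, x0)" "\<And>n. Q n (S n) (S (Suc n))"
    by blast
  define g where "g n = fst (S n)" for n
  define x where "x n = snd (S n)" for n
  have g0: "g 0 = f" "x 0 = x0" using S(2) by (simp_all add: g_def x_def)
  have gS: "g (Suc n) z = g n z + \<mu> n * N (c n) (z - x n)" for n z
    using S(3)[of n] by (simp add: Q_def g_def x_def)
  have gdec: "g (Suc n) (x (Suc n)) \<le> g (Suc n) (x n)" for n
    using S(3)[of n] unfolding Q_def g_def x_def by blast
  have x: "x n \<in> D" for n using S(1)[of n] by (simp add: P_def x_def)
  have gnear: "g n (x n) \<le> g n z + \<sigma> n" if "z \<in> D" for n z
    using S(1)[of n] that by (simp add: P_def g_def x_def)
  have g_sum: "g n z = f z + (\<Sum>k<n. \<mu> k * N (c k) (z - x k))" for n z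
    by (induction n) (simp_all add: g0 gS)
  have g_mono: "g n z \<le> g k z" if "n \<le> k" for n k z
    using that
  proof (rule lift_Suc_mono_le[of "\<lambda>n. g n z", rotated])
    show "g n z \<le> g (Suc n) z" for n using \<mu>[of n] Npos[OF c] by (simp add: gS)
  qed
  have val_dec: "g k (x k) \<le> g n (x n)" if "n \<le> k" for n k
    using that
  proof (rule lift_Suc_antimono_le[of "\<lambda>n. g n (x n)", rotated])
    show "g (Suc n) (x (Suc n)) \<le> g n (x n)" for n
      using gdec[of n] by (simp add: gS N0[OF c])
  qed
  \<comment> \<open>The functions increase with the stage while the values at their centres
    decrease, so later centres stay in every earlier sublevel set.\<close>
  have in_S: "g (Suc n) (x k) \<le> g n (x n)" if "n \<le> k" for n k
  proof (cases "n = k")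
    case True
    then show ?thesis by (simp add: gS N0[OF c])
  next
    case False
    then have "g (Suc n) (x k) \<le> g k (x k)" using that by (intro g_mono) simp
    then show ?thesis using val_dec[OF that] by simp
  qed
  have close: "norm (z - x n) \<le> \<delta> n / 2" if z: "z \<in> D" "g (Suc n) z \<le> g n (x n)" for z n
  proof -
    have "\<mu> n * (norm (z - x n) - c n) \<le> \<mu> n * N (c n) (z - x n)"
      using \<mu>[of n] Nge[OF c z(1) x[of n]] by simp
    also have "\<dots> \<le> \<sigma> n" using z(2) gnear[OF z(1), of n] by (simp add: gS)
    also have "\<dots> = \<mu> n * (\<delta> n / 4)" by (simp add: \<sigma>_def)
    finally have "norm (z - x n) - c n \<le> \<delta> n / 4" using \<mu>[of n] by simp
    then show ?thesis by (simp add: c_def)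
  qed
  have xk: "norm (x k - x n) \<le> \<delta> n / 2" if "n \<le> k" for n k
    by (rule close[OF x in_S[OF that]])
  have \<delta>0: "\<delta> \<longlonglongrightarrow> 0"
    unfolding \<delta>_def using tendsto_mult_left_zero[OF LIMSEQ_power_zero[of "1/2 :: real"], of R] by simp
  have "Cauchy x"
  proof (rule metric_CauchyI)
    fix e :: real assume "e > 0"
    then obtain n where n: "\<delta> n < e"
      using eventually_happens'[OF sequentially_bot order_tendstoD(2)[OF \<delta>0]] by blast
    have "dist (x k) (x l) < e" if "k \<ge> n" "l \<ge> n" for k l
    proof -
      have "dist (x k) (x l) \<le> norm (x k - x n) + norm (x l - x n)"
        using dist_triangle2[of "x k" "x l" "x n"] by (simp add: dist_norm)
      also have "\<dots> \<le> \<delta> n" using xk[OF that(1)] xk[OF that(2)] by simp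
      finally show ?thesis using n by simp
    qed
    then show "\<exists>n. \<forall>k\<ge>n. \<forall>l\<ge>n. dist (x k) (x l) < e" by blast
  qed
  then obtain u where uD: "u \<in> D" and u: "x \<longlonglongrightarrow> u"
    using D(1) x unfolding complete_def by blast
  have cont: "continuous_on UNIV (g n)" for n
  proof -
    have "continuous_on UNIV (N (c k))" for k by (rule continuous_on_if_increments_le[OF Nlip[OF c]])
    then have "continuous_on UNIV (\<lambda>z. N (c k) (z - x k))" for k
      by (rule continuous_on_compose2) (auto intro!: continuous_intros)
    then have "continuous_on UNIV (\<lambda>z. f z + (\<Sum>k<n. \<mu> k * N (c k) (z - x k)))"
      by (intro continuous_intros continuous_on_if_increments_le[OF f]) auto
    then show ?thesis using g_sum[of n] by presburger
  qed
  have u_in: "g (Suc n) u \<le> g n (x n)" for n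
  proof (rule LIMSEQ_le_const2)
    show "(\<lambda>k. g (Suc n) (x k)) \<longlonglongrightarrow> g (Suc n) u"
      using continuous_on_tendsto_compose[OF cont u] by simp
    show "\<exists>K. \<forall>k\<ge>K. g (Suc n) (x k) \<le> g n (x n)" using in_S by blast
  qed
  have ux: "norm (u - x0) \<le> R"
    using close[OF uD u_in[of 0]] R by (simp add: g0 \<delta>_def)
  have smb: "summable (\<lambda>n. \<mu> n * N (c n) (z - x n))" for z
  proof (rule summable_comparison_test'[of "\<lambda>n. \<mu> n * (M * (norm (z - x0) + R))" 0])
    show "summable (\<lambda>n. \<mu> n * (M * (norm (z - x0) + R)))"
      using \<mu>_sums by (intro summable_mult2) (simp add: sums_iff)
    fix n :: nat
    have "norm (x n - x0) \<le> R" using xk[of 0 n] R by (simp add: g0 \<delta>_def)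
    then have "norm (z - x n) \<le> norm (z - x0) + R"
      using norm_triangle_ineq4[of "z - x0" "x n - x0"] by simp
    moreover have "N (c n) (z - x n) \<le> M * norm (z - x n)" using Nlip[OF c, of n 0 "z - x n"] N0[OF c] by simp
    ultimately have "N (c n) (z - x n) \<le> M * (norm (z - x0) + R)"
      using M by (meson mult_left_mono order_trans)
    then show "norm (\<mu> n * N (c n) (z - x n)) \<le> \<mu> n * (M * (norm (z - x0) + R))"
      using \<mu>[of n] Npos[OF c, of n "z - x n"] by (simp add: abs_mult)
  qed
  have glim: "(\<lambda>n. g n z) \<longlonglongrightarrow> f z + (\<Sum>n. \<mu> n * N (c n) (z - x n))" for z
    unfolding g_sum by (intro tendsto_add tendsto_const summable_LIMSEQ smb)
  have \<sigma>0: "\<sigma> \<longlonglongrightarrow> 0"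
  proof -
    have "(\<lambda>n. \<mu> n * \<delta> n / 4) \<longlonglongrightarrow> 0 * 0 / 4"
      using \<mu>_sums by (intro tendsto_divide tendsto_mult \<delta>0 summable_LIMSEQ_zero tendsto_const) (auto simp: sums_iff)
    then show ?thesis by (simp add: \<sigma>_def[abs_def])
  qed
  \<comment> \<open>At stage \<open>n\<close> the limit \<open>u\<close> is at most the value at the
    centre, which is minimal up to \<open>\<sigma> n\<close>; the tolerance vanishes in the
    limit.\<close>
  have min: "f u + (\<Sum>n. \<mu> n * N (c n) (u - x n)) \<le> f z + (\<Sum>n. \<mu> n * N (c n) (z - x n))"
    if z: "z \<in> D" for z
  proof (rule LIMSEQ_le)
    show "(\<lambda>n. g n u) \<longlonglongrightarrow> f u + (\<Sum>n. \<mu> n * N (c n) (u - x n))" by (rule glim)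
    show "(\<lambda>n. g n z + \<sigma> n) \<longlonglongrightarrow> f z + (\<Sum>n. \<mu> n * N (c n) (z - x n))"
      using tendsto_add[OF glim \<sigma>0] by simp
    have "g n u \<le> g n z + \<sigma> n" for n
      using g_mono[of n "Suc n" u] u_in[of n] gnear[OF z, of n] by simp
    then show "\<exists>K. \<forall>n\<ge>K. g n u \<le> g n z + \<sigma> n" by blast
  qed
  show ?thesis
    by (rule that[of u \<mu> c x, OF uD ux less_imp_le[OF \<mu>] \<mu>_sums c x smb min])
qed

lemma suminf_increment_le:
  fixes q :: "nat \<Rightarrow> 'z::real_normed_vector \<Rightarrow> real"
  assumes \<mu>: "\<And>n. \<mu> n \<ge> 0" "\<mu> sums \<kappa>" and lip: "\<And>n. q n (z + h) - q n z \<le> b"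
    and smb: "\<And>z. summable (\<lambda>n. \<mu> n * q n z)"
  shows "(\<Sum>n. \<mu> n * q n (z + h)) - (\<Sum>n. \<mu> n * q n z) \<le> \<kappa> * b"
proof -
  have "(\<Sum>n. \<mu> n * q n (z + h)) - (\<Sum>n. \<mu> n * q n z) = (\<Sum>n. \<mu> n * q n (z + h) - \<mu> n * q n z)"
    by (rule suminf_diff[OF smb smb])
  also have "\<dots> \<le> (\<Sum>n. \<mu> n * b)"
  proof (rule suminf_le)
    fix n
    show "\<mu> n * q n (z + h) - \<mu> n * q n z \<le> \<mu> n * b"
      using mult_left_mono[OF lip \<mu>(1)[of n]] by (simp add: right_diff_distrib)
  qed (use \<mu>(2) in \<open>auto intro!: summable_diff smb summable_mult2 simp: sums_iff\<close>)
  also have "\<dots> = \<kappa> * b" using sums_mult2[OF \<mu>(2), of b] by (simp add: sums_iff)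
  finally show ?thesis .
qed

lemma convex_on_suminf:
  fixes q :: "nat \<Rightarrow> 'z::real_normed_vector \<Rightarrow> real"
  assumes \<mu>: "\<And>n. \<mu> n \<ge> 0" and cvx: "\<And>n. convex_on UNIV (q n)"
    and smb: "\<And>z. summable (\<lambda>n. \<mu> n * q n z)"
  shows "convex_on UNIV (\<lambda>z. \<Sum>n. \<mu> n * q n z)"
proof (intro convex_onI)
  fix t :: real and x y :: 'z assume t: "0 < t" "t < 1"
  have "(\<Sum>n. \<mu> n * q n ((1 - t) *\<^sub>R x + t *\<^sub>R y)) \<le> (\<Sum>n. (1 - t) * (\<mu> n * q n x) + t * (\<mu> n * q n y))"
  proof (rule suminf_le)
    fix n
    have "q n ((1 - t) *\<^sub>R x + t *\<^sub>R y) \<le> (1 - t) * q n x + t * q n y"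
      using convex_onD[OF cvx[of n], of t x y] t by simp
    from mult_left_mono[OF this \<mu>[of n]]
    show "\<mu> n * q n ((1 - t) *\<^sub>R x + t *\<^sub>R y) \<le> (1 - t) * (\<mu> n * q n x) + t * (\<mu> n * q n y)"
      by (simp add: algebra_simps)
  qed (intro summable_add summable_mult smb)+
  also have "\<dots> = (1 - t) * (\<Sum>n. \<mu> n * q n x) + t * (\<Sum>n. \<mu> n * q n y)"
    by (simp add: suminf_add[symmetric] suminf_mult smb summable_mult)
  finally show "(\<Sum>n. \<mu> n * q n ((1 - t) *\<^sub>R x + t *\<^sub>R y)) \<le> (1 - t) * (\<Sum>n. \<mu> n * q n x) + t * (\<Sum>n. \<mu> n * q n y)" .
qed simp

section \<open>Separable reduction for normals\<close>

text \<open>A list of triples \<open>(t, n, v)\<close> stands for the conic combination of the constraints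
  \<open>f (v - u) \<le> norm (v - u) / Suc n\<close> with weights \<open>t\<close>. For a positive sequence \<open>q\<close> the constraints
  with \<open>norm (v - u) < q n\<close> together say that \<open>f\<close> is a Frechet normal.\<close>

definition comb_vec :: "'z::real_normed_vector \<Rightarrow> (real \<times> nat \<times> 'z) list \<Rightarrow> 'z" where
  "comb_vec u L = (\<Sum>(t, n, v)\<leftarrow>L. t *\<^sub>R (v - u))"

definition comb_cost :: "'z::real_normed_vector \<Rightarrow> (real \<times> nat \<times> 'z) list \<Rightarrow> real" where
  "comb_cost u L = (\<Sum>(t, n, v)\<leftarrow>L. t * norm (v - u) / Suc n)"

definition comb_mass :: "(real \<times> nat \<times> 'z) list \<Rightarrow> real" where
  "comb_mass L = (\<Sum>(t, n, v)\<leftarrow>L. t)"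

definition admissible :: "'z::real_normed_vector set \<Rightarrow> 'z \<Rightarrow> (nat \<Rightarrow> real) \<Rightarrow> (real \<times> nat \<times> 'z) list \<Rightarrow> bool" where
  "admissible \<Omega> u q L \<longleftrightarrow> (\<forall>(t, n, v)\<in>set L. t \<ge> 0 \<and> v \<in> \<Omega> \<and> norm (v - u) < q n)"

lemma comb_simps [simp]:
  "comb_vec u [] = 0" "comb_vec u ((t, n, v) # L) = t *\<^sub>R (v - u) + comb_vec u L"
  "comb_cost u [] = 0" "comb_cost u ((t, n, v) # L) = t * norm (v - u) / Suc n + comb_cost u L"
  "comb_mass [] = 0" "comb_mass ((t, n, v) # L) = t + comb_mass L"
  "admissible \<Omega> u q []"
  "admissible \<Omega> u q ((t, n, v) # L) \<longleftrightarrow> t \<ge> 0 \<and> v \<in> \<Omega> \<and> norm (v - u) < q n \<and> admissible \<Omega> u q L"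
  by (auto simp: comb_vec_def comb_cost_def comb_mass_def admissible_def)

lemma comb_append [simp]:
  "comb_vec u (L @ L') = comb_vec u L + comb_vec u L'"
  "comb_cost u (L @ L') = comb_cost u L + comb_cost u L'"
  "admissible \<Omega> u q (L @ L') \<longleftrightarrow> admissible \<Omega> u q L \<and> admissible \<Omega> u q L'"
  unfolding comb_vec_def comb_cost_def admissible_def by (simp_all add: ball_Un)

lemma comb_cost_nonneg: "admissible \<Omega> u q L \<Longrightarrow> 0 \<le> comb_cost u L"
  by (induction L) auto

lemma comb_mass_nonneg: "admissible \<Omega> u q L \<Longrightarrow> 0 \<le> comb_mass L"
  by (induction L) auto

definition comb_scale :: "real \<Rightarrow> (real \<times> nat \<times> 'z) list \<Rightarrow> (real \<times> nat \<times> 'z) list" where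
  "comb_scale s L = map (\<lambda>(t, n, v). (s * t, n, v)) L"

lemma comb_scale_simps:
  "comb_vec u (comb_scale s L) = s *\<^sub>R comb_vec u L"
  "comb_cost u (comb_scale s L) = s * comb_cost u L"
  "s \<ge> 0 \<Longrightarrow> admissible \<Omega> u q L \<Longrightarrow> admissible \<Omega> u q (comb_scale s L)"
  by (induction L) (auto simp: comb_scale_def algebra_simps)

text \<open>With \<open>comb_vec_diff\<close> this shows that the total weight governs how a
  combination reacts to moving the base point; a bound on \<open>comb_mass\<close> makes the
  criterion for normals stable.\<close>

lemma comb_cost_diff:
  assumes "admissible \<Omega> w q L"
  shows "comb_cost u L - comb_cost u' L \<le> comb_mass L * norm (u - u')"
  using assms
proof (induction L)
  case (Cons a L)
  obtain t n v where a: "a = (t, n, v)" by (cases a)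
  have t: "t \<ge> 0" and L: "admissible \<Omega> w q L" using Cons.prems by (auto simp: a)
  have "norm (v - u) - norm (v - u') \<le> norm (u - u')"
    using norm_triangle_ineq2[of "v - u" "v - u'"] by (simp add: norm_minus_commute)
  then have "(norm (v - u) - norm (v - u')) / Suc n \<le> norm (u - u')"
    by (simp add: field_simps) (smt (verit) mult_nonneg_nonneg norm_ge_zero of_nat_0_le_iff)
  then have "t * ((norm (v - u) - norm (v - u')) / Suc n) \<le> t * norm (u - u')"
    using t by (rule mult_left_mono)
  then show ?case using Cons.IH[OF L] by (simp add: a algebra_simps diff_divide_distrib)
qed simp

lemma comb_vec_diff:
  "comb_vec u L - comb_vec u' L = comb_mass L *\<^sub>R (u' - u)"
  by (induction L) (auto simp: algebra_simps)

lemma linear_comb_vec_le: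
  assumes "linear l" "\<And>t n v. (t, n, v) \<in> set L \<Longrightarrow> t \<ge> 0 \<and> l (v - u) \<le> norm (v - u) / Suc n"
  shows "l (comb_vec u L) \<le> comb_cost u L"
  using assms(2)
proof (induction L)
  case Nil
  then show ?case using linear_0[OF assms(1)] by simp
next
  case (Cons a L)
  obtain t n v where a: "a = (t, n, v)" by (cases a)
  have "t \<ge> 0" "l (v - u) \<le> norm (v - u) / Suc n" using Cons.prems[of t n v] by (auto simp: a)
  then have "t * l (v - u) \<le> t * (norm (v - u) / Suc n)" by (intro mult_left_mono)
  moreover have "l (comb_vec u L) \<le> comb_cost u L" using Cons.prems by (intro Cons.IH) auto
  ultimately show ?case using assms(1) by (simp add: a linear_add linear_scale)
qed

text \<open>\<open>p\<close> is the largest sublinear function that lies below \<open>\<rho>\<close>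
  and respects all constraints. The hypothesis on \<open>\<beta>\<close> says
  \<open>p b \<ge> \<beta>\<close>, and Hahn-Banach gives a linear minorant that agrees with
  \<open>p\<close> at \<open>b\<close>.\<close>

lemma normal_functional_exists:
  fixes \<rho> :: "'z::real_normed_vector \<Rightarrow> real"
  assumes \<rho>: "sublinear \<rho>" "\<And>z. \<rho> z \<ge> 0"
    and \<beta>: "\<And>L. admissible \<Omega> u q L \<Longrightarrow> \<beta> \<le> comb_cost u L + \<rho> (b - comb_vec u L)"
  obtains f where "linear f" "\<And>z. f z \<le> \<rho> z" "f b \<ge> \<beta>"
    "\<And>n v. v \<in> \<Omega> \<Longrightarrow> norm (v - u) < q n \<Longrightarrow> f (v - u) \<le> norm (v - u) / Suc n"
proof -
  define p where "p z = (INF L\<in>Collect (admissible \<Omega> u q). comb_cost u L + \<rho> (z - comb_vec u L))" for z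
  have ne: "Collect (admissible \<Omega> u q) \<noteq> {}" by (auto intro: exI[of _ "[]"])
  have p_le: "p z \<le> comb_cost u L + \<rho> (z - comb_vec u L)" if "admissible \<Omega> u q L" for z L
    unfolding p_def using that comb_cost_nonneg \<rho>(2)
    by (intro cINF_lower bdd_belowI2[of _ 0] add_nonneg_nonneg) auto
  have p_ge: "a \<le> p z" if "\<And>L. admissible \<Omega> u q L \<Longrightarrow> a \<le> comb_cost u L + \<rho> (z - comb_vec u L)" for a z
    unfolding p_def using that ne by (intro cINF_greatest) auto
  have sub: "sublinear p"
  proof (rule sublinearI)
    fix x y
    have *: "p (x + y) \<le> (comb_cost u L + \<rho> (x - comb_vec u L)) + (comb_cost u L' + \<rho> (y - comb_vec u L'))"
      if "admissible \<Omega> u q L" "admissible \<Omega> u q L'" for L L'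
      using p_le[of "L @ L'" "x + y"] that sublinear_add[OF \<rho>(1), of "x - comb_vec u L" "y - comb_vec u L'"]
      by (simp add: algebra_simps)
    have "p (x + y) - (comb_cost u L + \<rho> (x - comb_vec u L)) \<le> p y" if "admissible \<Omega> u q L" for L
      using *[OF that] by (intro p_ge) (simp add: algebra_simps)
    then have "p (x + y) - p y \<le> p x" by (intro p_ge) (simp add: algebra_simps)
    then show "p (x + y) \<le> p x + p y" by simp
  next
    fix t :: real and x :: 'z assume t: "t > 0"
    have "p (t *\<^sub>R x) / t \<le> comb_cost u L + \<rho> (x - comb_vec u L)" if L: "admissible \<Omega> u q L" for L
    proof -
      have "p (t *\<^sub>R x) \<le> t * comb_cost u L + \<rho> (t *\<^sub>R (x - comb_vec u L))"
        using p_le[of "comb_scale t L" "t *\<^sub>R x"] comb_scale_simps(1,2)[where u = u and s = t and L = L]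
          comb_scale_simps(3)[OF _ L, of t] t
        by (simp add: scaleR_diff_right)
      also have "\<dots> = t * (comb_cost u L + \<rho> (x - comb_vec u L))"
        using sublinear_scaleR[OF \<rho>(1)] t by (simp add: distrib_left)
      finally show ?thesis using t by (simp add: field_simps)
    qed
    then have "p (t *\<^sub>R x) / t \<le> p x" by (rule p_ge)
    then show "p (t *\<^sub>R x) \<le> t * p x" using t by (simp add: field_simps)
  next
    have "0 \<le> p 0" using comb_cost_nonneg \<rho>(2) by (intro p_ge add_nonneg_nonneg) auto
    moreover have "p 0 \<le> 0" using p_le[of "[]" 0] sublinear_zero[OF \<rho>(1)] by simp
    ultimately show "p 0 = 0" by simp
  qed
  obtain f where f: "linear f" "\<And>x. f x \<le> p x" "f b = p b"
    by (rule hahn_banach_sublinear[OF sub, where ?x0.0 = b], rule that)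
  have 1: "f z \<le> \<rho> z" for z using f(2)[of z] p_le[of "[]" z] by simp
  have 2: "f b \<ge> \<beta>" using p_ge[OF \<beta>] f(3) by simp
  have 3: "f (v - u) \<le> norm (v - u) / Suc n" if "v \<in> \<Omega>" "norm (v - u) < q n" for n v
    using f(2)[of "v - u"] p_le[of "[(1, n, v)]" "v - u"] that sublinear_zero[OF \<rho>(1)] by simp
  show ?thesis by (rule that[OF f(1) 1 2 3])
qed

lemma comb_value_perturb:
  assumes \<rho>: "sublinear \<rho>" "\<And>z. \<rho> z \<le> K * norm z" and K: "K \<ge> 0"
    and adm: "admissible \<Omega> w q L" and T: "comb_mass L \<le> T"
    and s: "norm (u - u') \<le> s" "norm (b - b') \<le> s"
  shows "comb_cost u L + \<rho> (b - comb_vec u L)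
    \<le> comb_cost u' L + \<rho> (b' - comb_vec u' L) + s * (T + K + K * T)"
proof -
  have m: "0 \<le> comb_mass L" by (rule comb_mass_nonneg[OF adm])
  have s0: "0 \<le> s" using s(1) norm_ge_zero order_trans by blast
  have ms: "comb_mass L * norm (u - u') \<le> T * s" using m T s s0 by (intro mult_mono) auto
  have "b - comb_vec u L = (b' - comb_vec u' L) + ((b - b') - (comb_vec u L - comb_vec u' L))" by simp
  then have "\<rho> (b - comb_vec u L) \<le> \<rho> (b' - comb_vec u' L) + \<rho> ((b - b') - (comb_vec u L - comb_vec u' L))"
    using sublinear_add[OF \<rho>(1)] by metis
  also have "\<rho> ((b - b') - (comb_vec u L - comb_vec u' L)) \<le> K * norm ((b - b') - (comb_vec u L - comb_vec u' L))"
    by (rule \<rho>(2))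
  also have "norm ((b - b') - (comb_vec u L - comb_vec u' L)) \<le> s + T * s"
    using norm_triangle_ineq4[of "b - b'" "comb_vec u L - comb_vec u' L"] s(2) ms m
    by (simp add: comb_vec_diff norm_minus_commute)
  finally have "\<rho> (b - comb_vec u L) \<le> \<rho> (b' - comb_vec u' L) + K * (s + T * s)"
    using K by (simp add: mult_left_mono)
  moreover have "comb_cost u L \<le> comb_cost u' L + T * s" using comb_cost_diff[OF adm, of u u'] ms by simp
  ultimately show ?thesis by (simp add: algebra_simps)
qed

text \<open>Finite lists of rationals replace real sequences of radii, so that only countably many
  occur. Beyond the list the radius 0 excludes every triple, because \<open>norm (v - u) < 0\<close>
  is impossible.\<close>

definition list_radii :: "rat list \<Rightarrow> nat \<Rightarrow> real" where
  "list_radii rs n = (if n < length rs then of_rat (rs ! n) else 0)"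

text \<open>A list violating the criterion, with all data other than the points taken from a
  countable type: radii, a bound on the weight and a threshold. One list per choice of the data and
  of two points of a countable set keeps the hull countable.\<close>

definition comb_witness ::
  "('z::real_normed_vector \<Rightarrow> real) \<Rightarrow> 'z set \<Rightarrow> 'z \<Rightarrow> 'z \<Rightarrow> rat list \<times> nat \<times> rat \<Rightarrow> (real \<times> nat \<times> 'z) list \<Rightarrow> bool" where
  "comb_witness \<rho> \<Omega> u b = (\<lambda>(rs, T, \<gamma>) L. admissible \<Omega> u (list_radii rs) L \<and> comb_mass L \<le> real T \<and>
     comb_cost u L + \<rho> (b - comb_vec u L) < of_rat \<gamma>)"

lemma small_positive_exists:
  fixes A :: "real set"
  assumes "finite A" "\<And>a. a \<in> A \<Longrightarrow> a > 0"
  obtains s where "s > 0" "\<And>a. a \<in> A \<Longrightarrow> s \<le> a"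
  using assms by (metis Min_gr_iff Min_le empty_iff equals0I zero_less_one)

text \<open>All inequalities are strict, so there is room to replace \<open>u\<close> and
  \<open>b\<close> by points of \<open>S\<close> at distance at most \<open>s\<close>, and the radii
  and the threshold by rationals. The room is used twice: \<open>L\<close> remains a witness for the
  new data, and every witness for the new data violates the original criterion with
  \<open>\<beta>\<close> in place of \<open>\<beta>'\<close>.\<close>

lemma comb_witness_exists:
  fixes S :: "'z::real_normed_vector set"
  assumes \<rho>: "sublinear \<rho>" "\<And>z. \<rho> z \<le> K * norm z" and K: "K \<ge> 0"
    and u: "u \<in> closure S" and b: "b \<in> closure S" and \<delta>: "\<And>n. \<delta> n > 0"
    and adm: "admissible \<Omega> u \<delta> L" and less: "comb_cost u L + \<rho> (b - comb_vec u L) < \<beta>'" and \<beta>: "\<beta>' < \<beta>"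
  obtains u' b' p where "u' \<in> S" "b' \<in> S" "comb_witness \<rho> \<Omega> u' b' p L"
    "\<And>L'. comb_witness \<rho> \<Omega> u' b' p L' \<Longrightarrow>
      admissible \<Omega> u \<delta> L' \<and> comb_cost u L' + \<rho> (b - comb_vec u L') < \<beta>"
proof -
  obtain T where T: "comb_mass L \<le> real T" using real_arch_simple by blast
  obtain \<gamma> where \<gamma>: "\<beta>' < of_rat \<gamma>" "of_rat \<gamma> < \<beta>" using of_rat_dense[OF \<beta>] by blast
  define C where "C = real T + K + K * real T"
  have C: "C \<ge> 0" using K by (simp add: C_def)
  define M where "M = Suc (Max (insert 0 ((\<lambda>(t, n, v). n) ` set L)))"
  have M: "n < M" if "(t, n, v) \<in> set L" for t n v
  proof -
    have "n \<le> Max (insert 0 ((\<lambda>(t, n, v). n) ` set L))" using that by (intro Max_ge) force+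
    then show ?thesis by (simp add: M_def)
  qed
  define A where "A = {(of_rat \<gamma> - \<beta>') / (C + 1), (\<beta> - of_rat \<gamma>) / (C + 1)} \<union> (\<lambda>n. \<delta> n / 4) ` {..<M}
    \<union> (\<lambda>(t, n, v). (\<delta> n - norm (v - u)) / 4) ` set L"
  have "finite A" by (simp add: A_def)
  moreover have "a > 0" if "a \<in> A" for a
    using that \<gamma> C \<delta> adm by (auto simp: A_def admissible_def)
  ultimately obtain s where s: "s > 0" "\<And>a. a \<in> A \<Longrightarrow> s \<le> a" by (rule small_positive_exists) auto
  have sC: "s * C \<le> of_rat \<gamma> - \<beta>'" "s * C \<le> \<beta> - of_rat \<gamma>"
  proof -
    have "s * C \<le> s * (C + 1)" using s(1) by simp
    moreover have "s * (C + 1) \<le> of_rat \<gamma> - \<beta>'" "s * (C + 1) \<le> \<beta> - of_rat \<gamma>"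
      using s(2)[of "(of_rat \<gamma> - \<beta>') / (C + 1)"] s(2)[of "(\<beta> - of_rat \<gamma>) / (C + 1)"] C
      by (auto simp: A_def field_simps)
    ultimately show "s * C \<le> of_rat \<gamma> - \<beta>'" "s * C \<le> \<beta> - of_rat \<gamma>" by linarith+
  qed
  obtain u' where u': "u' \<in> S" "norm (u - u') \<le> s"
    using u s(1) unfolding closure_approachable by (metis dist_norm less_imp_le norm_minus_commute)
  obtain b' where b': "b' \<in> S" "norm (b - b') \<le> s"
    using b s(1) unfolding closure_approachable by (metis dist_norm less_imp_le norm_minus_commute)
  \<comment> \<open>Large enough for \<open>L\<close> to stay admissible at \<open>u'\<close>, small
    enough that admissibility at \<open>u'\<close> implies admissibility at
    \<open>u\<close>.\<close>
  have "\<exists>r :: rat. \<delta> n - 2 * s < of_rat r \<and> of_rat r < \<delta> n - s" for n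
    using of_rat_dense[of "\<delta> n - 2 * s" "\<delta> n - s"] s(1) by auto
  then obtain r :: "nat \<Rightarrow> rat" where r: "\<And>n. \<delta> n - 2 * s < of_rat (r n)" "\<And>n. of_rat (r n) < \<delta> n - s"
    by metis
  define rs where "rs = map r [0..<M]"
  have rad: "list_radii rs n = (if n < M then of_rat (r n) else 0)" for n by (simp add: list_radii_def rs_def)
  have tri: "norm (v - x) \<le> norm (v - y) + norm (x - y)" for v x y :: 'z
    using norm_triangle_ineq4[of "v - y" "x - y"] by simp
  have adm': "admissible \<Omega> u' (list_radii rs) L"
    unfolding admissible_def
  proof (clarify, intro conjI)
    fix t n v assume tnv: "(t, n, v) \<in> set L"
    then show "t \<ge> 0" "v \<in> \<Omega>" using adm by (auto simp: admissible_def)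
    have "(\<delta> n - norm (v - u)) / 4 \<in> A" using tnv by (force simp: A_def)
    then have "s \<le> (\<delta> n - norm (v - u)) / 4" by (rule s(2))
    moreover have "norm (v - u') \<le> norm (v - u) + s"
      using tri[of v u' u] u'(2) by (simp add: norm_minus_commute)
    ultimately have "norm (v - u') < of_rat (r n)" using r(1)[of n] s(1) by simp
    then show "norm (v - u') < list_radii rs n" using M[OF tnv] by (simp add: rad)
  qed
  have wit: "comb_witness \<rho> \<Omega> u' b' (rs, T, \<gamma>) L"
  proof -
    have "comb_cost u' L + \<rho> (b' - comb_vec u' L) \<le> comb_cost u L + \<rho> (b - comb_vec u L) + s * C"
      unfolding C_def using u'(2) b'(2)
      by (intro comb_value_perturb[OF \<rho> K adm T]) (simp_all add: norm_minus_commute)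
    then show ?thesis using less sC(1) T adm' by (simp add: comb_witness_def)
  qed
  have conv: "admissible \<Omega> u \<delta> L' \<and> comb_cost u L' + \<rho> (b - comb_vec u L') < \<beta>"
    if "comb_witness \<rho> \<Omega> u' b' (rs, T, \<gamma>) L'" for L'
  proof -
    have L': "admissible \<Omega> u' (list_radii rs) L'" "comb_mass L' \<le> real T"
        "comb_cost u' L' + \<rho> (b' - comb_vec u' L') < of_rat \<gamma>"
      using that by (auto simp: comb_witness_def)
    have "admissible \<Omega> u \<delta> L'"
      unfolding admissible_def
    proof (clarify, intro conjI)
      fix t n v assume tnv: "(t, n, v) \<in> set L'"
      then show "t \<ge> 0" "v \<in> \<Omega>" using L'(1) by (auto simp: admissible_def)
      have v: "norm (v - u') < list_radii rs n" using tnv L'(1) by (auto simp: admissible_def)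
      then have "n < M" by (smt (verit) rad norm_ge_zero)
      then have "norm (v - u') < \<delta> n - s" using v r(2)[of n] by (simp add: rad)
      then show "norm (v - u) < \<delta> n" using tri[of v u u'] u'(2) by simp
    qed
    moreover have "comb_cost u L' + \<rho> (b - comb_vec u L') \<le> comb_cost u' L' + \<rho> (b' - comb_vec u' L') + s * C"
      unfolding C_def using u'(2) b'(2) by (intro comb_value_perturb[OF \<rho> K L'(1,2)])
    ultimately show ?thesis using L'(3) sC(2) by simp
  qed
  show ?thesis by (rule that[OF u'(1) b'(1) wit conv])
qed

text \<open>The functional \<open>f\<close> need not extend \<open>l\<close>. What carries over is
  the bound \<open>\<rho>\<close>, the radii \<open>\<delta>\<close> and the value at one test
  vector \<open>b\<close>, up to an arbitrarily small loss: enough to keep normals small in sum and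
  away from zero.\<close>

definition normals_lift :: "('z::real_normed_vector \<Rightarrow> real) \<Rightarrow> 'z set \<Rightarrow> 'z set \<Rightarrow> bool" where
  "normals_lift \<rho> \<Omega> Y \<longleftrightarrow> (\<forall>u\<in>Y. \<forall>b\<in>Y. \<forall>\<beta> \<beta>' l \<delta>. \<beta>' < \<beta> \<longrightarrow> (\<forall>n. \<delta> n > 0) \<longrightarrow>
     linear l \<longrightarrow> (\<forall>z. l z \<le> \<rho> z) \<longrightarrow> l b \<ge> \<beta> \<longrightarrow>
     (\<forall>n. \<forall>v\<in>\<Omega> \<inter> Y. norm (v - u) < \<delta> n \<longrightarrow> l (v - u) \<le> norm (v - u) / Suc n) \<longrightarrow>
     (\<exists>f. linear f \<and> (\<forall>z. f z \<le> \<rho> z) \<and> f b \<ge> \<beta>' \<and>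
        (\<forall>n. \<forall>v\<in>\<Omega>. norm (v - u) < \<delta> n \<longrightarrow> f (v - u) \<le> norm (v - u) / Suc n)))"

lemma normals_liftD:
  assumes "normals_lift \<rho> \<Omega> Y" "u \<in> Y" "b \<in> Y" "\<beta>' < \<beta>" "\<And>n. \<delta> n > 0"
    "linear l" "\<And>z. l z \<le> \<rho> z" "l b \<ge> \<beta>"
    "\<And>n v. v \<in> \<Omega> \<Longrightarrow> v \<in> Y \<Longrightarrow> norm (v - u) < \<delta> n \<Longrightarrow> l (v - u) \<le> norm (v - u) / Suc n"
  shows "\<exists>f. linear f \<and> (\<forall>z. f z \<le> \<rho> z) \<and> f b \<ge> \<beta>' \<and>
    (\<forall>n. \<forall>v\<in>\<Omega>. norm (v - u) < \<delta> n \<longrightarrow> f (v - u) \<le> norm (v - u) / Suc n)"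
  by (rule assms(1)[unfolded normals_lift_def, rule_format]) (use assms in auto)

text \<open>Separable reduction: by the Hahn--Banach criterion above, non-existence of a normal
  functional on the whole space is witnessed by finite lists, and countably many witnesses suffice
  for all base points of the closure.\<close>

lemma normal_lifting:
  fixes \<rho> :: "'z::real_normed_vector \<Rightarrow> real" and F :: "'z list \<Rightarrow> 'z set"
  assumes \<rho>: "sublinear \<rho>" "\<And>z. \<rho> z \<ge> 0" "\<And>z. \<rho> z \<le> K * norm z"
    and F: "\<And>xs. countable (F xs)" and S0: "countable S0"
  obtains S where "countable S" "S0 \<subseteq> S" "\<And>xs. set xs \<subseteq> S \<Longrightarrow> F xs \<subseteq> S"
    "subspace (closure S)" "separable_space (top_of_set (closure S))"
    "normals_lift \<rho> \<Omega> (closure S)"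
proof -
  define pick where "pick u b p = (SOME L. comb_witness \<rho> \<Omega> u b p L)" for u b p
  define G where "G xs = F xs \<union> (\<Union>u\<in>set xs. \<Union>b\<in>set xs. \<Union>p. (\<lambda>(t, n, v). v) ` set (pick u b p))" for xs
  have cG: "countable (G xs)" for xs
    unfolding G_def by (intro countable_Un F countable_UN countable_image countableI_type
      countable_finite finite_set)
  obtain S where
    S: "countable S" "S0 \<subseteq> S" "\<And>xs. set xs \<subseteq> S \<Longrightarrow> G xs \<subseteq> S"
    "subspace (closure S)" "separable_space (top_of_set (closure S))"
    by (rule separable_subspace_closure_exists[where F = G, OF cG S0]) (rule that; assumption)
  have SF: "F xs \<subseteq> S" if "set xs \<subseteq> S" for xs using S(3)[OF that] by (simp add: G_def)
  have pickS: "v \<in> S" if "u \<in> S" "b \<in> S" "(t, n, v) \<in> set (pick u b p)" for u b p t n v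
  proof -
    have "v \<in> (\<lambda>(t, n, v). v) ` set (pick u b p)"
      using that(3) by (rule rev_image_eqI) simp
    then have "v \<in> G [u, b]"
      unfolding G_def
      by (intro UnI2 UN_I[of u _ v] UN_I[of b _ v] UN_I[of p _ v]) simp_all
    then show ?thesis using S(3)[of "[u, b]"] that by auto
  qed
  have K: "0 \<le> \<bar>K\<bar>" "\<rho> z \<le> \<bar>K\<bar> * norm z" for z
    using \<rho>(3)[of z] mult_right_mono[OF abs_ge_self[of K] norm_ge_zero[of z]] by auto
  have main: "\<exists>f. linear f \<and> (\<forall>z. f z \<le> \<rho> z) \<and> f b \<ge> \<beta>' \<and>
        (\<forall>n. \<forall>v\<in>\<Omega>. norm (v - u) < \<delta> n \<longrightarrow> f (v - u) \<le> norm (v - u) / Suc n)"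
    if u: "u \<in> closure S" and b: "b \<in> closure S" and \<beta>: "\<beta>' < \<beta>" and \<delta>: "\<And>n. \<delta> n > 0"
      and l: "linear l" "\<And>z. l z \<le> \<rho> z" "l b \<ge> \<beta>"
        "\<And>n v. v \<in> \<Omega> \<Longrightarrow> v \<in> closure S \<Longrightarrow> norm (v - u) < \<delta> n \<Longrightarrow> l (v - u) \<le> norm (v - u) / Suc n"
    for u b \<beta> \<beta>' l \<delta>
  proof -
    have crit: "\<beta>' \<le> comb_cost u L + \<rho> (b - comb_vec u L)" if adm: "admissible \<Omega> u \<delta> L" for L
    proof (rule ccontr)
      assume "\<not> ?thesis"
      then have less: "comb_cost u L + \<rho> (b - comb_vec u L) < \<beta>'" by simp
      obtain u' b' p where w: "u' \<in> S" "b' \<in> S" "comb_witness \<rho> \<Omega> u' b' p L"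
        and conv: "\<And>L'. comb_witness \<rho> \<Omega> u' b' p L' \<Longrightarrow>
          admissible \<Omega> u \<delta> L' \<and> comb_cost u L' + \<rho> (b - comb_vec u L') < \<beta>"
        by (rule comb_witness_exists[OF \<rho>(1) K(2,1) u b \<delta> adm less \<beta>], rule that)
      \<comment> \<open>The points of \<open>L\<close> may lie outside the subspace, but the list
        picked for the same data has its points in \<open>S\<close>. There \<open>l\<close> obeys
        the constraints, so \<open>l b\<close> would be smaller than \<open>\<beta>\<close>.\<close>
      define L' where "L' = pick u' b' p"
      have "comb_witness \<rho> \<Omega> u' b' p L'" unfolding L'_def pick_def using w(3) by (rule someI)
      then have L': "admissible \<Omega> u \<delta> L'" "comb_cost u L' + \<rho> (b - comb_vec u L') < \<beta>"
        using conv by auto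
      have "l (comb_vec u L') \<le> comb_cost u L'"
      proof (rule linear_comb_vec_le[OF l(1)])
        fix t n v assume tnv: "(t, n, v) \<in> set L'"
        then have "v \<in> S" unfolding L'_def by (rule pickS[OF w(1,2)])
        then have "v \<in> closure S" using closure_subset by blast
        then show "t \<ge> 0 \<and> l (v - u) \<le> norm (v - u) / Suc n"
          using tnv L'(1) l(4)[of v n] unfolding admissible_def by fast
      qed
      moreover have "l b = l (comb_vec u L') + l (b - comb_vec u L')"
        using linear_diff[OF l(1), of b "comb_vec u L'"] by simp
      ultimately show False using L'(2) l(2)[of "b - comb_vec u L'"] l(3) by simp
    qed
    obtain f where "linear f" "\<And>z. f z \<le> \<rho> z" "f b \<ge> \<beta>'"
      "\<And>n v. v \<in> \<Omega> \<Longrightarrow> norm (v - u) < \<delta> n \<Longrightarrow> f (v - u) \<le> norm (v - u) / Suc n"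
      by (rule normal_functional_exists[OF \<rho>(1,2) crit], assumption, rule that)
    then show ?thesis by blast
  qed
  have lift: "normals_lift \<rho> \<Omega> (closure S)"
    unfolding normals_lift_def by (intro ballI allI impI, rule main) auto
  show ?thesis by (rule that[OF S(1,2) SF S(4,5) lift])
qed

section \<open>Tuples\<close>

lemma smooth_norm_exists:
  fixes Y :: "'a::banach set"
  assumes A: "asplund TYPE('a)" and Y: "subspace Y" "separable_space (top_of_set Y)"
  obtains N :: "real \<Rightarrow> 'a \<Rightarrow> real" where
    "\<And>c. N c 0 = 0" "\<And>c x. c > 0 \<Longrightarrow> N c x \<ge> 0" "\<And>c x h. c > 0 \<Longrightarrow> N c (x + h) - N c x \<le> norm h"
    "\<And>c x. c > 0 \<Longrightarrow> norm x - c \<le> N c x" "\<And>c. c > 0 \<Longrightarrow> convex_on UNIV (N c)"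
    "\<And>c x. c > 0 \<Longrightarrow> smooth_along Y (N c) x"
proof -
  obtain fs :: "nat \<Rightarrow> 'a \<Rightarrow>\<^sub>L real" where fs: "\<And>n. norm (fs n) \<le> 1"
    "\<And>f e. norm f \<le> 1 \<Longrightarrow> e > 0 \<Longrightarrow> \<exists>n. \<forall>y\<in>Y. \<bar>blinfun_apply f y - fs n y\<bar> \<le> e * norm y"
    by (rule asplund_dense_functionals[OF A Y], rule that)
  interpret dense_functionals Y fs
    using A Y(1) fs by unfold_locales
  show ?thesis
    using smooth_norm_0 smooth_norm_nonneg smooth_norm_lipschitz smooth_norm_ge convex_on_smooth_norm
      smooth_norm_smooth
    by (intro that[of smooth_norm]) auto
qed

lemma convex_on_sum_fun:
  assumes "\<And>i. i \<in> I \<Longrightarrow> convex_on UNIV (p i)"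
  shows "convex_on UNIV (\<lambda>z. \<Sum>i\<in>I. p i z)"
  using assms
  by (induction I rule: infinite_finite_induct) (auto simp: convex_on_const intro!: convex_on_add)

definition frechet_normal :: "'a::real_normed_vector set \<Rightarrow> 'a \<Rightarrow> ('a \<Rightarrow>\<^sub>L real) \<Rightarrow> bool" where
  "frechet_normal \<Omega> u f \<longleftrightarrow> u \<in> \<Omega> \<and>
     (\<forall>e>0. \<exists>d>0. \<forall>v\<in>\<Omega>. norm (v - u) < d \<longrightarrow> blinfun_apply f (v - u) \<le> e * norm (v - u))"

text \<open>Since \<open>m\<close> is a variable, the power \<open>X\<^sup>m\<close> is not a type; its elements are represented by
  bounded functions on \<open>nat\<close> that vanish outside \<open>{1..m}\<close>.\<close>

definition coord :: "nat \<Rightarrow> (nat \<Rightarrow>\<^sub>C 'a::real_normed_vector) \<Rightarrow> 'a" where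
  "coord i z = apply_bcontfun z i"

definition emb :: "nat \<Rightarrow> 'a::real_normed_vector \<Rightarrow> (nat \<Rightarrow>\<^sub>C 'a)" where
  "emb i x = Bcontfun (\<lambda>j. if j = i then x else 0)"

lemma coord_emb: "coord j (emb i x) = (if j = i then x else 0)"
proof -
  have "(\<lambda>j. if j = i then x else 0) \<in> bcontfun"
    by (rule bcontfun_normI[of _ "norm x"]) auto
  then show ?thesis by (simp add: coord_def emb_def Bcontfun_inverse)
qed

lemma coord_linear_simps [simp]:
  "coord i (z + w) = coord i z + coord i w" "coord i (z - w) = coord i z - coord i w"
  "coord i (- z) = - coord i z" "coord i 0 = 0" "coord i (c *\<^sub>R z) = c *\<^sub>R coord i z"
  by (simp_all add: coord_def)

lemma tuple_eqI: "(\<And>i. coord i z = coord i w) \<Longrightarrow> z = w"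
  by (rule bcontfun_eqI) (simp add: coord_def)

lemma linear_coord: "linear (coord i)"
  by (rule linearI) auto

lemma linear_emb: "linear (emb i)"
  by (rule linearI; rule tuple_eqI) (auto simp: coord_emb)

lemma norm_coord_le: "norm (coord i z) \<le> norm z"
  unfolding coord_def by (rule norm_bounded)

lemma norm_tuple_le: "(\<And>i. norm (coord i z) \<le> b) \<Longrightarrow> norm z \<le> b"
  by (rule norm_bound) (simp add: coord_def)

lemma norm_emb: "norm (emb i x) = norm x"
  by (rule antisym[OF norm_tuple_le])
    (use norm_coord_le[of i "emb i x"] in \<open>auto simp: coord_emb\<close>)

lemma continuous_on_coord: "continuous_on A (coord i)"
  using norm_coord_le
  by (intro linear_continuous_on bounded_linear_intro[where K = 1]) auto

lemma continuous_on_emb: "continuous_on A (emb i)"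
  by (intro linear_continuous_on bounded_linear_intro[where K = 1])
    (auto simp: norm_emb linear_add[OF linear_emb] linear_scale[OF linear_emb])

lemma coord_sum: "coord j (\<Sum>i\<in>I. z i) = (\<Sum>i\<in>I. coord j (z i))"
  by (induction I rule: infinite_finite_induct) auto

lemma coord_sum_emb:
  "finite I \<Longrightarrow> coord j (\<Sum>i\<in>I. emb i (x i)) = (if j \<in> I then x j else 0)"
  by (simp add: coord_sum coord_emb)

section \<open>The approximate extremal principle\<close>

definition tuples_in :: "nat \<Rightarrow> (nat \<Rightarrow> 'a::real_normed_vector set) \<Rightarrow> (nat \<Rightarrow>\<^sub>C 'a) set" where
  "tuples_in m \<Omega> = {z. (\<forall>i\<in>{1..m}. coord i z \<in> \<Omega> i) \<and> (\<forall>i. i \<notin> {1..m} \<longrightarrow> coord i z = 0)}"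

text \<open>The first sum vanishes on diagonal tuples. A linear functional below this seminorm is
  therefore at most \<open>\<kappa> * real m * norm h\<close> on the tuple with all coordinates
  \<open>h\<close>, which bounds the sum of its components.\<close>

definition tuple_seminorm :: "nat \<Rightarrow> real \<Rightarrow> (nat \<Rightarrow>\<^sub>C 'a::real_normed_vector) \<Rightarrow> real" where
  "tuple_seminorm m \<kappa> h = (\<Sum>i\<in>{1..<m}. norm (coord i h - coord m h)) + \<kappa> * (\<Sum>i\<in>{1..m}. norm (coord i h))"

section \<open>Estimates for the seminorm on tuples\<close>

lemma sum_coord_diff_le: "(\<Sum>i\<in>{1..<m}. norm (coord i h - coord m h)) \<le> 2 * real m * norm h"
proof -
  have "(\<Sum>i\<in>{1..<m}. norm (coord i h - coord m h)) \<le> of_nat (card {1..<m}) * (2 * norm h)"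
  proof (rule sum_bounded_above)
    fix i
    show "norm (coord i h - coord m h) \<le> 2 * norm h"
      using norm_triangle_ineq4[of "coord i h" "coord m h"] norm_coord_le[of i h] norm_coord_le[of m h] by simp
  qed
  also have "\<dots> \<le> real m * (2 * norm h)" by (intro mult_right_mono) auto
  finally show ?thesis by simp
qed

lemma sum_coord_le: "(\<Sum>i\<in>{1..m}. norm (coord i h)) \<le> real m * norm h"
  using sum_bounded_above[of "{1..m}" "\<lambda>i. norm (coord i h)" "norm h"] norm_coord_le[of _ h] by simp

lemma tuple_seminorm_nonneg: "\<kappa> \<ge> 0 \<Longrightarrow> tuple_seminorm m \<kappa> h \<ge> 0"
  unfolding tuple_seminorm_def by (intro add_nonneg_nonneg sum_nonneg mult_nonneg_nonneg) auto

lemma tuple_seminorm_le: "\<kappa> \<ge> 0 \<Longrightarrow> tuple_seminorm m \<kappa> h \<le> (2 * real m + \<kappa> * real m) * norm h"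
  unfolding tuple_seminorm_def using sum_coord_diff_le[where m = m and h = h] mult_left_mono[OF sum_coord_le[where m = m and h = h], of \<kappa>]
  by (simp add: algebra_simps)

lemma tuple_seminorm_minus: "tuple_seminorm m \<kappa> (- h) = tuple_seminorm m \<kappa> h"
  by (simp add: tuple_seminorm_def norm_minus_commute)

lemma sublinear_tuple_seminorm:
  assumes "\<kappa> \<ge> 0"
  shows "sublinear (tuple_seminorm m \<kappa>)"
proof (rule sublinearI)
  fix x y :: "nat \<Rightarrow>\<^sub>C 'a"
  have "norm (coord i (x + y) - coord m (x + y)) \<le> norm (coord i x - coord m x) + norm (coord i y - coord m y)" for i
    using norm_triangle_ineq[of "coord i x - coord m x" "coord i y - coord m y"] by (simp add: algebra_simps)
  then have "(\<Sum>i\<in>{1..<m}. norm (coord i (x + y) - coord m (x + y)))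
      \<le> (\<Sum>i\<in>{1..<m}. norm (coord i x - coord m x)) + (\<Sum>i\<in>{1..<m}. norm (coord i y - coord m y))"
    unfolding sum.distrib[symmetric] by (intro sum_mono)
  moreover have "(\<Sum>i\<in>{1..m}. norm (coord i (x + y)))
      \<le> (\<Sum>i\<in>{1..m}. norm (coord i x)) + (\<Sum>i\<in>{1..m}. norm (coord i y))"
    unfolding sum.distrib[symmetric] by (intro sum_mono) (simp add: norm_triangle_ineq)
  then have "\<kappa> * (\<Sum>i\<in>{1..m}. norm (coord i (x + y)))
      \<le> \<kappa> * ((\<Sum>i\<in>{1..m}. norm (coord i x)) + (\<Sum>i\<in>{1..m}. norm (coord i y)))"
    using assms by (rule mult_left_mono)
  ultimately show "tuple_seminorm m \<kappa> (x + y) \<le> tuple_seminorm m \<kappa> x + tuple_seminorm m \<kappa> y"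
    by (simp add: tuple_seminorm_def distrib_left)
next
  fix t :: real and x :: "nat \<Rightarrow>\<^sub>C 'a" assume t: "t > 0"
  have "norm (coord i (t *\<^sub>R x) - coord m (t *\<^sub>R x)) = t * norm (coord i x - coord m x)" for i
    using t by (simp flip: scaleR_diff_right)
  then show "tuple_seminorm m \<kappa> (t *\<^sub>R x) \<le> t * tuple_seminorm m \<kappa> x"
    using t by (simp add: tuple_seminorm_def sum_distrib_left distrib_left algebra_simps)
qed (simp add: tuple_seminorm_def)

text \<open>Such tuples are sums of finitely many embedded coordinates, so limits of the coordinates
  give a limit in norm.\<close>

lemma complete_tuples:
  fixes D :: "(nat \<Rightarrow>\<^sub>C 'a::banach) set"
  assumes D: "closed D" "D \<subseteq> tuples_in m \<Omega>"
  shows "complete D"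
  unfolding complete_def
proof (intro allI impI, elim conjE)
  fix z :: "nat \<Rightarrow> (nat \<Rightarrow>\<^sub>C 'a)" assume z: "\<forall>n. z n \<in> D" "Cauchy z"
  have dec: "z n = (\<Sum>i\<in>{1..m}. emb i (coord i (z n)))" for n
    using z(1) D(2) by (intro tuple_eqI) (auto simp: coord_sum_emb tuples_in_def)
  have "convergent (\<lambda>n. coord i (z n))" for i
  proof -
    have "dist (coord i x) (coord i y) \<le> dist x y" for x y :: "nat \<Rightarrow>\<^sub>C 'a"
      using norm_coord_le[of i "x - y"] by (simp add: dist_norm)
    then have "Cauchy (\<lambda>n. coord i (z n))"
      using z(2) unfolding Cauchy_def by (meson le_less_trans)
    then show ?thesis by (simp add: Cauchy_convergent_iff)
  qed
  then obtain x where x: "\<And>i. (\<lambda>n. coord i (z n)) \<longlonglongrightarrow> x i" unfolding convergent_def by metis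
  have "(\<lambda>n. emb i (coord i (z n))) \<longlonglongrightarrow> emb i (x i)" for i
    using continuous_on_tendsto_compose[OF continuous_on_emb[of UNIV i] x[of i]] by simp
  then have "(\<lambda>n. \<Sum>i\<in>{1..m}. emb i (coord i (z n))) \<longlonglongrightarrow> (\<Sum>i\<in>{1..m}. emb i (x i))"
    by (intro tendsto_sum)
  then have lim: "z \<longlonglongrightarrow> (\<Sum>i\<in>{1..m}. emb i (x i))" by (subst (asm) dec[symmetric])
  with closed_sequentially[OF D(1)] z(1) show "\<exists>l\<in>D. z \<longlonglongrightarrow> l" by blast
qed

text \<open>Minimisation is restricted to tuples of \<open>YZ\<close>, whose coordinates lie in the
  separable \<open>Y\<close> where smooth approximate norms exist; the price is that
  \<open>l\<close> is normal only along \<open>YZ\<close>. Nontriviality is recorded as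
  \<open>l b \<ge> \<beta>\<close> with \<open>b\<close> in \<open>YZ\<close>, the form that lifting
  preserves.\<close>

lemma extremal_normal_along_subspace:
  fixes \<Omega> :: "nat \<Rightarrow> 'a::banach set" and a :: "nat \<Rightarrow> 'a" and YZ :: "(nat \<Rightarrow>\<^sub>C 'a) set"
  assumes A: "asplund TYPE('a)" and m: "m \<ge> 2"
    and YZ: "closed YZ" "subspace YZ" and Y: "subspace Y" "separable_space (top_of_set Y)"
    and YZ_Y: "\<And>z i. z \<in> YZ \<Longrightarrow> i \<in> {1..m} \<Longrightarrow> coord i z \<in> Y"
    and ops: "\<And>z i j. z \<in> YZ \<Longrightarrow> i \<in> {1..m} \<Longrightarrow> j \<in> {1..m} \<Longrightarrow> emb i (coord j z) \<in> YZ"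
    and X: "X \<in> YZ" "X \<in> tuples_in m \<Omega>" "\<And>i. i \<in> {1..m} \<Longrightarrow> coord i X = xbar"
    and At: "At \<in> YZ" "\<And>i. i \<in> {1..m} \<Longrightarrow> coord i At = a i"
    and s: "s > 0" and cl: "\<And>i. i \<in> {1..m} \<Longrightarrow> closed (\<Omega> i \<inter> cball xbar s)"
    and emp: "(\<Inter>i\<in>{1..m}. (\<lambda>w. w - a i) ` \<Omega> i) \<inter> cball xbar s = {}"
    and r: "\<And>i. i \<in> {1..m} \<Longrightarrow> norm (a i) \<le> r" and \<kappa>: "\<kappa> > 0" "\<kappa> \<le> 1/128" and rs: "64 * real m * r \<le> \<kappa> * s"
  obtains u b \<beta> l \<delta> where "u \<in> YZ" "u \<in> tuples_in m \<Omega>" "norm (u - X) \<le> s"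
    "b \<in> YZ" "\<beta> > 0" "(\<Sum>i\<in>{1..m}. norm (coord i b)) = 2 * \<beta>" "\<And>i. i \<notin> {1..m} \<Longrightarrow> coord i b = 0"
    "linear l" "\<And>h. l h \<le> tuple_seminorm m (32 * \<kappa>) h" "l b \<ge> \<beta>" "\<And>n :: nat. \<delta> n > 0"
    "\<And>n v. v \<in> tuples_in m \<Omega> \<Longrightarrow> v \<in> YZ \<Longrightarrow> norm (v - u) < \<delta> n \<Longrightarrow> l (v - u) \<le> norm (v - u) / Suc n"
proof -
  let ?I = "{1..m}" and ?J = "{1..<m}"
  have JI: "i \<in> ?I" if "i \<in> ?J" for i using that by auto
  have mI: "m \<in> ?I" using m by simp
  have m0: "real m > 0" using m by simp
  have r0: "r \<ge> 0" using r[OF mI] norm_ge_zero order_trans by blast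
  have rs': "r \<le> s / 4"
  proof -
    have "64 * r \<le> 64 * real m * r" using m r0 mult_right_mono[of 1 "real m" r] by simp
    also have "\<dots> \<le> \<kappa> * s" by (rule rs)
    also have "\<dots> \<le> 1 * s" using \<kappa> s by (intro mult_right_mono) auto
    finally show ?thesis using r0 by simp
  qed
  define w where "w i z = (coord i z - coord m z) + (a m - a i)" for i and z :: "nat \<Rightarrow>\<^sub>C 'a"
  define g where "g z = (\<Sum>i\<in>?J. norm (w i z))" for z
  have w_add: "w i (z + h) = w i z + (coord i h - coord m h)" for i z h
    by (simp add: w_def algebra_simps)
  have g_inc: "g (z + h) - g z \<le> 2 * real m * norm h" for z h
  proof -
    have "g (z + h) \<le> (\<Sum>i\<in>?J. norm (w i z) + norm (coord i h - coord m h))"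
      unfolding g_def w_add by (intro sum_mono norm_triangle_ineq)
    then show ?thesis using sum_coord_diff_le[where m = m and h = h] by (simp add: g_def sum.distrib)
  qed
  define D where "D = YZ \<inter> tuples_in m \<Omega> \<inter> {z. \<forall>i\<in>?I. coord i z \<in> cball xbar s}"
  have clD: "closed D"
  proof -
    have "D = YZ \<inter> (\<Inter>i\<in>?I. coord i -` (\<Omega> i \<inter> cball xbar s)) \<inter> (\<Inter>i\<in>- ?I. coord i -` {0})"
      by (auto simp: D_def tuples_in_def)
    also have "closed \<dots>"
    proof -
      have v: "closed (coord i -` S)" if "closed S" for i and S :: "'a set"
        using continuous_on_coord[of UNIV i] that
        by (intro continuous_closed_vimage) (auto simp: continuous_on_eq_continuous_at)
      have "closed (\<Inter>i\<in>?I. coord i -` (\<Omega> i \<inter> cball xbar s))" by (intro closed_INT ballI v cl)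
      moreover have "closed (\<Inter>i\<in>- ?I. coord i -` {0 :: 'a})" by (intro closed_INT ballI v) simp
      ultimately show ?thesis using YZ(1) by (intro closed_Int)
    qed
    finally show ?thesis .
  qed
  have cD: "complete D" by (rule complete_tuples[OF clD]) (auto simp: D_def)
  have XD: "X \<in> D" using X s by (simp add: D_def)
  \<comment> \<open>The value at \<open>X\<close> is at most \<open>2 * real m * r\<close>, and
    \<open>rs\<close> makes this the deficit allowed for slope \<open>\<kappa>\<close> and radius
    \<open>s/4\<close>.\<close>
  have gX: "g X \<le> g z + \<kappa> * (s/4) / 8" for z
  proof -
    have "g X \<le> of_nat (card ?J) * (2 * r)"
      unfolding g_def
    proof (rule sum_bounded_above)
      fix i assume i: "i \<in> ?J"
      have "w i X = a m - a i" using X(3)[OF JI[OF i]] X(3)[OF mI] by (simp add: w_def)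
      then show "norm (w i X) \<le> 2 * r"
        using norm_triangle_ineq4[of "a m" "a i"] r[OF mI] r[OF JI[OF i]] by simp
    qed
    also have "\<dots> \<le> real m * (2 * r)" using r0 by (intro mult_right_mono) auto
    also have "\<dots> \<le> \<kappa> * (s/4) / 8" using rs by simp
    finally have "g X \<le> \<kappa> * (s/4) / 8" .
    moreover have "0 \<le> g z" by (simp add: g_def sum_nonneg)
    ultimately show ?thesis by simp
  qed
  have s4: "s / 4 > 0" using s by simp
  have n1: "norm (z + h) - norm z \<le> 1 * norm h" for z h :: "nat \<Rightarrow>\<^sub>C 'a"
    using norm_triangle_ineq[of z h] by simp
  have n2: "norm (z - z') - c \<le> norm (z - z')" if "c > 0" for c and z z' :: "nat \<Rightarrow>\<^sub>C 'a"
    using that by simp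
  obtain u1 \<mu> c x where u1: "u1 \<in> D" "norm (u1 - X) \<le> s / 4" and \<mu>: "\<And>n. \<mu> n \<ge> 0" "\<mu> sums \<kappa>"
    and smb: "\<And>z. summable (\<lambda>n :: nat. \<mu> n * norm (z - x n))"
    and min1: "\<And>z. z \<in> D \<Longrightarrow> g u1 + (\<Sum>n. \<mu> n * norm (u1 - x n)) \<le> g z + (\<Sum>n. \<mu> n * norm (z - x n))"
    by (rule perturbed_minimum_exists[where f = g and N = "\<lambda>c. norm" and M = 1,
          OF cD XD g_inc gX norm_zero norm_ge_zero n1 zero_le_one n2 \<kappa>(1) s4])
      (assumption, rule that)
  have low1: "g u1 \<le> g z + \<kappa> * norm (z - u1)" if "z \<in> D" for z
  proof -
    have "norm (u1 + (z - u1) - x n) - norm (u1 - x n) \<le> norm (z - u1)" for n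
      using norm_triangle_ineq[of "u1 - x n" "z - u1"] by (simp add: algebra_simps)
    from suminf_increment_le[where q = "\<lambda>n z. norm (z - x n)", OF \<mu> this smb] min1[OF that]
    show ?thesis by simp
  qed
  have u1T: "u1 \<in> tuples_in m \<Omega>" using u1(1) by (simp add: D_def)
  \<comment> \<open>At a zero of \<open>g\<close> all points \<open>coord i u1 - a i\<close>
    coincide, and as \<open>u1\<close> is near \<open>X\<close> their common value would lie in the
    intersection that \<open>emp\<close> declares empty.\<close>
  have G: "g u1 > 0"
  proof (rule ccontr)
    assume "\<not> g u1 > 0"
    then have "g u1 = 0" using sum_nonneg[of ?J "\<lambda>i. norm (w i u1)"] by (simp add: g_def)
    then have w0: "w i u1 = 0" if "i \<in> ?J" for i
      using that sum_nonneg_eq_0_iff[of ?J "\<lambda>i. norm (w i u1)"] by (simp add: g_def)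
    define W where "W = coord m u1 - a m"
    have "W = coord i u1 - a i" if "i \<in> ?I" for i
    proof (cases "i = m")
      case False
      then have "i \<in> ?J" using that by auto
      from w0[OF this] show ?thesis by (simp add: w_def W_def algebra_simps)
    qed (simp add: W_def)
    then have "W \<in> (\<Inter>i\<in>?I. (\<lambda>w. w - a i) ` \<Omega> i)" using u1T by (auto simp: tuples_in_def)
    moreover have "dist xbar W \<le> s"
    proof -
      have "norm (W - xbar) \<le> norm (coord m (u1 - X)) + norm (a m)"
        using norm_triangle_ineq4[of "coord m (u1 - X)" "a m"] X(3)[OF mI] by (simp add: W_def algebra_simps)
      also have "\<dots> \<le> s / 4 + s / 4"
        using norm_coord_le[of m "u1 - X"] u1(2) r[OF mI] rs' by (intro add_mono) auto
      finally show ?thesis using s by (simp add: dist_norm norm_minus_commute)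
    qed
    ultimately have "W \<in> (\<Inter>i\<in>?I. (\<lambda>w. w - a i) ` \<Omega> i) \<inter> cball xbar s"
      unfolding Int_iff mem_cball by (rule conjI)
    then show False unfolding emp by simp
  qed
  obtain N :: "real \<Rightarrow> 'a \<Rightarrow> real" where N0: "\<And>c. N c 0 = 0" and Npos: "\<And>c x. c > 0 \<Longrightarrow> N c x \<ge> 0"
    and Nlip: "\<And>c x h. c > 0 \<Longrightarrow> N c (x + h) - N c x \<le> norm h"
    and Nge: "\<And>c x. c > 0 \<Longrightarrow> norm x - c \<le> N c x" and Ncvx: "\<And>c. c > 0 \<Longrightarrow> convex_on UNIV (N c)"
    and Nsm: "\<And>c x. c > 0 \<Longrightarrow> smooth_along Y (N c) x"
    by (rule smooth_norm_exists[OF A Y], rule that)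
  \<comment> \<open>The first bound keeps the next minimiser near \<open>X\<close>; the second keeps
    its value of \<open>g\<close> comparable with \<open>g u1\<close>, the Lipschitz constant of
    \<open>g\<close> being \<open>2 * real m\<close>.\<close>
  define R where "R = min (s/4) (g u1 / (8 * real m))"
  have R: "R > 0" "R \<le> s / 4" "R \<le> g u1 / (8 * real m)" using s G m0 by (auto simp: R_def)
  \<comment> \<open>Fewer than \<open>m\<close> norms are smoothed, so the total error is at most
    \<open>\<kappa> * R\<close>.\<close>
  define c0 where "c0 = \<kappa> * R / real m"
  have c0: "c0 > 0" "real m * c0 = \<kappa> * R" using \<kappa> R m0 by (auto simp: c0_def)
  define F where "F z = (\<Sum>i\<in>?J. N c0 (w i z))" for z
  have F_inc: "F (z + h) - F z \<le> (\<Sum>i\<in>?J. norm (coord i h - coord m h))" for z h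
  proof -
    have "F (z + h) - F z = (\<Sum>i\<in>?J. N c0 (w i z + (coord i h - coord m h)) - N c0 (w i z))"
      by (simp add: F_def w_add sum_subtractf)
    also have "\<dots> \<le> (\<Sum>i\<in>?J. norm (coord i h - coord m h))" by (intro sum_mono Nlip c0)
    finally show ?thesis .
  qed
  have F_inc': "F (z + h) - F z \<le> 2 * real m * norm h" for z h
    using F_inc[of z h] sum_coord_diff_le[where m = m and h = h] by simp
  have Nle: "N c0 x \<le> norm x" for x using Nlip[OF c0(1), of 0 x] N0[of c0] by simp
  have F_le: "F z \<le> g z" for z unfolding F_def g_def by (intro sum_mono Nle)
  have F_ge: "g z - \<kappa> * R \<le> F z" for z
  proof -
    have "(\<Sum>i\<in>?J. norm (w i z) - c0) \<le> F z" unfolding F_def by (intro sum_mono Nge c0)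
    moreover have "(\<Sum>i\<in>?J. norm (w i z) - c0) = g z - real (m - 1) * c0"
      by (simp add: g_def sum_subtractf)
    moreover have "real (m - 1) * c0 \<le> real m * c0" using c0(1) by (intro mult_right_mono) auto
    ultimately show ?thesis using c0(2) by simp
  qed
  define NZ where "NZ c z = (\<Sum>i\<in>?I. N c (coord i z))" for c z
  have NZ_inc: "NZ c (z + h) - NZ c z \<le> (\<Sum>i\<in>?I. norm (coord i h))" if "c > 0" for c z h
    unfolding NZ_def sum_subtractf[symmetric] coord_linear_simps by (intro sum_mono Nlip that)
  \<comment> \<open>On this ball the linear term in \<open>low1\<close> is at most
    \<open>\<kappa> * R\<close>. The next minimiser stays within \<open>R / 2\<close> of
    \<open>u1\<close>, so tuples of \<open>D\<close> near it still compete.\<close>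
  define D2 where "D2 = D \<inter> cball u1 R"
  have cD2: "complete D2"
    by (rule complete_tuples) (use clD in \<open>auto simp: D2_def D_def\<close>)
  have u1D2: "u1 \<in> D2" using u1(1) R(1) by (simp add: D2_def)
  \<comment> \<open>One error \<open>\<kappa> * R\<close> comes from \<open>low1\<close> and one
    from smoothing. Their sum is the deficit allowed for slope \<open>32 * \<kappa>\<close> and
    radius \<open>R / 2\<close>, which is the origin of the factor 32.\<close>
  have low2: "F u1 \<le> F z + 32 * \<kappa> * (R/2) / 8" if "z \<in> D2" for z
  proof -
    have "\<kappa> * norm (z - u1) \<le> \<kappa> * R"
      using that \<kappa> by (intro mult_left_mono) (auto simp: D2_def dist_norm norm_minus_commute)
    moreover have "32 * \<kappa> * (R/2) / 8 = \<kappa> * R + \<kappa> * R" by simp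
    moreover have "z \<in> D" using that by (simp add: D2_def)
    ultimately show ?thesis using low1[of z] F_le[of u1] F_ge[of z] by linarith
  qed
  have NZ_ge: "norm (z - z') - c \<le> NZ c (z - z')" if "c > 0" "z \<in> D2" "z' \<in> D2" for c z z'
  proof -
    have "norm (coord i (z - z')) \<le> NZ c (z - z') + c" for i
    proof (cases "i \<in> ?I")
      case True
      have "norm (coord i (z - z')) - c \<le> N c (coord i (z - z'))" by (rule Nge[OF that(1)])
      also have "\<dots> \<le> NZ c (z - z')"
        unfolding NZ_def using True Npos[OF that(1)] by (intro member_le_sum) auto
      finally show ?thesis by simp
    next
      case False
      then have "coord i (z - z') = 0" using that(2,3) by (simp add: D2_def D_def tuples_in_def)
      moreover have "0 \<le> NZ c (z - z')" unfolding NZ_def by (intro sum_nonneg Npos that(1))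
      ultimately show ?thesis using that(1) by simp
    qed
    then have "norm (z - z') \<le> NZ c (z - z') + c" by (rule norm_tuple_le)
    then show ?thesis by simp
  qed
  have R2: "R / 2 > 0" and \<kappa>32: "32 * \<kappa> > 0" using R \<kappa> by auto
  have NZ_lip: "NZ c (z + h) - NZ c z \<le> real m * norm h" if "c > 0" for c z h
    using NZ_inc[OF that, of z h] sum_coord_le[where m = m and h = h] by simp
  have NZ0: "NZ c 0 = 0" and NZpos: "0 \<le> NZ c z" if "c > 0" for c z
    using N0 Npos[OF that] by (auto simp: NZ_def intro: sum_nonneg)
  obtain u \<nu> d y where u: "u \<in> D2" "norm (u - u1) \<le> R / 2" and \<nu>: "\<And>n. \<nu> n \<ge> 0" "\<nu> sums (32 * \<kappa>)"
    and d: "\<And>n. d n > 0" and smb2: "\<And>z. summable (\<lambda>n :: nat. \<nu> n * NZ (d n) (z - y n))"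
    and min2: "\<And>z. z \<in> D2 \<Longrightarrow> F u + (\<Sum>n. \<nu> n * NZ (d n) (u - y n)) \<le> F z + (\<Sum>n. \<nu> n * NZ (d n) (z - y n))"
    by (rule perturbed_minimum_exists[where f = F and N = NZ and M = "real m",
          OF cD2 u1D2 F_inc' low2 NZ0 NZpos NZ_lip of_nat_0_le_iff NZ_ge \<kappa>32 R2])
      (assumption+, rule that)
  define P where "P z = (\<Sum>n. \<nu> n * NZ (d n) (z - y n))" for z
  have P_inc: "P (z + h) - P z \<le> 32 * \<kappa> * (\<Sum>i\<in>?I. norm (coord i h))" for z h
  proof -
    have "NZ (d n) (z + h - y n) - NZ (d n) (z - y n) \<le> (\<Sum>i\<in>?I. norm (coord i h))" for n
      using NZ_inc[OF d, of n "z - y n" h] by (simp add: algebra_simps)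
    from suminf_increment_le[where q = "\<lambda>n z. NZ (d n) (z - y n)", OF \<nu> this smb2]
    show ?thesis by (simp add: P_def)
  qed
  define \<Psi> where "\<Psi> z = F z + P z" for z
  have \<Psi>_inc: "\<Psi> (z + h) - \<Psi> z \<le> tuple_seminorm m (32 * \<kappa>) h" for z h
    using F_inc[of z h] P_inc[of z h] by (simp add: \<Psi>_def tuple_seminorm_def)
  have linJ: "linear (\<lambda>z. coord i z - coord m z)" for i :: nat
    by (intro linear_compose_sub linear_coord)
  have NZ_affine: "NZ c (z - y') = (\<Sum>i\<in>?I. N c (coord i z + - coord i y'))" for c z y'
    by (simp add: NZ_def)
  have cvx: "convex_on UNIV \<Psi>"
    unfolding \<Psi>_def F_def P_def w_def NZ_affine
    by (intro convex_on_add convex_on_sum_fun convex_on_suminf convex_on_affine Ncvx linJ linear_coord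
        c0 d \<nu> smb2[unfolded NZ_affine])
  have smooth: "smooth_along YZ \<Psi> u"
    unfolding \<Psi>_def
  proof (rule smooth_along_add)
    show "smooth_along YZ F u"
      unfolding F_def w_def
    proof (rule smooth_along_sum, rule smooth_along_affine[where B = 2 and Y = Y])
      fix i assume i: "i \<in> ?J"
      show "norm (coord i h - coord m h) \<le> 2 * norm h" for h :: "nat \<Rightarrow>\<^sub>C 'a"
        using norm_triangle_ineq4[of "coord i h" "coord m h"] norm_coord_le[of i h] norm_coord_le[of m h] by simp
      show "coord i h - coord m h \<in> Y" if "h \<in> YZ" for h
        using YZ_Y[OF that] JI[OF i] mI Y(1) by (intro subspace_diff) auto
    qed (intro Nsm c0 linJ)+
    show "smooth_along YZ P u"
      unfolding P_def
    proof (rule smooth_along_suminf[where M = "real m", OF \<nu>(1)])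
      show "summable \<nu>" using \<nu>(2) by (simp add: sums_iff)
      fix n
      show "smooth_along YZ (\<lambda>z. NZ (d n) (z - y n)) u"
        unfolding NZ_affine
      proof (rule smooth_along_sum, rule smooth_along_affine[where B = 1 and Y = Y])
        fix i assume i: "i \<in> ?I"
        show "norm (coord i h) \<le> 1 * norm h" for h :: "nat \<Rightarrow>\<^sub>C 'a" using norm_coord_le by simp
        show "coord i h \<in> Y" if "h \<in> YZ" for h by (rule YZ_Y[OF that i])
      qed (intro Nsm d linear_coord)+
      show "NZ (d n) (z + h - y n) - NZ (d n) (z - y n) \<le> real m * norm h" for z h
        using NZ_lip[OF d, of n "z - y n" h] by (simp add: algebra_simps)
    qed (use smb2 in auto)
  qed
  have uD: "u \<in> YZ" "u \<in> tuples_in m \<Omega>" using u(1) by (auto simp: D2_def D_def)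
  have uX: "norm (u - X) \<le> s / 2"
  proof -
    have "norm (u - X) \<le> norm (u - u1) + norm (u1 - X)" using norm_triangle_ineq[of "u - u1" "u1 - X"] by simp
    then show ?thesis using u(2) u1(2) R(2) s by simp
  qed
  have gu: "g u \<ge> g u1 * (7/8)"
  proof -
    have "g u1 - g u \<le> 2 * real m * norm (u1 - u)" using g_inc[of u "u1 - u"] by simp
    also have "\<dots> \<le> 2 * real m * (R / 2)" using u(2) by (intro mult_left_mono) (auto simp: norm_minus_commute)
    also have "\<dots> \<le> g u1 / 8" using R(3) m0 by (simp add: field_simps)
    finally show ?thesis by simp
  qed
  define \<beta> where "\<beta> = g u / 2"
  have \<beta>: "\<beta> > 0" using gu G by (simp add: \<beta>_def)
  have \<kappa>R: "\<kappa> * R \<le> g u / 4"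
  proof -
    have "R \<le> g u1 / 8"
    proof -
      have "g u1 / (8 * real m) \<le> g u1 / 8" using G m by (intro divide_left_mono) auto
      then show ?thesis using R(3) by simp
    qed
    moreover have "\<kappa> * R \<le> 1 * R" using \<kappa> R(1) by (intro mult_right_mono) auto
    ultimately show ?thesis using gu G by simp
  qed
  \<comment> \<open>Adding \<open>b\<close> to \<open>u\<close> makes every \<open>w i\<close>
    vanish and hence brings \<open>F\<close> down to 0.\<close>
  define b where "b = - (\<Sum>i\<in>?J. emb i (w i u))"
  have coord_b: "coord i b = (if i \<in> ?J then - w i u else 0)" for i
    by (simp add: b_def coord_sum_emb)
  have bY: "b \<in> YZ"
    unfolding b_def
  proof (intro subspace_neg[OF YZ(2)] subspace_sum[OF YZ(2)])
    fix i assume i: "i \<in> ?J"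
    \<comment> \<open>Embedded coordinates of \<open>u\<close> and of \<open>At\<close> remain in
      \<open>YZ\<close> by \<open>ops\<close>; the tuple \<open>At\<close> is in \<open>YZ\<close>
      so that the shifts are available here.\<close>
    have "emb i (w i u) = (emb i (coord i u) - emb i (coord m u)) + (emb i (coord m At) - emb i (coord i At))"
      using At(2)[OF mI] At(2)[OF JI[OF i]]
      by (simp add: w_def linear_add[OF linear_emb] linear_diff[OF linear_emb])
    also have "\<dots> \<in> YZ"
      using ops[OF uD(1) JI[OF i]] ops[OF At(1) JI[OF i]] JI[OF i] mI YZ(2)
      by (intro subspace_add subspace_diff) auto
    finally show "emb i (w i u) \<in> YZ" .
  qed
  have sum_b: "(\<Sum>i\<in>?I. norm (coord i b)) = 2 * \<beta>"
  proof -
    have "(\<Sum>i\<in>?I. norm (coord i b)) = (\<Sum>i\<in>?J. norm (coord i b))"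
      by (rule sum.mono_neutral_right) (auto simp: coord_b)
    then show ?thesis by (simp add: coord_b \<beta>_def g_def)
  qed
  have "F (u + b) = 0"
    unfolding F_def by (rule sum.neutral) (auto simp: w_add coord_b N0)
  moreover have "P (u + b) - P u \<le> 32 * \<kappa> * (2 * \<beta>)" using P_inc[of u b] unfolding sum_b .
  moreover have "32 * \<kappa> * (2 * \<beta>) \<le> 1/4 * (2 * \<beta>)" using \<kappa> \<beta> by (intro mult_right_mono) auto
  \<comment> \<open>\<open>F\<close> falls by at least \<open>3/4\<close> of \<open>g u\<close>,
    while \<open>P\<close> rises by at most \<open>1/4\<close> of it; the net fall is at least
    \<open>\<beta> = g u / 2\<close>.\<close>
  ultimately have drop: "\<Psi> (u + b) - \<Psi> u \<le> - \<beta>"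
    using F_ge[of u] \<kappa>R by (simp add: \<Psi>_def \<beta>_def)
  obtain l0 where l0: "linear l0" "\<And>h. l0 h \<le> \<Psi> (u + h) - \<Psi> u" "\<And>h. l0 h \<le> tuple_seminorm m (32 * \<kappa>) h"
  proof -
    have "sublinear (tuple_seminorm m (32 * \<kappa>) :: (nat \<Rightarrow>\<^sub>C 'a) \<Rightarrow> real)" using \<kappa> by (intro sublinear_tuple_seminorm) simp
    from convex_subgradient[OF cvx this \<Psi>_inc[of u]] show thesis using that by blast
  qed
  have l0_neg: "l0 (- h) = - l0 h" for h by (rule linear_neg[OF l0(1)])
  have "\<forall>n :: nat. \<exists>e>0. \<forall>h\<in>YZ. norm h \<le> e \<longrightarrow> \<Psi> (u + h) + \<Psi> (u - h) - 2 * \<Psi> u \<le> 1 / real (Suc n) * norm h"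
  proof
    fix n :: nat
    have "0 < 1 / real (Suc n)" by simp
    then show "\<exists>e>0. \<forall>h\<in>YZ. norm h \<le> e \<longrightarrow> \<Psi> (u + h) + \<Psi> (u - h) - 2 * \<Psi> u \<le> 1 / real (Suc n) * norm h"
      using smooth unfolding smooth_along_def by blast
  qed
  then obtain e where e: "\<And>n :: nat. e n > 0"
    "\<And>n h. h \<in> YZ \<Longrightarrow> norm h \<le> e n \<Longrightarrow> \<Psi> (u + h) + \<Psi> (u - h) - 2 * \<Psi> u \<le> 1 / real (Suc n) * norm h"
    by metis
  define \<delta> where "\<delta> n = min (e n) (R / 2)" for n
  have \<delta>: "\<delta> n > 0" for n using e(1) R(1) by (simp add: \<delta>_def)
  \<comment> \<open>The subgradient inequality at \<open>v\<close> bounds \<open>l0 (v - u)\<close>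
    only from above. Minimality at \<open>v\<close> and smoothness together bound the increment of
    \<open>\<Psi>\<close> at the reflected point \<open>u - (v - u)\<close>, which dominates
    \<open>- l0 (v - u)\<close>.\<close>
  have normal: "- l0 (v - u) \<le> norm (v - u) / Suc n"
    if v: "v \<in> tuples_in m \<Omega>" "v \<in> YZ" "norm (v - u) < \<delta> n" for n v
  proof -
    have vu: "norm (v - u) \<le> R / 2" "norm (v - u) \<le> e n" using v(3) by (auto simp: \<delta>_def)
    have "coord i v \<in> cball xbar s" if i: "i \<in> ?I" for i
    proof -
      have "norm (coord i v - xbar) = norm (coord i (v - u) + coord i (u - X))" using X(3)[OF i] by simp
      also have "\<dots> \<le> norm (v - u) + norm (u - X)"
        using norm_triangle_ineq[of "coord i (v - u)" "coord i (u - X)"] norm_coord_le[of i "v - u"]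
          norm_coord_le[of i "u - X"] by simp
      also have "\<dots> \<le> s" using vu(1) uX R(2) s by simp
      finally show ?thesis by (simp add: dist_norm norm_minus_commute)
    qed
    moreover have "norm (v - u1) \<le> R"
      using norm_triangle_ineq[of "v - u" "u - u1"] vu(1) u(2) by simp
    ultimately have "v \<in> D2" using v by (simp add: D2_def D_def dist_norm norm_minus_commute)
    then have "\<Psi> u \<le> \<Psi> v" using min2 by (simp add: \<Psi>_def P_def)
    moreover have "\<Psi> (u + (v - u)) + \<Psi> (u - (v - u)) - 2 * \<Psi> u \<le> 1 / real (Suc n) * norm (v - u)"
      using v(2) uD(1) YZ(2) vu(2) by (intro e(2) subspace_diff)
    moreover have "- l0 (v - u) \<le> \<Psi> (u - (v - u)) - \<Psi> u" using l0(2)[of "- (v - u)"]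
      unfolding l0_neg[of "v - u"] diff_conv_add_uminus[of u "v - u"] .
    ultimately show ?thesis by simp
  qed
  show ?thesis
  proof (rule that[of u b \<beta> "\<lambda>z. - l0 z" \<delta>])
    show "norm (u - X) \<le> s" using uX s by simp
    show "linear (\<lambda>z. - l0 z)" by (rule linear_compose_neg[OF l0(1)])
    show "- l0 h \<le> tuple_seminorm m (32 * \<kappa>) h" for h
      using l0(3)[of "- h"] by (simp add: l0_neg tuple_seminorm_minus)
    show "\<beta> \<le> - l0 b" using l0(2)[of b] drop by simp
    show "coord i b = 0" if "i \<notin> ?I" for i using that by (auto simp: coord_b)
  qed (use uD bY \<beta> sum_b \<delta> normal in auto)
qed

text \<open>The lifted functional \<open>f\<close> on tuples splits into components
  \<open>x i\<close>. Testing \<open>f\<close> on diagonal tuples bounds their sum, testing it on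
  \<open>b\<close> keeps one of them large, and testing it on changes of one coordinate makes each
  of them a Frechet normal.\<close>

lemma approximate_extremal_principle:
  fixes \<Omega> :: "nat \<Rightarrow> 'a::banach set" and a :: "nat \<Rightarrow> 'a"
  assumes A: "asplund TYPE('a)" and m: "m \<ge> 2" and xbar: "\<And>i. i \<in> {1..m} \<Longrightarrow> xbar \<in> \<Omega> i"
    and s: "s > 0" and cl: "\<And>i. i \<in> {1..m} \<Longrightarrow> closed (\<Omega> i \<inter> cball xbar s)"
    and emp: "(\<Inter>i\<in>{1..m}. (\<lambda>w. w - a i) ` \<Omega> i) \<inter> cball xbar s = {}"
    and r: "\<And>i. i \<in> {1..m} \<Longrightarrow> norm (a i) \<le> r" and \<kappa>: "\<kappa> > 0" "\<kappa> \<le> 1/128" and rs: "64 * real m * r \<le> \<kappa> * s"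
  obtains u x where "\<And>i. i \<in> {1..m} \<Longrightarrow> frechet_normal (\<Omega> i) (u i) (x i)"
    "\<And>i. i \<in> {1..m} \<Longrightarrow> norm (u i - xbar) \<le> s" "\<And>i. norm (x i) \<le> 3 * real m"
    "norm (\<Sum>i\<in>{1..m}. x i) \<le> 32 * \<kappa> * real m" "\<exists>i\<in>{1..m}. norm (x i) \<ge> 1/8"
proof -
  let ?I = "{1..m}" and ?\<rho> = "tuple_seminorm m (32 * \<kappa>) :: (nat \<Rightarrow>\<^sub>C 'a) \<Rightarrow> real"
  have \<kappa>0: "32 * \<kappa> \<ge> 0" using \<kappa> by simp
  define X :: "nat \<Rightarrow>\<^sub>C 'a" where "X = (\<Sum>i\<in>?I. emb i xbar)"
  define At :: "nat \<Rightarrow>\<^sub>C 'a" where "At = (\<Sum>i\<in>?I. emb i (a i))"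
  have coord_X: "coord i X = (if i \<in> ?I then xbar else 0)" for i
    unfolding X_def by (rule coord_sum_emb) simp
  have coord_At: "coord i At = (if i \<in> ?I then a i else 0)" for i
    unfolding At_def by (rule coord_sum_emb) simp
  define F where "F zs = (\<Union>z\<in>set zs. \<Union>i\<in>?I. \<Union>j\<in>?I. {emb i (coord j z)})" for zs :: "(nat \<Rightarrow>\<^sub>C 'a) list"
  have cF: "countable (F zs)" for zs
    unfolding F_def by (intro countable_UN countable_finite) auto
  have cS0: "countable {X, At}" by simp
  obtain S where S: "countable S" "{X, At} \<subseteq> S" "\<And>zs. set zs \<subseteq> S \<Longrightarrow> F zs \<subseteq> S"
    "subspace (closure S)" "separable_space (top_of_set (closure S))"
    and lift: "normals_lift ?\<rho> (tuples_in m \<Omega>) (closure S)"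
    by (rule normal_lifting[where \<rho> = ?\<rho> and F = F and \<Omega> = "tuples_in m \<Omega>",
          OF sublinear_tuple_seminorm[OF \<kappa>0] tuple_seminorm_nonneg[OF \<kappa>0] tuple_seminorm_le[OF \<kappa>0] cF cS0], rule that)
  define YZ where "YZ = closure S"
  have opS: "emb i (coord j z) \<in> S" if "z \<in> S" "i \<in> ?I" "j \<in> ?I" for z i j
  proof -
    have "emb i (coord j z) \<in> F [z]"
      unfolding F_def by (rule UN_I[of z], simp, rule UN_I[OF that(2)], rule UN_I[OF that(3)], simp)
    then show ?thesis using S(3)[of "[z]"] that(1) by auto
  qed
  have ops: "emb i (coord j z) \<in> YZ" if z: "z \<in> YZ" and ij: "i \<in> ?I" "j \<in> ?I" for z i j
  proof -
    have "(\<lambda>z. emb i (coord j z)) ` closure S \<subseteq> closure S"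
    proof (rule image_closure_subset)
      show "continuous_on (closure S) (\<lambda>z. emb i (coord j z))"
        by (rule continuous_on_compose2[OF continuous_on_emb continuous_on_coord]) auto
      show "(\<lambda>z. emb i (coord j z)) ` S \<subseteq> closure S"
        using opS ij closure_subset[of S] by auto
    qed simp
    then show ?thesis using z by (auto simp: YZ_def)
  qed
  \<comment> \<open>Coordinates can be moved between slots inside \<open>YZ\<close>, so the first
    slot represents all of them and every coordinate of a tuple in \<open>YZ\<close> lies in
    \<open>Y\<close>.\<close>
  define Y where "Y = {x. emb 1 x \<in> YZ}"
  have I1: "1 \<in> ?I" using m by simp
  have subY: "subspace Y"
    using S(4) unfolding Y_def YZ_def[symmetric] subspace_def
    by (auto simp: linear_add[OF linear_emb] linear_scale[OF linear_emb] linear_0[OF linear_emb])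
  have sepY: "separable_space (top_of_set Y)"
  proof (rule separable_space_if_subset_closure)
    show "countable (coord 1 ` S)" using S(1) by simp
    show "coord 1 ` S \<subseteq> Y"
      using opS[OF _ I1 I1] closure_subset[of S] by (auto simp: Y_def YZ_def)
    have "coord 1 ` closure S \<subseteq> closure (coord 1 ` S)"
      by (rule image_closure_subset[OF continuous_on_coord]) (auto simp: closure_subset)
    then show "Y \<subseteq> closure (coord 1 ` S)"
    proof (intro subsetI)
      fix x assume "x \<in> Y"
      then have "coord 1 (emb 1 x) \<in> coord 1 ` closure S" by (auto simp: Y_def YZ_def)
      then show "x \<in> closure (coord 1 ` S)"
        using \<open>coord 1 ` closure S \<subseteq> closure (coord 1 ` S)\<close> by (auto simp: coord_emb)
    qed
  qed
  have XY: "X \<in> YZ" "At \<in> YZ" using S(2) closure_subset[of S] by (auto simp: YZ_def)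
  have clYZ: "closed YZ" and subYZ: "subspace YZ" using S(4) by (auto simp: YZ_def)
  have YZ_Y: "coord i z \<in> Y" if "z \<in> YZ" "i \<in> ?I" for z i
    using ops[OF that(1) I1 that(2)] by (simp add: Y_def)
  have XT: "X \<in> tuples_in m \<Omega>" using xbar by (auto simp: tuples_in_def coord_X)
  have cX: "coord i X = xbar" and cAt: "coord i At = a i" if "i \<in> ?I" for i
    using that by (simp_all add: coord_X coord_At)
  obtain u b \<beta> l \<delta> where u: "u \<in> YZ" "u \<in> tuples_in m \<Omega>" "norm (u - X) \<le> s"
    and b: "b \<in> YZ" "\<beta> > 0" "(\<Sum>i\<in>{1..m}. norm (coord i b)) = 2 * \<beta>" "\<And>i. i \<notin> {1..m} \<Longrightarrow> coord i b = 0"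
    and l: "linear l" "\<And>h. l h \<le> ?\<rho> h" "l b \<ge> \<beta>" and \<delta>: "\<And>n :: nat. \<delta> n > 0"
    and normal: "\<And>n v. v \<in> tuples_in m \<Omega> \<Longrightarrow> v \<in> YZ \<Longrightarrow> norm (v - u) < \<delta> n \<Longrightarrow> l (v - u) \<le> norm (v - u) / Suc n"
    by (rule extremal_normal_along_subspace[OF A m clYZ subYZ subY sepY YZ_Y ops XY(1) XT cX XY(2) cAt s cl emp r \<kappa> rs])
      (assumption+, rule that)
  \<comment> \<open>Lifting may lose half of the value at \<open>b\<close>: the coordinate norms of
    \<open>b\<close> add up to \<open>2 * \<beta>\<close>, so components of norm at most
    \<open>1/8\<close> would give only \<open>f b \<le> \<beta> / 4\<close>.\<close>
  have "\<beta> / 2 < \<beta>" using b(2) by simp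
  note lifted = normals_liftD[where \<delta> = \<delta>, OF lift[folded YZ_def] u(1) b(1) this \<delta> l normal]
  have "\<exists>f. linear f \<and> (\<forall>z. f z \<le> ?\<rho> z) \<and> f b \<ge> \<beta> / 2 \<and>
      (\<forall>n. \<forall>v\<in>tuples_in m \<Omega>. norm (v - u) < \<delta> n \<longrightarrow> f (v - u) \<le> norm (v - u) / Suc n)"
    by (rule lifted)
  then obtain f where f: "linear f" "\<And>z. f z \<le> ?\<rho> z"
    "f b \<ge> \<beta> / 2" "\<And>n v. v \<in> tuples_in m \<Omega> \<Longrightarrow> norm (v - u) < \<delta> n \<Longrightarrow> f (v - u) \<le> norm (v - u) / Suc n"
    by blast
  have "\<exists>g :: 'a \<Rightarrow>\<^sub>L real. (\<forall>h. blinfun_apply g h = f (emb i h)) \<and> norm g \<le> 3 * real m" for i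
  proof -
    have "linear (\<lambda>h. f (emb i h))" using linear_compose[OF linear_emb f(1)] by (simp add: o_def)
    moreover have "f (emb i h) \<le> (3 * real m) * norm h" for h
    proof -
      have "f (emb i h) \<le> (2 * real m + 32 * \<kappa> * real m) * norm (emb i h)"
        using f(2) tuple_seminorm_le[OF \<kappa>0] order_trans by blast
      also have "\<dots> \<le> (3 * real m) * norm h"
        unfolding norm_emb using \<kappa> mult_right_mono[of "32 * \<kappa>" 1 "real m"] by (intro mult_right_mono) auto
      finally show ?thesis .
    qed
    moreover have "0 \<le> 3 * real m" by simp
    ultimately obtain g :: "'a \<Rightarrow>\<^sub>L real" where "\<And>h. blinfun_apply g h = f (emb i h)" "norm g \<le> 3 * real m"
      by (rule blinfun_of_linear_le_norm) blast
    then show ?thesis by blast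
  qed
  then obtain x :: "nat \<Rightarrow> 'a \<Rightarrow>\<^sub>L real" where x: "\<And>i h. blinfun_apply (x i) h = f (emb i h)" "\<And>i. norm (x i) \<le> 3 * real m"
    by metis
  have sum_x: "(\<Sum>i\<in>?I. blinfun_apply (x i) (h i)) = f (\<Sum>i\<in>?I. emb i (h i))" for h
    by (simp add: x linear_sum[OF f(1)])
  have 1: "frechet_normal (\<Omega> i) (coord i u) (x i)" if i: "i \<in> ?I" for i
    unfolding frechet_normal_def
  proof (intro conjI allI impI)
    show "coord i u \<in> \<Omega> i" using u(2) i by (simp add: tuples_in_def)
    fix e :: real assume e: "e > 0"
    obtain n where n: "1 / Suc n < e" using reals_Archimedean[OF e] by (auto simp: inverse_eq_divide)
    have "blinfun_apply (x i) (v - coord i u) \<le> e * norm (v - coord i u)"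
      if v: "v \<in> \<Omega> i" "norm (v - coord i u) < \<delta> n" for v
    proof -
      \<comment> \<open>Changing the single coordinate \<open>i\<close> within
        \<open>\<Omega> i\<close> stays in the product set, so normality of \<open>f\<close> passes
        to \<open>x i\<close> with the same radii.\<close>
      define z where "z = u + emb i (v - coord i u)"
      have "z \<in> tuples_in m \<Omega>" using u(2) v(1) i by (auto simp: z_def tuples_in_def coord_emb)
      moreover have zu: "z - u = emb i (v - coord i u)" by (simp add: z_def)
      ultimately have "blinfun_apply (x i) (v - coord i u) \<le> 1 / Suc n * norm (v - coord i u)"
        using f(4)[of z n] v(2) by (simp add: x norm_emb)
      also have "\<dots> \<le> e * norm (v - coord i u)" using n by (intro mult_right_mono) auto
      finally show ?thesis .
    qed
    then show "\<exists>d>0. \<forall>v\<in>\<Omega> i. norm (v - coord i u) < d \<longrightarrow> blinfun_apply (x i) (v - coord i u) \<le> e * norm (v - coord i u)"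
      using \<delta> by blast
  qed
  have 2: "norm (coord i u - xbar) \<le> s" if "i \<in> ?I" for i
    using norm_coord_le[of i "u - X"] u(3) cX[OF that] by simp
  have 3: "norm (\<Sum>i\<in>?I. x i) \<le> 32 * \<kappa> * real m"
  proof (rule norm_blinfun_bound)
    show "0 \<le> 32 * \<kappa> * real m" using \<kappa> by simp
    have up: "blinfun_apply (\<Sum>i\<in>?I. x i) h \<le> 32 * \<kappa> * real m * norm h" for h
    proof -
      have "blinfun_apply (\<Sum>i\<in>?I. x i) h = f (\<Sum>i\<in>?I. emb i h)"
        unfolding blinfun.sum_left by (rule sum_x)
      also have "\<dots> \<le> ?\<rho> (\<Sum>i\<in>?I. emb i h)" by (rule f(2))
      also have "\<dots> = 32 * \<kappa> * (\<Sum>i\<in>?I. norm h)"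
      proof -
        have "coord i (\<Sum>i\<in>?I. emb i h) = (if i \<in> ?I then h else 0)" for i by (rule coord_sum_emb) simp
        then show ?thesis using m by (simp add: tuple_seminorm_def)
      qed
      finally show ?thesis by simp
    qed
    show "norm (blinfun_apply (\<Sum>i\<in>?I. x i) h) \<le> 32 * \<kappa> * real m * norm h" for h
      using up[of h] up[of "- h"] by (simp add: blinfun.minus_right abs_le_iff)
  qed
  have 4: "\<exists>i\<in>?I. norm (x i) \<ge> 1/8"
  proof (rule ccontr)
    assume "\<not> ?thesis"
    then have small: "norm (x i) \<le> 1/8" if "i \<in> ?I" for i using that by force
    have "b = (\<Sum>i\<in>?I. emb i (coord i b))"
      using b(4) by (intro tuple_eqI) (auto simp: coord_sum_emb)
    then have "f b = (\<Sum>i\<in>?I. blinfun_apply (x i) (coord i b))" by (metis sum_x)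
    also have "\<dots> \<le> (\<Sum>i\<in>?I. 1/8 * norm (coord i b))"
    proof (rule sum_mono)
      fix i assume i: "i \<in> ?I"
      have "blinfun_apply (x i) (coord i b) \<le> norm (x i) * norm (coord i b)"
        using norm_blinfun[of "x i" "coord i b"] by simp
      also have "\<dots> \<le> 1/8 * norm (coord i b)" by (rule mult_right_mono[OF small[OF i]]) simp
      finally show "blinfun_apply (x i) (coord i b) \<le> 1/8 * norm (coord i b)" .
    qed
    also have "\<dots> = 1/8 * (2 * \<beta>)" unfolding sum_distrib_left[symmetric] b(3) ..
    finally show False using f(3) b(2) by simp
  qed
  show ?thesis by (rule that[of "\<lambda>i. coord i u" x, OF 1 2 x(2) 3 4])
qed

section \<open>Passage to the limit\<close>

lemma frechet_normal_scaleR: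
  assumes "frechet_normal \<Omega> u f" "c > 0"
  shows "frechet_normal \<Omega> u (c *\<^sub>R f)"
  unfolding frechet_normal_def
proof (intro conjI allI impI)
  show "u \<in> \<Omega>" using assms(1) by (simp add: frechet_normal_def)
  fix e :: real assume "e > 0"
  then have "e / c > 0" using assms(2) by simp
  then obtain d where d: "d > 0" "\<And>v. v \<in> \<Omega> \<Longrightarrow> norm (v - u) < d \<Longrightarrow> blinfun_apply f (v - u) \<le> e / c * norm (v - u)"
    using assms(1) unfolding frechet_normal_def by blast
  have "blinfun_apply (c *\<^sub>R f) (v - u) \<le> e * norm (v - u)" if "v \<in> \<Omega>" "norm (v - u) < d" for v
    using mult_left_mono[OF d(2)[OF that], of c] assms(2) by (simp add: blinfun.scaleR_left)
  then show "\<exists>d>0. \<forall>v\<in>\<Omega>. norm (v - u) < d \<longrightarrow> blinfun_apply (c *\<^sub>R f) (v - u) \<le> e * norm (v - u)"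
    using d(1) by blast
qed

lemma frechet_normal_eps_normals:
  assumes "frechet_normal \<Omega> u f"
  shows "f \<in> eps_normals 0 u \<Omega>"
proof -
  have u: "u \<in> \<Omega>" using assms by (simp add: frechet_normal_def)
  have "Limsup (at u within \<Omega>) (\<lambda>v. ereal (blinfun_apply f (v - u) / norm (v - u))) \<le> 0"
  proof (rule ereal_le_epsilon2)
    fix e :: real assume e: "0 < e"
    obtain d where d: "d > 0" "\<And>v. v \<in> \<Omega> \<Longrightarrow> norm (v - u) < d \<Longrightarrow> blinfun_apply f (v - u) \<le> e * norm (v - u)"
      using assms e unfolding frechet_normal_def by blast
    have "\<forall>\<^sub>F v in at u within \<Omega>. ereal (blinfun_apply f (v - u) / norm (v - u)) \<le> ereal e"
      unfolding eventually_at
    proof (intro exI[of _ d] conjI ballI impI)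
      fix v assume "v \<in> \<Omega>" "v \<noteq> u \<and> dist v u < d"
      then show "ereal (blinfun_apply f (v - u) / norm (v - u)) \<le> ereal e"
        using d(2)[of v] by (simp add: dist_norm divide_le_eq)
    qed (use d in simp)
    then have "Limsup (at u within \<Omega>) (\<lambda>v. ereal (blinfun_apply f (v - u) / norm (v - u))) \<le> ereal e"
      by (rule Limsup_bounded)
    then show "Limsup (at u within \<Omega>) (\<lambda>v. ereal (blinfun_apply f (v - u) / norm (v - u))) \<le> 0 + ereal e"
      by simp
  qed
  then show ?thesis using u by (simp add: eps_normals_def zero_ereal_def)
qed

lemma limitin_weak_star:
  assumes "\<And>h. ((\<lambda>n. blinfun_apply (f n) h) \<longlongrightarrow> blinfun_apply g h) F"
  shows "limitin weak_star_topology f g F"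
proof -
  have lim: "limitin (euclidean :: ('a \<Rightarrow> real) topology) (\<lambda>n. blinfun_apply (f n)) (blinfun_apply g) F"
    unfolding euclidean_product_topology[symmetric] limitin_componentwise using assms by simp
  show ?thesis
    unfolding limitin_def
  proof (intro conjI allI impI)
    show "g \<in> topspace weak_star_topology" by (simp add: strong_operator_topology_topspace)
    fix U assume U: "openin weak_star_topology U \<and> g \<in> U"
    then obtain V where V: "openin (euclidean :: ('a \<Rightarrow> real) topology) V" "U = blinfun_apply -` V \<inter> UNIV"
      unfolding strong_operator_topology_def openin_pullback_topology by blast
    then have "\<forall>\<^sub>F n in F. blinfun_apply (f n) \<in> V" using lim U unfolding limitin_def by auto
    then show "\<forall>\<^sub>F n in F. f n \<in> U" by eventually_elim (simp add: V(2))
  qed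
qed

lemma weak_star_subseq_tuple:
  fixes x :: "nat \<Rightarrow> nat \<Rightarrow> 'a::banach \<Rightarrow>\<^sub>L real"
  assumes A: "asplund TYPE('a)" and x: "\<And>n i. norm (x n i) \<le> K"
  shows "\<exists>r :: nat \<Rightarrow> nat. \<exists>g. strict_mono r \<and>
    (\<forall>i<k. \<forall>h. (\<lambda>n. blinfun_apply (x (r n) i) h) \<longlonglongrightarrow> blinfun_apply (g i) h)"
proof (induction k)
  case 0
  show ?case by (intro exI[of _ id]) (simp add: strict_mono_def)
next
  case (Suc k)
  then obtain r :: "nat \<Rightarrow> nat" and g where r: "strict_mono r"
    and g: "\<And>i h. i < k \<Longrightarrow> (\<lambda>n. blinfun_apply (x (r n) i) h) \<longlonglongrightarrow> blinfun_apply (g i) h" by blast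
  obtain r' :: "nat \<Rightarrow> nat" and g' where r': "strict_mono r'"
    and g': "\<And>h. (\<lambda>n. blinfun_apply (x (r (r' n)) k) h) \<longlonglongrightarrow> blinfun_apply g' h"
    by (rule asplund_weak_star_seq_compact[where f = "\<lambda>n. x (r n) k", OF A x], rule that)
  have "(\<lambda>n. blinfun_apply (x ((r \<circ> r') n) i) h) \<longlonglongrightarrow> blinfun_apply ((g(k := g')) i) h" if "i < Suc k" for i h
  proof (cases "i = k")
    case True
    then show ?thesis using g' by simp
  next
    case False
    then show ?thesis
      using LIMSEQ_subseq_LIMSEQ[OF g[of i h] r'] that by (simp add: o_def)
  qed
  moreover have "strict_mono (r \<circ> r')" using r r' by (rule strict_mono_o)
  ultimately show ?case by blast
qed

text \<open>The place where \<open>\<alpha> < 1\<close> is used: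
  \<open>r k = r k powr (1 - \<alpha>) * r k powr \<alpha>\<close>, and the first factor tends to 0.
  The threshold \<open>b\<close> satisfies
  \<open>b powr (1 - \<alpha>) = \<gamma> / C\<close>.\<close>

lemma small_rate_exists:
  fixes r :: "nat \<Rightarrow> real"
  assumes r: "r \<longlonglongrightarrow> 0" and pos: "\<forall>\<^sub>F k in sequentially. r k > 0" and \<alpha>: "\<alpha> < 1" and C: "C > 0" and \<gamma>: "\<gamma> > 0"
  shows "\<forall>\<^sub>F k in sequentially. C * r k \<le> \<gamma> * r k powr \<alpha>"
proof -
  define b where "b = (\<gamma> / C) powr (1 / (1 - \<alpha>))"
  have "b > 0" using C \<gamma> by (simp add: b_def)
  then have "\<forall>\<^sub>F k in sequentially. r k < b" using r by (rule order_tendstoD(2)[rotated])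
  with pos show ?thesis
  proof eventually_elim
    case (elim k)
    have "r k powr (1 - \<alpha>) \<le> b powr (1 - \<alpha>)" using elim \<alpha> by (intro powr_mono2) auto
    also have "\<dots> = \<gamma> / C" using \<alpha> C \<gamma> by (simp add: b_def powr_powr)
    finally have "C * r k powr (1 - \<alpha>) \<le> \<gamma>" using C by (simp add: field_simps)
    then have "C * r k powr (1 - \<alpha>) * r k powr \<alpha> \<le> \<gamma> * r k powr \<alpha>" by (rule mult_right_mono) simp
    moreover have "r k powr (1 - \<alpha>) * r k powr \<alpha> = r k" using elim(1) by (simp add: powr_add[symmetric])
    ultimately show ?case by (simp add: mult.assoc)
  qed
qed

text \<open>The slope \<open>\<kappa>\<close> is fixed first, from the wanted accuracy
  \<open>e\<close>. Then \<open>k\<close> is taken so large that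
  \<open>64 * real m / \<kappa> * r k\<close> fits below the radius of emptiness and below the
  radius of closedness.\<close>

lemma rated_extremal_approximation:
  fixes \<Omega> :: "nat \<Rightarrow> 'a::banach set"
  assumes A: "asplund TYPE('a)" and m: "m \<ge> 2" and ext: "rated_extremal_point \<alpha> m \<Omega> xbar"
    and loc: "\<forall>i\<in>{1..m}. locally_closed_at (\<Omega> i) xbar" and e: "e > 0"
  obtains u x where "\<And>i. i \<in> {1..m} \<Longrightarrow> frechet_normal (\<Omega> i) (u i) (x i)"
    "\<And>i. i \<in> {1..m} \<Longrightarrow> norm (u i - xbar) \<le> e" "\<And>i. norm (x i) \<le> 3 * real m"
    "norm (\<Sum>i\<in>{1..m}. x i) \<le> e" "\<exists>i\<in>{1..m}. norm (x i) \<ge> 1/8"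
proof -
  let ?I = "{1..m}"
  have m0: "real m > 0" and neI: "?I \<noteq> {}" using m by auto
  have xbar: "xbar \<in> \<Omega> i" if "i \<in> ?I" for i
    using ext that by (auto simp: rated_extremal_point_def)
  have \<alpha>: "\<alpha> < 1" using ext by (simp add: rated_extremal_point_def)
  obtain \<gamma> a where \<gamma>: "\<gamma> > 0"
    and ra: "(\<lambda>k. Max ((\<lambda>i. norm (a i k)) ` ?I)) \<longlonglongrightarrow> 0"
      "\<forall>\<^sub>F k in sequentially. (\<Inter>i\<in>?I. (\<lambda>w. w - a i k) ` \<Omega> i) \<inter>
        cball xbar (\<gamma> * Max ((\<lambda>i. norm (a i k)) ` ?I) powr \<alpha>) = {}"
    using ext unfolding rated_extremal_point_def Let_def by blast
  define r where "r k = Max ((\<lambda>i. norm (a i k)) ` ?I)" for k :: nat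
  note ra = ra[folded r_def]
  have ar: "norm (a i k) \<le> r k" if "i \<in> ?I" for i k
    unfolding r_def using that by (intro Max_ge) auto
  \<comment> \<open>If all shifts vanished, \<open>xbar\<close> itself would be a common
    point.\<close>
  have "r k > 0" if emp: "(\<Inter>i\<in>?I. (\<lambda>w. w - a i k) ` \<Omega> i) \<inter> cball xbar (\<gamma> * r k powr \<alpha>) = {}" for k
  proof (rule ccontr)
    assume "\<not> r k > 0"
    then have "norm (a i k) \<le> 0" if "i \<in> ?I" for i using ar[OF that, of k] by linarith
    then have a0: "a i k = 0" if "i \<in> ?I" for i using that by simp
    have "xbar \<in> (\<lambda>w. w - a i k) ` \<Omega> i" if "i \<in> ?I" for i
      using xbar[OF that] a0[OF that] by simp
    then have "xbar \<in> (\<Inter>i\<in>?I. (\<lambda>w. w - a i k) ` \<Omega> i) \<inter> cball xbar (\<gamma> * r k powr \<alpha>)"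
      using \<gamma> by simp
    then show False unfolding emp by simp
  qed
  then have pos: "\<forall>\<^sub>F k in sequentially. r k > 0" by (rule eventually_mono[OF ra(2)])
  have "\<forall>i\<in>?I. \<exists>\<rho>>0. closed (\<Omega> i \<inter> cball xbar \<rho>)" using loc by (simp add: locally_closed_at_def)
  then obtain \<rho> where \<rho>: "\<And>i. i \<in> ?I \<Longrightarrow> \<rho> i > 0" "\<And>i. i \<in> ?I \<Longrightarrow> closed (\<Omega> i \<inter> cball xbar (\<rho> i))" by metis
  define \<rho>0 where "\<rho>0 = min e (Min (\<rho> ` ?I))"
  have \<rho>0: "\<rho>0 > 0" "\<rho>0 \<le> e" using e \<rho>(1) neI by (auto simp: \<rho>0_def)
  have \<rho>0_le: "\<rho>0 \<le> \<rho> i" if "i \<in> ?I" for i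
  proof -
    have "Min (\<rho> ` ?I) \<le> \<rho> i" using that by (intro Min_le) auto
    then show ?thesis by (simp add: \<rho>0_def)
  qed
  define \<kappa> where "\<kappa> = min (1/128) (e / (32 * real m))"
  have \<kappa>: "\<kappa> > 0" "\<kappa> \<le> 1/128" using e m0 by (auto simp: \<kappa>_def)
  have "\<kappa> \<le> e / (32 * real m)" by (simp add: \<kappa>_def)
  then have \<kappa>e: "32 * \<kappa> * real m \<le> e" using m0 by (simp add: field_simps)
  have C: "64 * real m / \<kappa> > 0" using m0 \<kappa> by simp
  have small: "\<forall>\<^sub>F k in sequentially. r k < \<kappa> * \<rho>0 / (64 * real m)"
    using order_tendstoD(2)[OF ra(1)] \<kappa>(1) \<rho>0(1) m0 by simp
  have "\<forall>\<^sub>F k in sequentially. 64 * real m / \<kappa> * r k \<le> \<gamma> * r k powr \<alpha>"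
    by (rule small_rate_exists[OF ra(1) pos \<alpha> C \<gamma>])
  from eventually_conj[OF this eventually_conj[OF small eventually_conj[OF pos ra(2)]]]
  obtain k where k: "64 * real m / \<kappa> * r k \<le> \<gamma> * r k powr \<alpha>" "r k < \<kappa> * \<rho>0 / (64 * real m)" "r k > 0"
    "(\<Inter>i\<in>?I. (\<lambda>w. w - a i k) ` \<Omega> i) \<inter> cball xbar (\<gamma> * r k powr \<alpha>) = {}"
    using eventually_happens'[OF sequentially_bot] by blast
  \<comment> \<open>One radius for everything: within \<open>e\<close>, within the radii of
    closedness, and within the radius of emptiness.\<close>
  define s where "s = min \<rho>0 (\<gamma> * r k powr \<alpha>)"
  have s: "s > 0" "s \<le> \<rho>0" "s \<le> \<gamma> * r k powr \<alpha>" using \<rho>0(1) \<gamma> k(3) by (auto simp: s_def)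
  have rs: "64 * real m * r k \<le> \<kappa> * s"
  proof -
    have "64 * real m / \<kappa> * r k \<le> \<rho>0" using k(2) \<kappa>(1) m0 by (simp add: field_simps)
    then have "64 * real m / \<kappa> * r k \<le> s" using k(1) by (simp add: s_def)
    then show ?thesis using \<kappa>(1) by (simp add: field_simps)
  qed
  have cl: "closed (\<Omega> i \<inter> cball xbar s)" if "i \<in> ?I" for i
  proof -
    have "\<Omega> i \<inter> cball xbar s = (\<Omega> i \<inter> cball xbar (\<rho> i)) \<inter> cball xbar s"
      using s(2) \<rho>0_le[OF that] by auto
    also have "closed \<dots>" by (rule closed_Int[OF \<rho>(2)[OF that] closed_cball])
    finally show ?thesis .
  qed
  have "cball xbar s \<subseteq> cball xbar (\<gamma> * r k powr \<alpha>)" using s(3) by auto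
  then have emp: "(\<Inter>i\<in>?I. (\<lambda>w. w - a i k) ` \<Omega> i) \<inter> cball xbar s = {}" using k(4) by blast
  obtain u x where ux: "\<And>i. i \<in> ?I \<Longrightarrow> frechet_normal (\<Omega> i) (u i) (x i)"
    "\<And>i. i \<in> ?I \<Longrightarrow> norm (u i - xbar) \<le> s" "\<And>i. norm (x i) \<le> 3 * real m"
    "norm (\<Sum>i\<in>?I. x i) \<le> 32 * \<kappa> * real m" "\<exists>i\<in>?I. norm (x i) \<ge> 1/8"
    by (rule approximate_extremal_principle[where a = "\<lambda>i. a i k", OF A m xbar s(1) cl emp ar \<kappa>(1,2) rs])
      (assumption+, rule that)
  have ue: "norm (u i - xbar) \<le> e" if "i \<in> ?I" for i using ux(2)[OF that] s(2) \<rho>0(2) by simp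
  have xe: "norm (\<Sum>i\<in>?I. x i) \<le> e" using ux(4) \<kappa>e by simp
  show ?thesis by (rule that[OF ux(1) ue ux(3) xe ux(5)])
qed

theorem theorem3p9:
  fixes \<Omega> :: "nat \<Rightarrow> 'a::banach set"
    and xbar :: 'a
    and m :: nat
    and \<alpha> :: real
  assumes "asplund TYPE('a)"
    and "m \<ge> 2"
    and "rated_extremal_point \<alpha> m \<Omega> xbar"
    and "\<forall>i\<in>{1..m}. locally_closed_at (\<Omega> i) xbar"
    and "\<exists>j\<in>{1..m}. \<forall>i\<in>{1..m} - {j}. SNC_at (\<Omega> i) xbar"
  shows "\<exists>x :: nat \<Rightarrow> 'a \<Rightarrow>\<^sub>L real.
           (\<forall>i\<in>{1..m}. x i \<in> limiting_normal_cone xbar (\<Omega> i)) \<and>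
           (\<Sum>i=1..m. x i) = 0 \<and>
           (\<Sum>i=1..m. (norm (x i))\<^sup>2) = 1"
proof -
  let ?I = "{1..m}"
  have "\<exists>u x. (\<forall>i\<in>?I. frechet_normal (\<Omega> i) (u i) (x i) \<and> norm (u i - xbar) \<le> 1 / real (Suc n)) \<and>
      (\<forall>i. norm (x i) \<le> 3 * real m) \<and> norm (\<Sum>i\<in>?I. x i) \<le> 1 / real (Suc n) \<and>
      (\<exists>i\<in>?I. norm (x i) \<ge> 1/8)" for n
  proof -
    have "1 / real (Suc n) > 0" by simp
    from rated_extremal_approximation[OF assms(1-4) this] show ?thesis by metis
  qed
  then obtain u x where
    fn: "\<And>n i. i \<in> ?I \<Longrightarrow> frechet_normal (\<Omega> i) (u n i) (x n i)"
    and un: "\<And>n i. i \<in> ?I \<Longrightarrow> norm (u n i - xbar) \<le> 1 / real (Suc n)"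
    and xn: "\<And>n i. norm (x n i) \<le> 3 * real m"
    and sn: "\<And>n. norm (\<Sum>i\<in>?I. x n i) \<le> 1 / real (Suc n)"
    and big: "\<And>n. \<exists>i\<in>?I. norm (x n i) \<ge> 1/8"
    by metis
  \<comment> \<open>\<open>Suc m\<close> because the extraction lemma covers indices strictly below
    its bound and the index \<open>m\<close> is wanted.\<close>
  obtain r :: "nat \<Rightarrow> nat" and g where r: "strict_mono r"
    and g': "\<forall>i<Suc m. \<forall>h. (\<lambda>n. blinfun_apply (x (r n) i) h) \<longlonglongrightarrow> blinfun_apply (g i) h"
    using weak_star_subseq_tuple[where x = x and k = "Suc m", OF assms(1) xn] by blast
  have g: "(\<lambda>n. blinfun_apply (x (r n) i) h) \<longlonglongrightarrow> blinfun_apply (g i) h" if "i \<in> ?I" for i h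
    using g' that by simp
  have inv0: "(\<lambda>n. 1 / real (Suc (r n))) \<longlonglongrightarrow> 0"
    using LIMSEQ_subseq_LIMSEQ[OF LIMSEQ_Suc[OF lim_1_over_n] r] by (simp add: o_def)
  have u_lim: "(\<lambda>n. u (r n) i) \<longlonglongrightarrow> xbar" if "i \<in> ?I" for i
  proof (subst LIM_zero_iff[symmetric], rule Lim_null_comparison[OF _ inv0])
    show "\<forall>\<^sub>F n in sequentially. norm (u (r n) i - xbar) \<le> 1 / real (Suc (r n))"
      by (intro always_eventually allI un that)
  qed
  have sum_lim: "(\<lambda>n. norm (\<Sum>i\<in>?I. x (r n) i)) \<longlonglongrightarrow> 0"
    by (rule tendsto_sandwich[OF _ _ tendsto_const inv0]) (intro always_eventually allI norm_ge_zero sn)+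
  have sum0: "(\<Sum>i\<in>?I. g i) = 0"
  proof (rule blinfun_eqI)
    fix h
    have "(\<lambda>n. \<Sum>i\<in>?I. blinfun_apply (x (r n) i) h) \<longlonglongrightarrow> (\<Sum>i\<in>?I. blinfun_apply (g i) h)"
      by (intro tendsto_sum g)
    then have 1: "(\<lambda>n. blinfun_apply (\<Sum>i\<in>?I. x (r n) i) h) \<longlonglongrightarrow> blinfun_apply (\<Sum>i\<in>?I. g i) h"
      by (simp only: blinfun.sum_left)
    have "(\<lambda>n. norm (\<Sum>i\<in>?I. x (r n) i) * norm h) \<longlonglongrightarrow> 0"
      using tendsto_mult_left_zero[OF sum_lim] by simp
    then have "(\<lambda>n. blinfun_apply (\<Sum>i\<in>?I. x (r n) i) h) \<longlonglongrightarrow> 0"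
      by (rule Lim_null_comparison[rotated]) (intro always_eventually allI norm_blinfun)
    with 1 show "blinfun_apply (\<Sum>i\<in>?I. g i) h = blinfun_apply 0 h"
      using LIMSEQ_unique by force
  qed
  \<comment> \<open>Weak-star limits may lose norm, so the lower bound \<open>1/8\<close> does not
    pass to the limit by itself. If all limits vanished, SNC would drive all but one sequence to 0
    in norm, and the small sum would do the same for the last one.\<close>
  have "\<exists>i\<in>?I. g i \<noteq> 0"
  proof (rule ccontr)
    assume "\<not> ?thesis"
    then have g0: "g i = 0" if "i \<in> ?I" for i using that by blast
    obtain j where j: "j \<in> ?I" "\<And>i. i \<in> ?I - {j} \<Longrightarrow> SNC_at (\<Omega> i) xbar" using assms(5) by blast
    have x0: "(\<lambda>n. norm (x (r n) i)) \<longlonglongrightarrow> 0" if i: "i \<in> ?I - {j}" for i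
    proof -
      have iI: "i \<in> ?I" using i by simp
      have "limitin weak_star_topology (\<lambda>n. x (r n) i) 0 sequentially"
        using g[OF iI] g0[OF iI] by (intro limitin_weak_star) simp
      moreover have "u (r n) i \<in> \<Omega> i" "x (r n) i \<in> frechet_normal_cone (u (r n) i) (\<Omega> i)" for n
        using fn[OF iI, of "r n"] frechet_normal_eps_normals
        by (auto simp: frechet_normal_cone_def frechet_normal_def)
      ultimately show ?thesis
        using u_lim[OF iI]
        by (intro j(2)[OF i, unfolded SNC_at_def, rule_format, of "\<lambda>n. u (r n) i" "\<lambda>n. x (r n) i"]) auto
    qed
    have rest: "(\<lambda>n. \<Sum>i\<in>?I - {j}. norm (x (r n) i)) \<longlonglongrightarrow> 0"
      using tendsto_sum[of "?I - {j}" "\<lambda>i n. norm (x (r n) i)" "\<lambda>_. 0"] x0 by simp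
    have le: "norm (x (r n) i) \<le> norm (\<Sum>i\<in>?I. x (r n) i) + (\<Sum>i\<in>?I - {j}. norm (x (r n) i))"
      if i: "i \<in> ?I" for n i
    proof (cases "i = j")
      \<comment> \<open>For the exceptional index the sum replaces SNC: \<open>x (r n) j\<close> is
        the small total minus the other terms.\<close>
      case True
      have "(\<Sum>i\<in>?I. x (r n) i) = x (r n) j + (\<Sum>i\<in>?I - {j}. x (r n) i)"
        using j(1) by (intro sum.remove) auto
      then have "x (r n) j = (\<Sum>i\<in>?I. x (r n) i) - (\<Sum>i\<in>?I - {j}. x (r n) i)" by simp
      then have "norm (x (r n) j) \<le> norm (\<Sum>i\<in>?I. x (r n) i) + norm (\<Sum>i\<in>?I - {j}. x (r n) i)"
        using norm_triangle_ineq4 by metis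
      also have "norm (\<Sum>i\<in>?I - {j}. x (r n) i) \<le> (\<Sum>i\<in>?I - {j}. norm (x (r n) i))" by (rule norm_sum)
      finally show ?thesis using True by simp
    next
      case False
      then have "norm (x (r n) i) \<le> (\<Sum>i\<in>?I - {j}. norm (x (r n) i))"
        using i by (intro member_le_sum) auto
      then show ?thesis using norm_ge_zero[of "\<Sum>i\<in>?I. x (r n) i"] by linarith
    qed
    have "(\<lambda>n. norm (\<Sum>i\<in>?I. x (r n) i) + (\<Sum>i\<in>?I - {j}. norm (x (r n) i))) \<longlonglongrightarrow> 0"
      using tendsto_add[OF sum_lim rest] by simp
    then have "\<forall>\<^sub>F n in sequentially. norm (\<Sum>i\<in>?I. x (r n) i) + (\<Sum>i\<in>?I - {j}. norm (x (r n) i)) < 1/8"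
      by (rule order_tendstoD) simp
    then obtain n where n: "norm (\<Sum>i\<in>?I. x (r n) i) + (\<Sum>i\<in>?I - {j}. norm (x (r n) i)) < 1/8"
      using eventually_happens'[OF sequentially_bot] by blast
    obtain i where "i \<in> ?I" "norm (x (r n) i) \<ge> 1/8" using big by blast
    then show False using le[of i n] n by simp
  qed
  then obtain i0 where i0: "i0 \<in> ?I" "g i0 \<noteq> 0" by blast
  define S where "S = (\<Sum>i\<in>?I. (norm (g i))\<^sup>2)"
  have "(norm (g i0))\<^sup>2 \<le> S" unfolding S_def using i0(1) by (intro member_le_sum) auto
  moreover have "0 < (norm (g i0))\<^sup>2" using i0(2) by simp
  ultimately have S: "S > 0" by linarith
  define c where "c = 1 / sqrt S"
  have c: "c > 0" "c\<^sup>2 * S = 1" using S by (simp_all add: c_def power_divide)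
  \<comment> \<open>The normalising factor is applied before the limit, where Frechet normals may be
    scaled; these are exact normals, so \<open>0\<close> serves as the sequence of
    tolerances.\<close>
  show ?thesis
  proof (intro exI[of _ "\<lambda>i. c *\<^sub>R g i"] conjI ballI)
    fix i assume i: "i \<in> ?I"
    have "limitin weak_star_topology (\<lambda>n. c *\<^sub>R x (r n) i) (c *\<^sub>R g i) sequentially"
      by (intro limitin_weak_star) (simp add: blinfun.scaleR_left tendsto_mult_left g[OF i])
    moreover have "c *\<^sub>R x (r n) i \<in> eps_normals 0 (u (r n) i) (\<Omega> i)" for n
      by (intro frechet_normal_eps_normals frechet_normal_scaleR fn i c)
    ultimately show "c *\<^sub>R g i \<in> limiting_normal_cone xbar (\<Omega> i)"
      unfolding limiting_normal_cone_def using u_lim[OF i]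
      by (intro CollectI exI[of _ "\<lambda>_. 0"] exI[of _ "\<lambda>n. u (r n) i"] exI[of _ "\<lambda>n. c *\<^sub>R x (r n) i"])
        (simp add: decseq_def)
  next
    show "(\<Sum>i=1..m. c *\<^sub>R g i) = 0" using sum0 by (simp flip: scaleR_sum_right)
    have "(\<Sum>i=1..m. (norm (c *\<^sub>R g i))\<^sup>2) = c\<^sup>2 * S"
      using c(1) by (simp add: S_def power_mult_distrib sum_distrib_left)
    then show "(\<Sum>i=1..m. (norm (c *\<^sub>R g i))\<^sup>2) = 1" using c(2) by simp
  qed
qed

end
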